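(* Let $M$ be a compact, orientable Riemannian manifold of dimension $n$, let $p$ be an integer with $0\le p\le n$, and let $G:E^p(M)\to (H^p)^{\perp}$ be the operator sending $\alpha$ to the unique solution $G\alpha\in(H^p)^\perp$ of $\Delta G\alpha=\alpha-H(\alpha)$. Then the eigenvalues of $G$ acting on $(H^p)^{\perp}$ are the reciprocals of the nonzero eigenvalues of $\Delta$ acting on $(H^p)^{\perp}$.
   Context: Manifolds are smooth and without boundary, and an orientation of $M$ is fixed. $E^p(M)$ is the real vector space of smooth $p$-forms on $M$, with inner product $(\alpha,\beta)=\int_M \alpha\wedge *\beta$, where $*$ is the Hodge star operator. $d$ is the exterior derivative and $\delta$ is its adjoint with respect to these inner products, i.e. $(d\alpha,\beta)=(\alpha,\delta\beta)$ for $\alpha$ of degree $p$ and $\beta$ of degree $p+1$. The Laplace-Beltrami operator is $\Delta=d\delta+\delta d: E^p(M)\to E^p(M)$, and $H^p=\{\omega\in E^p(M):\Delta\omega=0\}$ is the (finite-dimensional) space of harmonic $p$-forms. $(H^p)^{\perp}$ is the subspace of $E^p(M)$ of all forms orthogonal to $H^p$; both $\Delta$ and $G$ map $(H^p)^\perp$ into itself. $H:E^p(M)\to H^p$ is the orthogonal projection. For every $\alpha\in E^p(M)$ the equation $\Delta\beta=\alpha-H(\alpha)$ has exactly one solution $\beta\in(H^p)^\perp$, so $G$ is well defined. An eigenvalue of an operator $T$ (here $T=\Delta$ or $T=G$) acting on a space of smooth $p$-forms is a real number $\lambda$ for which there is a form $\omega$ in that space, not identically zero, with $T\omega=\lambda\omega$.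 *)

theory Defs
  imports
    "HOL-Analysis.Analysis"
    "HOL-Combinatorics.Permutations"
    "HOL-Library.Function_Algebras"
    "Jordan_Normal_Form.Determinant"
    "Jordan_Normal_Form.Gauss_Jordan_Elimination"
begin

section \<open>Calculus on n-dimensional Euclidean space\<close>

text \<open>
  The model space is the library's \<^const>\<open>Euclidean_space\<close> of dimension \<open>n\<close>, whose points are the
  \<open>x :: nat \<Rightarrow> real\<close> with \<open>x i = 0\<close> for \<open>i \<ge> n\<close>.  The dimension is thus an arbitrary natural
  number, zero included.  Its topology is induced by the product topology, which is
  also the type-class topology of \<^typ>\<open>nat \<Rightarrow> real\<close> used by \<^const>\<open>continuous_on\<close> below.
\<close>

definition partial :: "nat \<Rightarrow> ((nat \<Rightarrow> real) \<Rightarrow> real) \<Rightarrow> (nat \<Rightarrow> real) \<Rightarrow> real" where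
  "partial i f y = deriv (\<lambda>t. f (y(i := t))) (y i)"

fun Ck_on :: "nat \<Rightarrow> (nat \<Rightarrow> real) set \<Rightarrow> nat \<Rightarrow> ((nat \<Rightarrow> real) \<Rightarrow> real) \<Rightarrow> bool" where
  "Ck_on n S 0 f \<longleftrightarrow> continuous_on S f"
| "Ck_on n S (Suc k) f \<longleftrightarrow> continuous_on S f \<and>
     (\<forall>i<n. (\<forall>y\<in>S. (\<lambda>t. f (y(i := t))) differentiable (at (y i))) \<and> Ck_on n S k (partial i f))"

text \<open>Only used for sets \<open>S\<close> that are open in \<open>Euclidean_space n\<close>.\<close>

definition smooth_on :: "nat \<Rightarrow> (nat \<Rightarrow> real) set \<Rightarrow> ((nat \<Rightarrow> real) \<Rightarrow> real) \<Rightarrow> bool" where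
  "smooth_on n S f \<longleftrightarrow> (\<forall>k. Ck_on n S k f)"

text \<open>
  Lebesgue measure on \<open>Euclidean_space n\<close>: the product measure lives on functions that are
  undefined from \<open>n\<close> on, hence the change of representation.
\<close>

definition lborel_Rn :: "nat \<Rightarrow> (nat \<Rightarrow> real) measure" where
  "lborel_Rn n = distr (Pi\<^sub>M {..<n} (\<lambda>_. lborel)) borel (\<lambda>y i. if i < n then y i else 0)"


section \<open>Oriented Riemannian manifolds\<close>

text \<open>
  A chart is a domain together with a coordinate map.  A smooth structure with orientation is
  given by an atlas whose transition maps are smooth with positive Jacobian determinant (the
  atlas need not be maximal).  The metric is given by its components
  \<open>g\<^sub>i\<^sub>j\<close> at each point, with respect to each chart.
\<close>

type_synonym 'a chart = "'a set \<times> ('a \<Rightarrow> nat \<Rightarrow> real)"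

record 'a riem =
  points :: "'a topology"
  mdim :: nat
  atlas :: "'a chart set"
  metric :: "'a chart \<Rightarrow> 'a \<Rightarrow> nat \<Rightarrow> nat \<Rightarrow> real"

definition chart_inv :: "'a chart \<Rightarrow> (nat \<Rightarrow> real) \<Rightarrow> 'a" where
  "chart_inv c = inv_into (fst c) (snd c)"

definition is_chart :: "'a topology \<Rightarrow> nat \<Rightarrow> 'a chart \<Rightarrow> bool" where
  "is_chart X n c \<longleftrightarrow> openin X (fst c) \<and> openin (Euclidean_space n) (snd c ` fst c) \<and>
     homeomorphic_map (subtopology X (fst c)) (subtopology (Euclidean_space n) (snd c ` fst c)) (snd c)"

definition chart_partial :: "'a chart \<Rightarrow> nat \<Rightarrow> ('a \<Rightarrow> real) \<Rightarrow> 'a \<Rightarrow> real" where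
  "chart_partial c i f x = partial i (\<lambda>y. f (chart_inv c y)) (snd c x)"

definition smooth_in_chart :: "nat \<Rightarrow> 'a chart \<Rightarrow> ('a \<Rightarrow> real) \<Rightarrow> bool" where
  "smooth_in_chart n c f \<longleftrightarrow> smooth_on n (snd c ` fst c) (\<lambda>y. f (chart_inv c y))"

text \<open>\<open>jacobian c c' x k i\<close> is the derivative of the \<open>k\<close>-th coordinate of \<open>c'\<close> in the direction of
  the \<open>i\<close>-th coordinate of \<open>c\<close>.\<close>

definition jacobian :: "'a chart \<Rightarrow> 'a chart \<Rightarrow> 'a \<Rightarrow> nat \<Rightarrow> nat \<Rightarrow> real" where
  "jacobian c c' x k i = chart_partial c i (\<lambda>z. snd c' z k) x"

definition square_mat :: "nat \<Rightarrow> (nat \<Rightarrow> nat \<Rightarrow> real) \<Rightarrow> real mat" where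
  "square_mat n a = mat n n (\<lambda>(i, j). a i j)"

definition oriented_smooth_manifold :: "'a riem \<Rightarrow> bool" where
  "oriented_smooth_manifold M \<longleftrightarrow>
     Hausdorff_space (points M) \<and> second_countable (points M) \<and>
     (\<forall>c\<in>atlas M. is_chart (points M) (mdim M) c) \<and>
     topspace (points M) = (\<Union>c\<in>atlas M. fst c) \<and>
     (\<forall>c\<in>atlas M. \<forall>c'\<in>atlas M.
        (\<forall>k<mdim M. smooth_on (mdim M) (snd c ` (fst c \<inter> fst c')) (\<lambda>y. snd c' (chart_inv c y) k)) \<and>
        (\<forall>x\<in>fst c \<inter> fst c'. Determinant.det (square_mat (mdim M) (jacobian c c' x)) > 0))"

definition riemannian_metric :: "'a riem \<Rightarrow> bool" where
  "riemannian_metric M \<longleftrightarrow>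
     (\<forall>c\<in>atlas M.
        (\<forall>i<mdim M. \<forall>j<mdim M. smooth_in_chart (mdim M) c (\<lambda>x. metric M c x i j)) \<and>
        (\<forall>x\<in>fst c.
           (\<forall>i<mdim M. \<forall>j<mdim M. metric M c x i j = metric M c x j i) \<and>
           (\<forall>v. (\<exists>i<mdim M. v i \<noteq> 0) \<longrightarrow>
              (\<Sum>i<mdim M. \<Sum>j<mdim M. metric M c x i j * v i * v j) > 0)) \<and>
        (\<forall>c'\<in>atlas M. \<forall>x\<in>fst c \<inter> fst c'. \<forall>i<mdim M. \<forall>j<mdim M.
           metric M c x i j =
             (\<Sum>k<mdim M. \<Sum>l<mdim M. jacobian c c' x k i * jacobian c c' x l j * metric M c' x k l)))"

definition oriented_riemannian_manifold :: "'a riem \<Rightarrow> bool" where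
  "oriented_riemannian_manifold M \<longleftrightarrow> oriented_smooth_manifold M \<and> riemannian_metric M"


section \<open>Differential forms\<close>

text \<open>
  A \<open>p\<close>-form is an alternating covariant tensor field of rank \<open>p\<close>: \<open>\<omega> c x [i\<^sub>1, \<dots>, i\<^sub>p]\<close> is its value
  at \<open>x\<close> on the \<open>p\<close> coordinate vector fields of the chart \<open>c\<close> with these indices.  Forms
  vanish at arguments without meaning, so that equality of forms is HOL equality, and
  addition, subtraction and zero are the pointwise ones.
\<close>

type_synonym 'a form = "'a chart \<Rightarrow> 'a \<Rightarrow> nat list \<Rightarrow> real"

definition index_lists :: "nat \<Rightarrow> nat \<Rightarrow> nat list set" where
  "index_lists n p = {is. length is = p \<and> set is \<subseteq> {..<n}}"

definition forms :: "'a riem \<Rightarrow> nat \<Rightarrow> 'a form set" where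
  "forms M p = {\<omega>.
     (\<forall>c x is. \<not> (c \<in> atlas M \<and> x \<in> fst c \<and> is \<in> index_lists (mdim M) p) \<longrightarrow> \<omega> c x is = 0) \<and>
     (\<forall>c\<in>atlas M. \<forall>x\<in>fst c. \<forall>is\<in>index_lists (mdim M) p. \<forall>\<sigma>. \<sigma> permutes {..<p} \<longrightarrow>
        \<omega> c x (permute_list \<sigma> is) = of_int (sign \<sigma>) * \<omega> c x is) \<and>
     (\<forall>c\<in>atlas M. \<forall>is\<in>index_lists (mdim M) p. smooth_in_chart (mdim M) c (\<lambda>x. \<omega> c x is)) \<and>
     (\<forall>c\<in>atlas M. \<forall>c'\<in>atlas M. \<forall>x\<in>fst c \<inter> fst c'. \<forall>is\<in>index_lists (mdim M) p.
        \<omega> c x is =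
          (\<Sum>js\<in>index_lists (mdim M) p. (\<Prod>a<p. jacobian c c' x (js ! a) (is ! a)) * \<omega> c' x js))}"

definition form_scale :: "real \<Rightarrow> 'a form \<Rightarrow> 'a form" where
  "form_scale r \<omega> = (\<lambda>c x is. r * \<omega> c x is)"

definition wedge :: "nat \<Rightarrow> nat \<Rightarrow> 'a form \<Rightarrow> 'a form \<Rightarrow> 'a form" where
  "wedge p q \<alpha> \<beta> = (\<lambda>c x is.
     if length is = p + q then
       (\<Sum>\<sigma> | \<sigma> permutes {..<p + q}. of_int (sign \<sigma>) *
          \<alpha> c x (take p (permute_list \<sigma> is)) * \<beta> c x (drop p (permute_list \<sigma> is))) / (fact p * fact q)
     else 0)"

definition ext_deriv :: "'a riem \<Rightarrow> 'a form \<Rightarrow> 'a form" where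
  "ext_deriv M \<omega> = (\<lambda>c x is.
     if c \<in> atlas M \<and> x \<in> fst c \<and> set is \<subseteq> {..<mdim M} then
       (\<Sum>k<length is. (- 1) ^ k *
          chart_partial c (is ! k) (\<lambda>z. \<omega> c z (take k is @ drop (Suc k) is)) x)
     else 0)"


section \<open>Hodge star, integration and the inner product\<close>

definition levi_civita :: "nat \<Rightarrow> nat list \<Rightarrow> real" where
  "levi_civita n is =
     (if length is = n \<and> set is = {..<n}
      then of_int (sign (\<lambda>i. if i < n then is ! i else i)) else 0)"

definition inverse_metric :: "'a riem \<Rightarrow> 'a chart \<Rightarrow> 'a \<Rightarrow> nat \<Rightarrow> nat \<Rightarrow> real" where
  "inverse_metric M c x i j = the (mat_inverse (square_mat (mdim M) (metric M c x))) $$ (i, j)"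

definition raise_indices :: "'a riem \<Rightarrow> nat \<Rightarrow> 'a form \<Rightarrow> 'a form" where
  "raise_indices M p \<beta> = (\<lambda>c x is.
     \<Sum>ks\<in>index_lists (mdim M) p. (\<Prod>a<p. inverse_metric M c x (is ! a) (ks ! a)) * \<beta> c x ks)"

text \<open>
  In an oriented chart, \<open>(*\<beta>)\<^sub>J = (1/p!) sqrt (det g) \<Sum>\<^sub>I \<epsilon>\<^sub>I\<^sub>J \<beta>\<^sup>I\<close>; with this convention
  \<open>\<alpha> \<and> *\<beta> = \<langle>\<alpha>,\<beta>\<rangle> vol\<close>.
\<close>

definition hodge_star :: "'a riem \<Rightarrow> nat \<Rightarrow> 'a form \<Rightarrow> 'a form" where
  "hodge_star M p \<beta> = (\<lambda>c x js.
     sqrt (Determinant.det (square_mat (mdim M) (metric M c x))) / fact p *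
     (\<Sum>is\<in>index_lists (mdim M) p. levi_civita (mdim M) (is @ js) * raise_indices M p \<beta> c x is))"

text \<open>
  The integral of an \<open>n\<close>-form over a compact oriented manifold, by a finite partition of unity
  subordinate to the atlas.  By the change of variables formula the result does not depend on the
  partition; continuity of the partition functions is enough for this.
\<close>

definition partition_of_unity :: "'a riem \<Rightarrow> 'a chart set \<Rightarrow> ('a chart \<Rightarrow> 'a \<Rightarrow> real) \<Rightarrow> bool" where
  "partition_of_unity M F \<rho> \<longleftrightarrow> finite F \<and> F \<subseteq> atlas M \<and>
     (\<forall>c\<in>F. continuous_map (points M) euclideanreal (\<rho> c) \<and>
        (\<forall>x\<in>topspace (points M). \<rho> c x \<ge> 0) \<and>
        points M closure_of {x \<in> topspace (points M). \<rho> c x \<noteq> 0} \<subseteq> fst c) \<and>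
     (\<forall>x\<in>topspace (points M). (\<Sum>c\<in>F. \<rho> c x) = 1)"

definition form_integral :: "'a riem \<Rightarrow> 'a form \<Rightarrow> real" where
  "form_integral M \<omega> =
     (let (F, \<rho>) = (SOME (F, \<rho>). partition_of_unity M F \<rho>)
      in \<Sum>c\<in>F. set_lebesgue_integral (lborel_Rn (mdim M)) (snd c ` fst c)
           (\<lambda>y. \<rho> c (chart_inv c y) * \<omega> c (chart_inv c y) [0..<mdim M]))"

definition form_inner :: "'a riem \<Rightarrow> nat \<Rightarrow> 'a form \<Rightarrow> 'a form \<Rightarrow> real" where
  "form_inner M p \<alpha> \<beta> = form_integral M (wedge p (mdim M - p) \<alpha> (hodge_star M p \<beta>))"


section \<open>The Laplace-Beltrami operator and Green's operator\<close>

text \<open>\<open>\<delta>\<close> is the adjoint of \<open>d\<close> in all degrees; there are no forms of degree \<open>-1\<close>, so it is zero on functions.\<close>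

definition codifferential :: "'a riem \<Rightarrow> ('a form \<Rightarrow> 'a form) \<Rightarrow> bool" where
  "codifferential M \<delta> \<longleftrightarrow>
     (\<forall>f\<in>forms M 0. \<delta> f = 0) \<and>
     (\<forall>k. \<forall>\<beta>\<in>forms M (Suc k). \<delta> \<beta> \<in> forms M k \<and>
        (\<forall>\<alpha>\<in>forms M k. form_inner M (Suc k) (ext_deriv M \<alpha>) \<beta> = form_inner M k \<alpha> (\<delta> \<beta>)))"

definition laplacian :: "'a riem \<Rightarrow> ('a form \<Rightarrow> 'a form) \<Rightarrow> 'a form \<Rightarrow> 'a form" where
  "laplacian M \<delta> \<omega> = ext_deriv M (\<delta> \<omega>) + \<delta> (ext_deriv M \<omega>)"

definition harmonic_forms :: "'a riem \<Rightarrow> ('a form \<Rightarrow> 'a form) \<Rightarrow> nat \<Rightarrow> 'a form set" where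
  "harmonic_forms M \<delta> p = {\<omega> \<in> forms M p. laplacian M \<delta> \<omega> = 0}"

definition harmonic_perp :: "'a riem \<Rightarrow> ('a form \<Rightarrow> 'a form) \<Rightarrow> nat \<Rightarrow> 'a form set" where
  "harmonic_perp M \<delta> p = {\<omega> \<in> forms M p. \<forall>h\<in>harmonic_forms M \<delta> p. form_inner M p \<omega> h = 0}"

definition harmonic_proj :: "'a riem \<Rightarrow> ('a form \<Rightarrow> 'a form) \<Rightarrow> nat \<Rightarrow> 'a form \<Rightarrow> 'a form" where
  "harmonic_proj M \<delta> p \<alpha> = (THE h. h \<in> harmonic_forms M \<delta> p \<and> \<alpha> - h \<in> harmonic_perp M \<delta> p)"

text \<open>At most one \<open>\<beta> \<in> harmonic_perp M \<delta> p\<close> solves \<open>laplacian M \<delta> \<beta> = \<alpha> - harmonic_proj M \<delta> p \<alpha>\<close>, as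
  two solutions differ by a form that is both harmonic and orthogonal to the harmonic forms;
  the predicate therefore determines \<open>G\<close> on \<open>forms M p\<close>.\<close>

definition green_operator ::
    "'a riem \<Rightarrow> ('a form \<Rightarrow> 'a form) \<Rightarrow> nat \<Rightarrow> ('a form \<Rightarrow> 'a form) \<Rightarrow> bool" where
  "green_operator M \<delta> p G \<longleftrightarrow>
     (\<forall>\<alpha>\<in>forms M p. G \<alpha> \<in> harmonic_perp M \<delta> p \<and>
        laplacian M \<delta> (G \<alpha>) = \<alpha> - harmonic_proj M \<delta> p \<alpha>)"

definition eigenvalue_on :: "'a form set \<Rightarrow> ('a form \<Rightarrow> 'a form) \<Rightarrow> real \<Rightarrow> bool" where
  "eigenvalue_on V T r \<longleftrightarrow> (\<exists>\<omega>\<in>V. \<omega> \<noteq> 0 \<and> T \<omega> = form_scale r \<omega>)"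

end

theory Submission
  imports Defs
begin

text \<open>
  On the orthogonal complement of the harmonic forms \<open>H\<close> vanishes, so \<open>\<Delta> (G \<omega>) = \<omega>\<close> there, and \<open>\<Delta>\<close> is
  injective because a form that is harmonic and orthogonal to the harmonic forms is orthogonal to
  itself.  Hence \<open>G \<omega> = r \<omega>\<close> is equivalent to \<open>\<Delta> \<omega> = \<omega> / r\<close>.

  What this uses is that the inner product is bilinear and definite and that \<open>\<Delta>\<close> is linear.
  Linearity of the adjoint \<open>\<delta>\<close> follows from definiteness, once \<open>d\<close> is known to map forms to forms:
  the second derivatives of the transition maps are symmetric and cancel after antisymmetrization.
  Definiteness is a pointwise statement: \<open>\<alpha> \<and> *\<alpha>\<close> is a positive multiple of the quadratic form of a
  tensor power of the inverse metric, and it passes to the integral because the integrand is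
  continuous with compact support in each chart of a partition of unity.
\<close>

section \<open>Alternating functions of index lists\<close>

text \<open>\<delta> is any function that satisfies the adjointness identity, so everything about it
  has to come from that identity. Its linearity is tested against its own defect of linearity;
  moving \<delta> across the inner product then puts the exterior derivative of the defect there,
  and bilinearity applies to it only because \<open>ext_deriv\<close> respects the change of charts.
  The top degree is delicate: the derivative of an n-form has degree n + 1, where the wedge in
  \<open>form_inner\<close> takes its default value zero, so definiteness is invoked only after
  \<delta> has come down to degree at most n. Components are indexed by all index lists, not only by
  increasing ones. Every contraction counts an index set several times, and the permutation sums
  produce factorials that have to cancel. \<open>form_integral\<close> picks its partition of unity
  by \<open>SOME\<close>. Existence gives the pick its properties, and since the pick depends on the
  manifold alone, bilinearity can be checked chart by chart.\<close>

lemma index_lists_0 [simp]: "index_lists n 0 = {[]}"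
  by (auto simp: index_lists_def)

lemma index_lists_Suc: "index_lists n (Suc p) = (\<lambda>(i, ns). i # ns) ` ({..<n} \<times> index_lists n p)"
proof -
  have "x \<in> index_lists n (Suc p) \<longleftrightarrow> (\<exists>i js. x = i # js \<and> i < n \<and> js \<in> index_lists n p)" for x
    by (cases x) (auto simp: index_lists_def)
  then show ?thesis by (force simp: set_eq_iff)
qed

lemma finite_index_lists [simp]: "finite (index_lists n p)"
  by (induction p) (simp_all add: index_lists_Suc)

lemma sum_index_lists_Suc:
  "(\<Sum>js\<in>index_lists n (Suc p). f js) = (\<Sum>i<n. \<Sum>js\<in>index_lists n p. f (i # js))"
proof -
  have "inj_on (\<lambda>(i, ns). i # ns) ({..<n} \<times> index_lists n p)" by (auto simp: inj_on_def)
  then show ?thesis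
    by (simp add: index_lists_Suc sum.reindex sum.cartesian_product case_prod_unfold)
qed

text \<open>Expanding a product of sums chooses one summand in each factor, and an index list is
  such a choice. Contractions of tensor powers thereby split into contractions of single
  matrices.\<close>

lemma sum_index_lists_prod:
  fixes F :: "nat \<Rightarrow> nat \<Rightarrow> 'a::comm_semiring_1"
  shows "(\<Sum>js\<in>index_lists n p. \<Prod>a<p. F a (js ! a)) = (\<Prod>a<p. \<Sum>j<n. F a j)"
proof (induction p arbitrary: F)
  case (Suc p)
  have "(\<Sum>js\<in>index_lists n (Suc p). \<Prod>a<Suc p. F a (js ! a))
      = (\<Sum>i<n. \<Sum>js\<in>index_lists n p. F 0 i * (\<Prod>a<p. F (Suc a) (js ! a)))"
    by (simp add: sum_index_lists_Suc prod.lessThan_Suc_shift del: prod.lessThan_Suc)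
  also have "\<dots> = (\<Sum>i<n. F 0 i) * (\<Prod>a<p. \<Sum>j<n. F (Suc a) j)"
    by (simp add: sum_distrib_left[symmetric] sum_distrib_right[symmetric] Suc.IH[of "\<lambda>a. F (Suc a)"])
  finally show ?case by (simp add: prod.lessThan_Suc_shift del: prod.lessThan_Suc)
qed simp

lemma index_lists_nth: "ns \<in> index_lists n p \<Longrightarrow> a < p \<Longrightarrow> ns ! a < n"
  unfolding index_lists_def using nth_mem by blast

lemma permute_list_index_lists:
  "\<sigma> permutes {..<p} \<Longrightarrow> ns \<in> index_lists n p \<Longrightarrow> permute_list \<sigma> ns \<in> index_lists n p"
  by (auto simp: index_lists_def)

lemma permute_list_inverse:
  assumes "\<sigma> permutes {..<length ns}"
  shows "permute_list \<sigma> (permute_list (Hilbert_Choice.inv \<sigma>) ns) = ns" "permute_list (Hilbert_Choice.inv \<sigma>) (permute_list \<sigma> ns) = ns"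
  using permute_list_compose[OF assms, of "Hilbert_Choice.inv \<sigma>"] permute_list_compose[OF permutes_inv[OF assms], of \<sigma>]
    permutes_inv_o[OF assms] by simp_all

lemma bij_betw_permute_list:
  assumes "\<sigma> permutes {..<p}"
  shows "bij_betw (permute_list \<sigma>) (index_lists n p) (index_lists n p)"
proof (rule bij_betw_byWitness[where f' = "permute_list (Hilbert_Choice.inv \<sigma>)"])
  show "\<forall>ns\<in>index_lists n p. permute_list (Hilbert_Choice.inv \<sigma>) (permute_list \<sigma> ns) = ns"
    "\<forall>ns\<in>index_lists n p. permute_list \<sigma> (permute_list (Hilbert_Choice.inv \<sigma>) ns) = ns"
    using assms by (auto simp: index_lists_def intro: permute_list_inverse)
  show "permute_list \<sigma> ` index_lists n p \<subseteq> index_lists n p"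
    "permute_list (Hilbert_Choice.inv \<sigma>) ` index_lists n p \<subseteq> index_lists n p"
    using assms permute_list_index_lists permutes_inv by blast+
qed

lemma sum_index_lists_permute:
  "\<sigma> permutes {..<p} \<Longrightarrow> (\<Sum>js\<in>index_lists n p. f (permute_list \<sigma> js)) = (\<Sum>js\<in>index_lists n p. f js)"
  using sum.reindex_bij_betw[OF bij_betw_permute_list] .

text \<open>The symmetry clause of \<open>forms\<close> at a single point, isolated so that it also
  applies to raised components and to partial derivatives of components.\<close>

definition alternating :: "nat \<Rightarrow> nat \<Rightarrow> (nat list \<Rightarrow> real) \<Rightarrow> bool" where
  "alternating n p A \<longleftrightarrow> (\<forall>ns\<in>index_lists n p. \<forall>\<sigma>. \<sigma> permutes {..<p} \<longrightarrow>
     A (permute_list \<sigma> ns) = of_int (sign \<sigma>) * A ns)"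

lemma alternatingD:
  "alternating n p A \<Longrightarrow> ns \<in> index_lists n p \<Longrightarrow> \<sigma> permutes {..<p} \<Longrightarrow>
    A (permute_list \<sigma> ns) = of_int (sign \<sigma>) * A ns"
  unfolding alternating_def by blast

lemma alternating_adjacent_swap:
  assumes "alternating n p A" "us @ a # b # ys \<in> index_lists n p"
  shows "A (us @ a # b # ys) = - A (us @ b # a # ys)"
proof -
  let ?t = "Transposition.transpose (length us) (Suc (length us))"
  have t: "?t permutes {..<p}" using assms(2) by (intro permutes_swap_id) (auto simp: index_lists_def)
  have "permute_list ?t (us @ b # a # ys) = us @ a # b # ys"
  proof (rule nth_equalityI)
    fix i assume "i < length (permute_list ?t (us @ b # a # ys))"
    then have i: "i < p" using assms(2) by (auto simp: index_lists_def)
    have "permute_list ?t (us @ b # a # ys) ! i = (us @ b # a # ys) ! ?t i"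
      using t i assms(2) by (intro permute_list_nth) (auto simp: index_lists_def)
    also have "\<dots> = (us @ a # b # ys) ! i"
      by (auto simp: Transposition.transpose_def nth_append nth_Cons split: nat.split)
    finally show "permute_list ?t (us @ b # a # ys) ! i = (us @ a # b # ys) ! i" .
  qed simp
  moreover have "us @ b # a # ys \<in> index_lists n p" using assms(2) by (auto simp: index_lists_def)
  ultimately show ?thesis using alternatingD[OF assms(1) _ t, of "us @ b # a # ys"] by (simp add: sign_swap_id)
qed

text \<open>Each entry that \<open>a\<close> passes costs one adjacent swap. This is the source of
  the signs \<open>(- 1) ^ k\<close> in the exterior derivative.\<close>

lemma alternating_move:
  assumes "alternating n p A" "us @ a # xs @ ys \<in> index_lists n p"
  shows "A (us @ a # xs @ ys) = (- 1) ^ length xs * A (us @ xs @ a # ys)"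
  using assms(2)
proof (induction xs arbitrary: us)
  case (Cons x xs)
  have "A (us @ a # (x # xs) @ ys) = - A ((us @ [x]) @ a # xs @ ys)"
    using alternating_adjacent_swap[OF assms(1), of us a x "xs @ ys"] Cons.prems by simp
  also have "\<dots> = - ((- 1) ^ length xs * A ((us @ [x]) @ xs @ a # ys))"
    using Cons.prems by (subst Cons.IH) (auto simp: index_lists_def)
  finally show ?case by simp
qed simp

text \<open>Exchanging two equal entries fixes the list but reverses the sign of the value.\<close>

lemma alternating_not_distinct:
  assumes "alternating n p A" "ns \<in> index_lists n p" "\<not> distinct ns"
  shows "A ns = 0"
proof -
  obtain a b where ab: "a < length ns" "b < length ns" "a \<noteq> b" "ns ! a = ns ! b"
    using assms(3) by (auto simp: distinct_conv_nth)
  have t: "Transposition.transpose a b permutes {..<length ns}" using ab by (intro permutes_swap_id) auto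
  have "permute_list (Transposition.transpose a b) ns = ns"
    using ab t by (intro nth_equalityI) (auto simp: permute_list_nth Transposition.transpose_def)
  then show ?thesis
    using alternatingD[OF assms(1,2), of "Transposition.transpose a b"] t ab assms(2) by (simp add: sign_swap_id index_lists_def)
qed

section \<open>Sums over permutations: antisymmetrization, Levi-Civita symbol, cancellation\<close>

lemma permutes_shift:
  assumes "q permutes {Suc 0..<Suc p}"
  obtains \<tau> where "\<tau> permutes {..<p}" "sign \<tau> = sign q" "\<And>i. i < p \<Longrightarrow> q (Suc i) = Suc (\<tau> i)"
proof
  let ?S = "{Suc 0..<Suc p}" and ?f = "\<lambda>i::nat. i - 1"
  let ?t = "map_permutation ?S ?f q"
  have inj: "inj_on ?f ?S" by (auto simp: inj_on_def)
  have im: "?f ` ?S = {..<p}" by (force simp: image_iff)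
  show "?t permutes {..<p}"
    using map_permutation_permutes[OF _ assms, of ?f "{..<p}"] inj im by (simp add: bij_betw_def)
  show "sign ?t = sign q" using assms inj by (intro sign_map_permutation) auto
  show "q (Suc i) = Suc (?t i)" if "i < p" for i
  proof -
    have "?t (?f (Suc i)) = ?f (q (Suc i))" using inj that by (intro map_permutation_apply) auto
    moreover have "q (Suc i) \<in> ?S" using permutes_in_image[OF assms, of "Suc i"] that by auto
    ultimately show ?thesis by auto
  qed
qed

text \<open>Every permutation of p + 1 positions is uniquely a transposition of 0 with some b,
  composed with a q that fixes 0. Here b tells which entry comes first, and q only rearranges the
  alternating arguments, so its two signs cancel and each b is counted p! times. This turns an
  antisymmetrization into the deletion formula of \<open>ext_deriv\<close>.\<close>

lemma sum_permutations_Cons: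
  fixes T :: "nat list \<Rightarrow> real"
  assumes alt: "\<And>i. i < n \<Longrightarrow> alternating n p (\<lambda>js. T (i # js))" and ns: "ns \<in> index_lists n (Suc p)"
  shows "(\<Sum>\<sigma> | \<sigma> permutes {..<Suc p}. of_int (sign \<sigma>) * T (permute_list \<sigma> ns))
     = fact p * (\<Sum>k<Suc p. (- 1) ^ k * T (ns ! k # take k ns @ drop (Suc k) ns))"
proof -
  let ?S = "{Suc 0..<Suc p}"
  have S: "{..<Suc p} = insert 0 ?S" by auto
  have len: "length ns = Suc p" and lt: "\<And>k. k < Suc p \<Longrightarrow> ns ! k < n"
    using ns nth_mem[of _ "ns"] by (auto simp: index_lists_def subset_iff)
  have main: "of_int (sign (Transposition.transpose 0 b \<circ> q)) * T (permute_list (Transposition.transpose 0 b \<circ> q) ns)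
      = (- 1) ^ b * T (ns ! b # take b ns @ drop (Suc b) ns)"
    if b: "b < Suc p" and q: "q permutes ?S" for b q
  proof -
    obtain \<tau> where \<tau>: "\<tau> permutes {..<p}" "sign \<tau> = sign q" "\<And>i. i < p \<Longrightarrow> q (Suc i) = Suc (\<tau> i)"
      using permutes_shift[OF q] by blast
    have q0: "q 0 = 0" using q by (auto simp: permutes_def)
    have q': "q permutes {..<length ns}" using q by (rule permutes_subset) (auto simp: len)
    have t': "Transposition.transpose 0 b permutes {..<length ns}" using b len by (intro permutes_swap_id) auto
    \<comment> \<open>\<open>L\<close> is what follows the leading entry \<open>ns ! b\<close> once
      positions 0 and b are exchanged. On it q acts as \<tau>, up to the shift by one.\<close>
    define L where "L = tl (permute_list (Transposition.transpose 0 b) ns)"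
    have L: "permute_list (Transposition.transpose 0 b) ns = ns ! b # L"
    proof -
      have "permute_list (Transposition.transpose 0 b) ns \<noteq> []" using len by (metis length_permute_list list.size(3) nat.distinct(1))
      moreover have "permute_list (Transposition.transpose 0 b) ns ! 0 = ns ! b" using t' len by (simp add: permute_list_nth)
      ultimately show ?thesis unfolding L_def by (metis hd_conv_nth list.collapse)
    qed
    have Ll: "L \<in> index_lists n p"
      using permute_list_index_lists[OF t'[unfolded len] ns] unfolding L by (auto simp: index_lists_def)
    have lenL: "length L = p" using Ll by (simp add: index_lists_def)
    have "permute_list (Transposition.transpose 0 b \<circ> q) ns = permute_list q (ns ! b # L)"
      using permute_list_compose[OF q', of "Transposition.transpose 0 b"] L by simp
    also have "\<dots> = ns ! b # permute_list \<tau> L"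
    proof (rule nth_equalityI)
      fix i assume "i < length (permute_list q (ns ! b # L))"
      then have i: "i < Suc p" by (simp add: lenL)
      have "permute_list q (ns ! b # L) ! i = (ns ! b # L) ! q i"
        using q' i by (intro permute_list_nth) (auto simp: lenL len)
      also have "\<dots> = (ns ! b # permute_list \<tau> L) ! i"
        using i q0 \<tau> by (cases i) (simp_all add: permute_list_nth lenL)
      finally show "permute_list q (ns ! b # L) ! i = (ns ! b # permute_list \<tau> L) ! i" .
    qed simp
    finally have 1: "T (permute_list (Transposition.transpose 0 b \<circ> q) ns) = of_int (sign q) * T (ns ! b # L)"
      using alternatingD[OF alt[OF lt[OF b]] Ll \<tau>(1)] \<tau>(2) by simp
    have sg: "sign (Transposition.transpose 0 b \<circ> q) = sign (Transposition.transpose 0 b) * sign q"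
      using q' t' by (intro sign_compose permutes_imp_permutation[of "{..<length ns}"]) auto
    have sq: "of_int (sign q) * (of_int (sign q) * x) = (x::real)" for x
      by (metis mult.assoc mult_1 of_int_1 of_int_mult sign_idempotent)
    have 2: "of_int (sign (Transposition.transpose 0 b \<circ> q)) * T (permute_list (Transposition.transpose 0 b \<circ> q) ns)
        = of_int (sign (Transposition.transpose 0 b)) * T (ns ! b # L)"
      unfolding 1 sg by (simp add: sq mult.assoc)
    show ?thesis
    proof (cases "b = 0")
      case True
      then have "L = tl ns" unfolding L_def by simp
      then show ?thesis using 2 True by (simp add: drop_Suc)
    next
      case False
      \<comment> \<open>The transposition puts \<open>ns ! 0\<close> behind \<open>xs\<close>,
        whereas deletion of position b leaves it in front. Since \<open>xs\<close> has b - 1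
        entries, the move costs \<open>(- 1) ^ (b - 1)\<close>; with the sign -1 of the
        transposition this makes \<open>(- 1) ^ b\<close>.\<close>
      define xs ys where "xs = take (b - 1) (tl ns)" and "ys = drop (Suc b) ns"
      have isx: "ns = ns ! 0 # xs @ ns ! b # ys"
      proof -
        have "ns = ns ! 0 # tl ns" using len by (cases "ns") auto
        moreover have "tl ns = xs @ ns ! b # ys"
          using id_take_nth_drop[of "b - 1" "tl ns"] False b len
          by (simp add: xs_def ys_def nth_tl drop_Suc)
        ultimately show ?thesis by metis
      qed
      have lx: "length xs = b - 1" using b len by (simp add: xs_def)
      have "permute_list (Transposition.transpose 0 b) ns = ns ! b # xs @ ns ! 0 # ys"
      proof (rule nth_equalityI)
        show "length (permute_list (Transposition.transpose 0 b) ns) = length (ns ! b # xs @ ns ! 0 # ys)"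
          using arg_cong[OF isx, of length] by simp
        fix i assume "i < length (permute_list (Transposition.transpose 0 b) ns)"
        then have "permute_list (Transposition.transpose 0 b) ns ! i = ns ! Transposition.transpose 0 b i"
          using t' by (simp add: permute_list_nth)
        also have "\<dots> = (ns ! b # xs @ ns ! 0 # ys) ! i"
        proof -
          consider "i = 0" | "i = b" | "i \<noteq> 0" "i \<noteq> b" by blast
          then show ?thesis
          proof cases
            case 3
            then have "Transposition.transpose 0 b i = i" by (simp add: Transposition.transpose_def)
            moreover have "ns ! i = (ns ! 0 # xs @ ns ! b # ys) ! i" using isx by simp
            moreover have "(ns ! 0 # xs @ ns ! b # ys) ! i = (ns ! b # xs @ ns ! 0 # ys) ! i"
              using 3 lx False by (cases i) (auto simp: nth_append nth_Cons split: nat.split)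
            ultimately show ?thesis by simp
          qed (use lx False in \<open>auto simp: nth_append nth_Cons split: nat.split\<close>)
        qed
        finally show "permute_list (Transposition.transpose 0 b) ns ! i = (ns ! b # xs @ ns ! 0 # ys) ! i" .
      qed
      then have Lx: "L = xs @ ns ! 0 # ys" using L by simp
      have tk: "take b ns @ drop (Suc b) ns = ns ! 0 # xs @ ys"
      proof -
        have "take b ns = ns ! 0 # xs" using False lx arg_cong[OF isx, of "take b"] by (cases b) auto
        then show ?thesis by (simp add: ys_def)
      qed
      have "T (ns ! b # ns ! 0 # xs @ ys) = (- 1) ^ (b - 1) * T (ns ! b # xs @ ns ! 0 # ys)"
      proof -
        have "[] @ ns ! 0 # xs @ ys \<in> index_lists n p" using Ll Lx by (auto simp: index_lists_def)
        from alternating_move[OF alt[OF lt[OF b]] this] show ?thesis by (simp add: lx)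
      qed
      moreover have "(- 1) ^ b * (- 1) ^ (b - 1) = (- 1 :: real)"
        using False by (cases b) (auto simp: power_mult_distrib[symmetric])
      ultimately have "(- 1) ^ b * T (ns ! b # take b ns @ drop (Suc b) ns) = - T (ns ! b # L)"
        unfolding tk Lx by (simp add: mult.assoc[symmetric])
      then show ?thesis using 2 False by (simp add: sign_swap_id)
    qed
  qed
  have "(\<Sum>\<sigma> | \<sigma> permutes {..<Suc p}. of_int (sign \<sigma>) * T (permute_list \<sigma> ns))
      = (\<Sum>b\<in>insert 0 ?S. \<Sum>q | q permutes ?S.
          of_int (sign (Transposition.transpose 0 b \<circ> q)) * T (permute_list (Transposition.transpose 0 b \<circ> q) ns))"
    unfolding S by (rule sum_over_permutations_insert) auto
  also have "\<dots> = (\<Sum>b<Suc p. \<Sum>q | q permutes ?S. (- 1) ^ b * T (ns ! b # take b ns @ drop (Suc b) ns))"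
    unfolding S[symmetric] using main by (intro sum.cong) auto
  also have "\<dots> = (\<Sum>b<Suc p. fact p * ((- 1) ^ b * T (ns ! b # take b ns @ drop (Suc b) ns)))"
    using card_permutations[of ?S p] by simp
  finally show ?thesis by (simp only: sum_distrib_left)
qed

text \<open>Reindexing by left composition with \<tau> multiplies every sign by that of \<tau>;
  hence an antisymmetrization is alternating.\<close>

lemma sum_permutations_compose_list:
  fixes T :: "nat list \<Rightarrow> real"
  assumes "\<tau> permutes {..<length ns}"
  shows "(\<Sum>\<sigma> | \<sigma> permutes {..<length ns}. of_int (sign \<sigma>) * T (permute_list \<sigma> (permute_list \<tau> ns)))
    = of_int (sign \<tau>) * (\<Sum>\<sigma> | \<sigma> permutes {..<length ns}. of_int (sign \<sigma>) * T (permute_list \<sigma> ns))"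
proof -
  have "(\<Sum>\<sigma> | \<sigma> permutes {..<length ns}. of_int (sign \<sigma>) * T (permute_list \<sigma> ns))
      = (\<Sum>\<sigma> | \<sigma> permutes {..<length ns}. of_int (sign (\<tau> \<circ> \<sigma>)) * T (permute_list (\<tau> \<circ> \<sigma>) ns))"
    by (rule setum_permutations_compose_left[OF assms])
  also have "\<dots> = (\<Sum>\<sigma> | \<sigma> permutes {..<length ns}. of_int (sign \<tau>) * (of_int (sign \<sigma>) * T (permute_list \<sigma> (permute_list \<tau> ns))))"
  proof (rule sum.cong)
    fix \<sigma> assume "\<sigma> \<in> {\<sigma>. \<sigma> permutes {..<length ns}}"
    then have \<sigma>: "\<sigma> permutes {..<length ns}" by simp
    have "sign (\<tau> \<circ> \<sigma>) = sign \<tau> * sign \<sigma>"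
      using assms \<sigma> by (intro sign_compose permutes_imp_permutation[of "{..<length ns}"]) auto
    then show "of_int (sign (\<tau> \<circ> \<sigma>)) * T (permute_list (\<tau> \<circ> \<sigma>) ns)
      = of_int (sign \<tau>) * (of_int (sign \<sigma>) * T (permute_list \<sigma> (permute_list \<tau> ns)))"
      using permute_list_compose[OF \<sigma>, of \<tau>] by simp
  qed simp
  finally have "(\<Sum>\<sigma> | \<sigma> permutes {..<length ns}. of_int (sign \<sigma>) * T (permute_list \<sigma> ns))
      = of_int (sign \<tau>) * (\<Sum>\<sigma> | \<sigma> permutes {..<length ns}. of_int (sign \<sigma>) * T (permute_list \<sigma> (permute_list \<tau> ns)))"
    by (simp only: sum_distrib_left)
  then show ?thesis
    by (simp add: mult.assoc[symmetric] of_int_mult[symmetric] del: of_int_mult)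
qed

text \<open>Right composition with the odd q reverses every sign and keeps every value, so the sum
  is its own negative.\<close>

lemma sum_permutations_cancel:
  fixes g :: "(nat \<Rightarrow> nat) \<Rightarrow> real"
  assumes "finite S" "q permutes S" "sign q = - 1" "\<And>\<sigma>. \<sigma> permutes S \<Longrightarrow> g (\<sigma> \<circ> q) = g \<sigma>"
  shows "(\<Sum>\<sigma> | \<sigma> permutes S. of_int (sign \<sigma>) * g \<sigma>) = 0"
proof -
  have "(\<Sum>\<sigma> | \<sigma> permutes S. of_int (sign \<sigma>) * g \<sigma>) = (\<Sum>\<sigma> | \<sigma> permutes S. of_int (sign (\<sigma> \<circ> q)) * g (\<sigma> \<circ> q))"
    by (rule sum_permutations_compose_right[OF assms(2)])
  also have "\<dots> = (\<Sum>\<sigma> | \<sigma> permutes S. - (of_int (sign \<sigma>) * g \<sigma>))"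
  proof (rule sum.cong)
    fix \<sigma> assume "\<sigma> \<in> {\<sigma>. \<sigma> permutes S}"
    then have \<sigma>: "\<sigma> permutes S" by simp
    have "sign (\<sigma> \<circ> q) = sign \<sigma> * sign q"
      by (intro sign_compose permutes_imp_permutation[OF assms(1)] \<sigma> assms(2))
    moreover have "g (\<sigma> \<circ> q) = g \<sigma>" using assms(4) \<sigma> .
    ultimately show "of_int (sign (\<sigma> \<circ> q)) * g (\<sigma> \<circ> q) = - (of_int (sign \<sigma>) * g \<sigma>)" using assms(3) by simp
  qed simp
  finally show ?thesis by (simp add: sum_negf)
qed


text \<open>Permuting \<open>ls\<close> and \<open>ns\<close> simultaneously only reorders the
  factors of the Jacobian product. So antisymmetrization commutes with the tensorial change of
  coordinates.\<close>

lemma sum_index_lists_transform: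
  fixes J :: "nat \<Rightarrow> nat \<Rightarrow> real" and T :: "nat list \<Rightarrow> real"
  assumes "length ns = m"
  shows "(\<Sum>\<sigma> | \<sigma> permutes {..<m}. of_int (sign \<sigma>) *
       (\<Sum>ls\<in>index_lists n m. (\<Prod>a<m. J (ls ! a) (permute_list \<sigma> ns ! a)) * T ls))
    = (\<Sum>ls\<in>index_lists n m. (\<Prod>a<m. J (ls ! a) (ns ! a)) *
        (\<Sum>\<sigma> | \<sigma> permutes {..<m}. of_int (sign \<sigma>) * T (permute_list \<sigma> ls)))"
proof -
  have "(\<Sum>ls\<in>index_lists n m. (\<Prod>a<m. J (ls ! a) (permute_list \<sigma> ns ! a)) * T ls)
      = (\<Sum>ls\<in>index_lists n m. (\<Prod>a<m. J (ls ! a) (ns ! a)) * T (permute_list \<sigma> ls))"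
    if \<sigma>: "\<sigma> permutes {..<m}" for \<sigma>
  proof -
    have "(\<Sum>ls\<in>index_lists n m. (\<Prod>a<m. J (ls ! a) (permute_list \<sigma> ns ! a)) * T ls)
        = (\<Sum>ls\<in>index_lists n m. (\<Prod>a<m. J (permute_list \<sigma> ls ! a) (permute_list \<sigma> ns ! a)) * T (permute_list \<sigma> ls))"
      by (rule sum_index_lists_permute[OF \<sigma>, symmetric])
    also have "\<dots> = (\<Sum>ls\<in>index_lists n m. (\<Prod>a<m. J (ls ! a) (ns ! a)) * T (permute_list \<sigma> ls))"
    proof (rule sum.cong)
      fix ls assume "ls \<in> index_lists n m"
      then have l: "length ls = m" by (simp add: index_lists_def)
      have "(\<Prod>a<m. J (permute_list \<sigma> ls ! a) (permute_list \<sigma> ns ! a)) = (\<Prod>a<m. J (ls ! \<sigma> a) (ns ! \<sigma> a))"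
        using \<sigma> l assms by (intro prod.cong) (simp_all add: permute_list_nth)
      also have "\<dots> = (\<Prod>a<m. J (ls ! a) (ns ! a))"
        using prod.permute[OF \<sigma>, of "\<lambda>a. J (ls ! a) (ns ! a)"] by (simp add: o_def)
      finally show "(\<Prod>a<m. J (permute_list \<sigma> ls ! a) (permute_list \<sigma> ns ! a)) * T (permute_list \<sigma> ls)
          = (\<Prod>a<m. J (ls ! a) (ns ! a)) * T (permute_list \<sigma> ls)" by simp
    qed simp
    finally show ?thesis .
  qed
  then have "(\<Sum>\<sigma> | \<sigma> permutes {..<m}. of_int (sign \<sigma>) *
       (\<Sum>ls\<in>index_lists n m. (\<Prod>a<m. J (ls ! a) (permute_list \<sigma> ns ! a)) * T ls))
     = (\<Sum>\<sigma> | \<sigma> permutes {..<m}. \<Sum>ls\<in>index_lists n m.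
         of_int (sign \<sigma>) * ((\<Prod>a<m. J (ls ! a) (ns ! a)) * T (permute_list \<sigma> ls)))"
    by (intro sum.cong) (auto simp: sum_distrib_left)
  also have "\<dots> = (\<Sum>ls\<in>index_lists n m. \<Sum>\<sigma> | \<sigma> permutes {..<m}.
         of_int (sign \<sigma>) * ((\<Prod>a<m. J (ls ! a) (ns ! a)) * T (permute_list \<sigma> ls)))"
    by (rule sum.swap)
  finally show ?thesis by (simp add: sum_distrib_left mult.left_commute)
qed

text \<open>With the last n - p indices fixed, the symbol survives only on rearrangements of the
  first p values of \<sigma>. Each of these p! lists contributes the same, because the sign of the
  rearrangement occurs both in the symbol and in B. The factor p! is the one that
  \<open>hodge_star\<close> divides out.\<close>

lemma sum_levi_civita:
  fixes B :: "nat list \<Rightarrow> real"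
  assumes B: "alternating n p B" and \<sigma>: "\<sigma> permutes {..<n}" and p: "p \<le> n"
  shows "(\<Sum>ks\<in>index_lists n p. levi_civita n (ks @ drop p (map \<sigma> [0..<n])) * B ks)
    = fact p * of_int (sign \<sigma>) * B (take p (map \<sigma> [0..<n]))"
proof -
  define K D where "K = take p (map \<sigma> [0..<n])" and "D = drop p (map \<sigma> [0..<n])"
  have KD: "K @ D = map \<sigma> [0..<n]" by (simp add: K_def D_def)
  have d: "distinct (K @ D)" unfolding KD
    using permutes_inj_on[OF \<sigma>] by (simp add: distinct_map)
  have st: "set (K @ D) = {..<n}" unfolding KD
    using permutes_image[OF \<sigma>] by (simp add: atLeast0LessThan)
  have lK: "length K = p" "length D = n - p" using p by (auto simp: K_def D_def)
  have Kin: "K \<in> index_lists n p" using lK st by (auto simp: index_lists_def)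
  have fK: "permute_list \<tau> K ! i = \<sigma> (\<tau> i)" if "\<tau> permutes {..<p}" "i < p" for \<tau> i
  proof -
    have "\<tau> i < p" using permutes_in_image[OF that(1), of i] that(2) by auto
    then have "K ! \<tau> i = \<sigma> (\<tau> i)" using p by (simp add: K_def)
    then show ?thesis using that lK by (simp add: permute_list_nth)
  qed
  let ?P = "{\<tau>. \<tau> permutes {..<p}}"
  have inj: "inj_on (\<lambda>\<tau>. permute_list \<tau> K) ?P"
  proof (rule inj_onI)
    fix \<tau> \<tau>' assume t: "\<tau> \<in> ?P" "\<tau>' \<in> ?P" "permute_list \<tau> K = permute_list \<tau>' K"
    show "\<tau> = \<tau>'"
    proof
      fix i show "\<tau> i = \<tau>' i"
      proof (cases "i < p")
        case True
        then have "\<sigma> (\<tau> i) = \<sigma> (\<tau>' i)" using fK[of \<tau> i] fK[of \<tau>' i] t by simp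
        then show ?thesis using permutes_inj[OF \<sigma>] by (simp add: inj_eq)
      next
        case False
        then show ?thesis using t by (auto simp: permutes_def)
      qed
    qed
  qed
  have im: "(\<lambda>\<tau>. permute_list \<tau> K) ` ?P \<subseteq> index_lists n p"
    using permute_list_index_lists[OF _ Kin] by auto
  \<comment> \<open>A nonzero symbol makes \<open>ks @ D\<close> a listing of all n indices without
    repetition, so \<open>ks\<close> has the same entries as \<open>K\<close> and is a rearrangement
    of it.\<close>
  have zero: "levi_civita n (ks @ D) = 0"
    if ks: "ks \<in> index_lists n p - (\<lambda>\<tau>. permute_list \<tau> K) ` ?P" for ks
  proof (rule ccontr)
    assume "levi_civita n (ks @ D) \<noteq> 0"
    then have l: "length (ks @ D) = n" "set (ks @ D) = {..<n}" by (auto simp: levi_civita_def split: if_splits)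
    have dk: "distinct (ks @ D)" by (rule card_distinct) (metis card_lessThan l)
    then have "set ks = set K" using l(2) st d by auto
    then have "mset ks = mset K" using dk d by (metis distinct_append set_eq_iff_mset_eq_distinct)
    then obtain \<tau> where "\<tau> permutes {..<length K}" "permute_list \<tau> K = ks" by (rule mset_eq_permutation)
    then show False using ks lK by auto
  qed
  \<comment> \<open>Extended by the identity on positions from p on, \<tau> turns the list
    \<open>permute_list \<tau> K @ D\<close> into the function
    \<open>\<sigma> \<circ> \<tau>\<close>.\<close>
  have eps: "levi_civita n (permute_list \<tau> K @ D) = of_int (sign \<sigma>) * of_int (sign \<tau>)" if \<tau>: "\<tau> permutes {..<p}" for \<tau>
  proof -
    have tn: "\<tau> permutes {..<n}" using \<tau> p by (auto intro: permutes_subset)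
    have s: "set (permute_list \<tau> K @ D) = {..<n}" using st \<tau> lK by simp
    have "(\<lambda>i. if i < n then (permute_list \<tau> K @ D) ! i else i) = \<sigma> \<circ> \<tau>"
    proof
      fix i
      consider "i < p" | "p \<le> i" "i < n" | "n \<le> i" by linarith
      then show "(if i < n then (permute_list \<tau> K @ D) ! i else i) = (\<sigma> \<circ> \<tau>) i"
      proof cases
        case 1
        then show ?thesis using fK[OF \<tau> 1] lK p by (simp add: nth_append)
      next
        case 2
        then have "\<tau> i = i" using \<tau> by (auto simp: permutes_def)
        then show ?thesis using 2 lK p by (simp add: nth_append D_def)
      next
        case 3
        then have "\<tau> i = i" "\<sigma> i = i" using tn \<sigma> by (auto simp: permutes_def)
        then show ?thesis using 3 by simp
      qed
    qed
    moreover have "sign (\<sigma> \<circ> \<tau>) = sign \<sigma> * sign \<tau>"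
      by (rule sign_compose[OF permutes_imp_permutation[OF finite_lessThan \<sigma>] permutes_imp_permutation[OF finite_lessThan tn]])
    ultimately show ?thesis using s lK p by (simp add: levi_civita_def)
  qed
  have "(\<Sum>ks\<in>index_lists n p. levi_civita n (ks @ D) * B ks)
      = (\<Sum>ks\<in>(\<lambda>\<tau>. permute_list \<tau> K) ` ?P. levi_civita n (ks @ D) * B ks)"
    using im zero by (intro sum.mono_neutral_right) auto
  also have "\<dots> = (\<Sum>\<tau>\<in>?P. levi_civita n (permute_list \<tau> K @ D) * B (permute_list \<tau> K))"
    by (simp add: sum.reindex[OF inj])
  also have "\<dots> = (\<Sum>\<tau>\<in>?P. of_int (sign \<sigma>) * B K)"
  proof (rule sum.cong)
    fix \<tau> assume "\<tau> \<in> ?P"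
    then have \<tau>: "\<tau> permutes {..<p}" by simp
    have "real_of_int (sign \<tau>) * of_int (sign \<tau>) = 1" by (metis of_int_1 of_int_mult sign_idempotent)
    then show "levi_civita n (permute_list \<tau> K @ D) * B (permute_list \<tau> K) = of_int (sign \<sigma>) * B K"
      using eps[OF \<tau>] alternatingD[OF B Kin \<tau>] by (simp add: algebra_simps)
  qed simp
  also have "\<dots> = fact p * of_int (sign \<sigma>) * B K"
    using card_permutations[of "{..<p}" p] by simp
  finally show ?thesis by (simp add: K_def D_def)
qed

text \<open>Every repetition-free list of length p is the beginning of equally many permutations,
  namely (n - p)!; of this number only positivity is recorded.\<close>

lemma sum_permutations_take:
  assumes p: "p \<le> n"
  obtains c :: nat where "c > 0"
    "\<And>f :: nat list \<Rightarrow> real. (\<Sum>\<sigma> | \<sigma> permutes {..<n}. f (take p (map \<sigma> [0..<n])))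
      = of_nat c * (\<Sum>ks | ks \<in> index_lists n p \<and> distinct ks. f ks)"
proof -
  let ?h = "\<lambda>\<sigma>. take p (map \<sigma> [0..<n])"
  let ?P = "{\<sigma>. \<sigma> permutes {..<n}}"
  let ?T = "{ks \<in> index_lists n p. distinct ks}"
  define c where "c = card {\<sigma> \<in> ?P. ?h \<sigma> = [0..<p]}"
  have h: "?h \<sigma> = map \<sigma> [0..<p]" for \<sigma> :: "nat \<Rightarrow> nat" using p by (simp add: take_map)
  have fib: "card {\<sigma> \<in> ?P. ?h \<sigma> = ks} = c" if ks: "ks \<in> ?T" for ks
  proof -
    have k: "length ks = p" "set ks \<subseteq> {..<n}" "distinct ks" using ks by (auto simp: index_lists_def)
    \<comment> \<open>Any completion of \<open>ks\<close> to a listing of all indices serves; read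
      as a permutation it gives a \<pi> whose first p values are \<open>ks\<close>.\<close>
    define rest where "rest = sorted_list_of_set ({..<n} - set ks)"
    have "distinct (ks @ rest)" "set (ks @ rest) = {..<n}" using k by (auto simp: rest_def)
    then have "mset (ks @ rest) = mset [0..<n]"
      by (metis distinct_upt atLeast0LessThan set_eq_iff_mset_eq_distinct set_upt)
    then obtain \<pi> where "\<pi> permutes {..<length [0..<n]}" "permute_list \<pi> [0..<n] = ks @ rest"
      by (rule mset_eq_permutation)
    then have \<pi>: "\<pi> permutes {..<n}" "permute_list \<pi> [0..<n] = ks @ rest" by auto
    have "\<pi> i < n" if "i < n" for i using permutes_in_image[OF \<pi>(1), of i] that by auto
    then have "map \<pi> [0..<n] = permute_list \<pi> [0..<n]" by (auto simp: permute_list_def)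
    then have "map \<pi> [0..<n] = ks @ rest" using \<pi>(2) by simp
    then have \<pi>k: "map \<pi> [0..<p] = ks" using h[of \<pi>] k(1) by simp
    \<comment> \<open>Composition with \<pi> carries the permutations that fix the first p positions
      to those that begin with \<open>ks\<close>, so all fibres have the size of one.\<close>
    have "bij_betw (\<lambda>\<sigma>. \<pi> \<circ> \<sigma>) {\<sigma> \<in> ?P. ?h \<sigma> = [0..<p]} {\<sigma> \<in> ?P. ?h \<sigma> = ks}"
    proof (rule bij_betw_byWitness[where f' = "\<lambda>\<sigma>. Hilbert_Choice.inv \<pi> \<circ> \<sigma>"])
      show "\<forall>\<sigma>\<in>{\<sigma> \<in> ?P. ?h \<sigma> = [0..<p]}. Hilbert_Choice.inv \<pi> \<circ> (\<pi> \<circ> \<sigma>) = \<sigma>"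
        "\<forall>\<sigma>\<in>{\<sigma> \<in> ?P. ?h \<sigma> = ks}. \<pi> \<circ> (Hilbert_Choice.inv \<pi> \<circ> \<sigma>) = \<sigma>"
        using permutes_inv_o[OF \<pi>(1)] by (simp_all add: o_assoc)
      have "map (\<pi> \<circ> \<sigma>) [0..<p] = ks" if "map \<sigma> [0..<p] = [0..<p]" for \<sigma>
        using \<pi>k that by (metis map_map)
      then show "(\<lambda>\<sigma>. \<pi> \<circ> \<sigma>) ` {\<sigma> \<in> ?P. ?h \<sigma> = [0..<p]} \<subseteq> {\<sigma> \<in> ?P. ?h \<sigma> = ks}"
        unfolding h using permutes_compose[OF _ \<pi>(1)] by blast
      have "map (Hilbert_Choice.inv \<pi> \<circ> \<sigma>) [0..<p] = [0..<p]" if "map \<sigma> [0..<p] = ks" for \<sigma>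
      proof -
        have "map (Hilbert_Choice.inv \<pi> \<circ> \<sigma>) [0..<p] = map (Hilbert_Choice.inv \<pi>) (map \<pi> [0..<p])"
          using that \<pi>k by (metis map_map)
        also have "\<dots> = [0..<p]" using permutes_inv_o[OF \<pi>(1)] by (simp del: map_eq_conv)
        finally show ?thesis .
      qed
      then show "(\<lambda>\<sigma>. Hilbert_Choice.inv \<pi> \<circ> \<sigma>) ` {\<sigma> \<in> ?P. ?h \<sigma> = ks} \<subseteq> {\<sigma> \<in> ?P. ?h \<sigma> = [0..<p]}"
        unfolding h using permutes_compose[OF _ permutes_inv[OF \<pi>(1)]] by blast
    qed
    then show ?thesis unfolding c_def by (simp add: bij_betw_same_card)
  qed
  have "id \<in> {\<sigma> \<in> ?P. ?h \<sigma> = [0..<p]}" using p by (simp add: permutes_id)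
  moreover have fin: "finite ?P" by (simp add: finite_permutations)
  ultimately have c0: "c > 0" unfolding c_def card_gt_0_iff by (metis (no_types, lifting) empty_iff finite_subset mem_Collect_eq subsetI)
  have "(\<Sum>\<sigma>\<in>?P. f (?h \<sigma>)) = of_nat c * (\<Sum>ks\<in>?T. f ks)" for f :: "nat list \<Rightarrow> real"
  proof -
    have "?h ` ?P \<subseteq> ?T"
    proof (rule image_subsetI)
      fix \<sigma> assume "\<sigma> \<in> ?P"
      then have \<sigma>: "\<sigma> permutes {..<n}" by simp
      have "\<sigma> i < n" if "i < p" for i using permutes_in_image[OF \<sigma>, of i] that p by auto
      moreover have "distinct (map \<sigma> [0..<p])"
        using permutes_inj_on[OF \<sigma>] by (simp add: distinct_map)
      ultimately show "?h \<sigma> \<in> ?T" unfolding h by (auto simp: index_lists_def)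
    qed
    then have "(\<Sum>\<sigma>\<in>?P. f (?h \<sigma>)) = (\<Sum>ks\<in>?T. \<Sum>\<sigma>\<in>{\<sigma> \<in> ?P. ?h \<sigma> = ks}. f (?h \<sigma>))"
      using fin by (intro sum.group[symmetric]) auto
    also have "\<dots> = (\<Sum>ks\<in>?T. of_nat (card {\<sigma> \<in> ?P. ?h \<sigma> = ks}) * f ks)"
      by (intro sum.cong) simp_all
    also have "\<dots> = (\<Sum>ks\<in>?T. of_nat c * f ks)" using fib by (intro sum.cong) simp_all
    finally show ?thesis by (simp only: sum_distrib_left)
  qed
  then show ?thesis using c0 that by blast
qed

text \<open>The summand for b reads positions 0 and b + 1 only through the symmetric H, so
  exchanging these positions leaves it unchanged while the sign flips. In the use below, H holds
  second derivatives of a transition map: this is the term that spoils the tensor law of a plain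
  derivative.\<close>

lemma sum_permutations_symmetric_cancel:
  fixes H :: "nat \<Rightarrow> nat \<Rightarrow> nat \<Rightarrow> real"
  assumes ns: "ns \<in> index_lists n (Suc p)"
    and H: "\<And>k i j. i < n \<Longrightarrow> j < n \<Longrightarrow> H k i j = H k j i"
  shows "(\<Sum>\<sigma> | \<sigma> permutes {..<Suc p}. of_int (sign \<sigma>) *
     (\<Sum>ls\<in>index_lists n p. (\<Sum>b<p. H (ls ! b) (permute_list \<sigma> ns ! Suc b) (permute_list \<sigma> ns ! 0) *
        (\<Prod>a\<in>{..<p} - {b}. J (ls ! a) (permute_list \<sigma> ns ! Suc a))) * W ls)) = 0"
proof -
  let ?P = "{\<sigma>. \<sigma> permutes {..<Suc p}}"
  define g where "g ls b \<sigma> = H (ls ! b) (ns ! \<sigma> (Suc b)) (ns ! \<sigma> 0) *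
      (\<Prod>a\<in>{..<p} - {b}. J (ls ! a) (ns ! \<sigma> (Suc a))) * W ls" for ls b \<sigma>
  have len: "length ns = Suc p" using ns by (simp add: index_lists_def)
  have lt: "ns ! a < n" if "a < Suc p" for a
    using index_lists_nth[OF ns that] .
  \<comment> \<open>The transposition that cancels the terms depends on b, so the sum over
    permutations has to become the innermost one, with \<open>ls\<close> and b fixed.\<close>
  have z: "(\<Sum>\<sigma>\<in>?P. of_int (sign \<sigma>) * g ls b \<sigma>) = 0" if b: "b < p" for ls b
  proof (rule sum_permutations_cancel[where q = "Transposition.transpose 0 (Suc b)"])
    show "Transposition.transpose 0 (Suc b) permutes {..<Suc p}" using b by (intro permutes_swap_id) auto
    show "sign (Transposition.transpose 0 (Suc b)) = - 1" by (simp add: sign_swap_id)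
    fix \<sigma> assume \<sigma>: "\<sigma> permutes {..<Suc p}"
    have "\<sigma> 0 < Suc p" "\<sigma> (Suc b) < Suc p"
      using permutes_in_image[OF \<sigma>, of 0] permutes_in_image[OF \<sigma>, of "Suc b"] b by simp_all
    then have "H (ls ! b) (ns ! \<sigma> 0) (ns ! \<sigma> (Suc b)) = H (ls ! b) (ns ! \<sigma> (Suc b)) (ns ! \<sigma> 0)"
      by (intro H lt)
    moreover have "(\<Prod>a\<in>{..<p} - {b}. J (ls ! a) (ns ! (\<sigma> \<circ> Transposition.transpose 0 (Suc b)) (Suc a)))
        = (\<Prod>a\<in>{..<p} - {b}. J (ls ! a) (ns ! \<sigma> (Suc a)))"
      by (intro prod.cong) (auto simp: Transposition.transpose_def)
    ultimately show "g ls b (\<sigma> \<circ> Transposition.transpose 0 (Suc b)) = g ls b \<sigma>"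
      unfolding g_def by simp
  qed simp
  have "(\<Sum>\<sigma>\<in>?P. of_int (sign \<sigma>) *
     (\<Sum>ls\<in>index_lists n p. (\<Sum>b<p. H (ls ! b) (permute_list \<sigma> ns ! Suc b) (permute_list \<sigma> ns ! 0) *
        (\<Prod>a\<in>{..<p} - {b}. J (ls ! a) (permute_list \<sigma> ns ! Suc a))) * W ls))
    = (\<Sum>\<sigma>\<in>?P. \<Sum>ls\<in>index_lists n p. \<Sum>b<p. of_int (sign \<sigma>) * g ls b \<sigma>)"
  proof (intro sum.cong refl)
    fix \<sigma> assume "\<sigma> \<in> ?P"
    then have nth: "permute_list \<sigma> ns ! a = ns ! \<sigma> a" if "a < Suc p" for a
      using that by (simp add: permute_list_nth len)
    show "of_int (sign \<sigma>) * (\<Sum>ls\<in>index_lists n p. (\<Sum>b<p. H (ls ! b) (permute_list \<sigma> ns ! Suc b) (permute_list \<sigma> ns ! 0) *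
        (\<Prod>a\<in>{..<p} - {b}. J (ls ! a) (permute_list \<sigma> ns ! Suc a))) * W ls)
      = (\<Sum>ls\<in>index_lists n p. \<Sum>b<p. of_int (sign \<sigma>) * g ls b \<sigma>)"
      by (simp add: sum_distrib_left sum_distrib_right g_def nth)
  qed
  also have "\<dots> = (\<Sum>ls\<in>index_lists n p. \<Sum>\<sigma>\<in>?P. \<Sum>b<p. of_int (sign \<sigma>) * g ls b \<sigma>)"
    by (rule sum.swap)
  also have "\<dots> = (\<Sum>ls\<in>index_lists n p. \<Sum>b<p. \<Sum>\<sigma>\<in>?P. of_int (sign \<sigma>) * g ls b \<sigma>)"
    by (intro sum.cong refl sum.swap)
  also have "\<dots> = 0" using z by (simp add: sum.neutral)
  finally show ?thesis .
qed

section \<open>Calculus on Euclidean space\<close>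

text \<open>Boxes with the zero tail of \<open>Euclidean_space n\<close>. Around a point of that
  space they are stable under moving one coordinate within the radius, which is what arguments with
  partial derivatives need.\<close>

definition cube :: "nat \<Rightarrow> (nat \<Rightarrow> real) \<Rightarrow> real \<Rightarrow> (nat \<Rightarrow> real) set" where
  "cube n y e = {z. (\<forall>i\<ge>n. z i = 0) \<and> (\<forall>i<n. \<bar>z i - y i\<bar> < e)}"

lemma cube_mono: "d \<le> e \<Longrightarrow> cube n y d \<subseteq> cube n y e"
  unfolding cube_def by force

lemma openin_Euclidean_space_support: "openin (Euclidean_space n) S \<Longrightarrow> z \<in> S \<Longrightarrow> i \<ge> n \<Longrightarrow> z i = 0"
  using openin_subset[of "Euclidean_space n" S] by (auto simp: topspace_Euclidean_space)

lemma openin_Euclidean_space_cube: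
  assumes "openin (Euclidean_space n) S" "y \<in> S"
  shows "\<exists>e>0. cube n y e \<subseteq> S"
proof -
  obtain T where T: "openin (powertop_real UNIV) T" "S = T \<inter> {x. \<forall>i\<ge>n. x i = 0}"
    using assms(1) unfolding Euclidean_space_def openin_subtopology by auto
  have "y \<in> T" using assms T by auto
  obtain X where X: "y \<in> (\<Pi>\<^sub>E i\<in>UNIV. X i)" "\<And>i. open (X i)" "(\<Pi>\<^sub>E i\<in>UNIV. X i) \<subseteq> T"
    using product_topology_open_contains_basis[OF T(1) \<open>y \<in> T\<close>] by auto
  have "\<exists>e>0. ball (y i) e \<subseteq> X i" for i
    using X(1,2) by (auto simp: PiE_def Pi_def open_contains_ball)
  then obtain e where e: "\<And>i. e i > 0" "\<And>i. ball (y i) (e i) \<subseteq> X i" by metis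
  \<comment> \<open>The inserted 1 keeps the minimum meaningful for n = 0.\<close>
  define d where "d = Min (insert 1 (e ` {..<n}))"
  have d: "d > 0" "\<And>i. i < n \<Longrightarrow> d \<le> e i" unfolding d_def using e(1) by auto
  have "cube n y d \<subseteq> S"
  proof
    fix z assume z: "z \<in> cube n y d"
    have "z i \<in> X i" for i
    proof (cases "i < n")
      case True
      then have "dist (y i) (z i) < e i"
        using z d(2)[OF True] by (fastforce simp: cube_def dist_real_def abs_minus_commute)
      then show ?thesis using e(2)[of i] by auto
    next
      case False
      then have "z i = y i" using z assms T by (auto simp: cube_def)
      then show ?thesis using X(1) by auto
    qed
    then have "z \<in> T" using X(3) by auto
    then show "z \<in> S" using T z by (auto simp: cube_def)
  qed
  then show ?thesis using d by blast
qed

lemma openin_Euclidean_space_Int_vimage: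
  fixes f :: "(nat \<Rightarrow> real) \<Rightarrow> real"
  assumes "openin (Euclidean_space n) S" "continuous_on S f" "open T"
  shows "openin (Euclidean_space n) (S \<inter> f -` T)"
proof -
  have E: "Euclidean_space n = top_of_set {x. \<forall>i\<ge>n. x i = 0}"
    by (simp add: Euclidean_space_def euclidean_product_topology)
  have "openin (top_of_set S) (S \<inter> f -` T)"
    using assms(2,3) continuous_on_open_gen[of f S UNIV] by (simp add: continuous_openin_preimage_gen)
  then show ?thesis
    using assms(1) unfolding E by (rule openin_trans)
qed

lemma continuous_on_cube:
  fixes f :: "(nat \<Rightarrow> real) \<Rightarrow> real"
  assumes "openin (Euclidean_space n) S" "continuous_on S f" "y \<in> S" "e > 0"
  shows "\<exists>d>0. cube n y d \<subseteq> S \<and> (\<forall>z\<in>cube n y d. \<bar>f z - f y\<bar> < e)"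
proof -
  have "\<exists>d>0. cube n y d \<subseteq> S \<inter> f -` ball (f y) e"
    using assms by (intro openin_Euclidean_space_cube openin_Euclidean_space_Int_vimage) auto
  then show ?thesis
    by (fastforce simp: subset_iff dist_real_def abs_minus_commute)
qed

lemma eventually_fun_upd_mem:
  assumes "openin (Euclidean_space n) S" "y \<in> S" "i < n"
  shows "eventually (\<lambda>t. y(i := t) \<in> S) (nhds (y i))"
proof -
  obtain e where e: "e > 0" "cube n y e \<subseteq> S" using openin_Euclidean_space_cube[OF assms(1,2)] by auto
  have "y(i := t) \<in> S" if "dist t (y i) < e" for t
  proof -
    have "y(i := t) \<in> cube n y e"
      using that e(1) assms openin_Euclidean_space_support[OF assms(1,2)] by (auto simp: cube_def dist_real_def)
    then show ?thesis using e by auto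
  qed
  then show ?thesis unfolding eventually_nhds_metric using e(1) by blast
qed

text \<open>At a point of an open set a partial derivative reads only nearby values inside the set.
  Formulas that hold merely on a chart overlap can therefore be differentiated.\<close>

lemma partial_cong:
  assumes "openin (Euclidean_space n) S" "y \<in> S" "i < n" "\<And>z. z \<in> S \<Longrightarrow> f z = g z"
  shows "partial i f y = partial i g y"
  unfolding partial_def
  by (rule deriv_cong_ev[OF eventually_mono[OF eventually_fun_upd_mem[OF assms(1-3)]]]) (auto simp: assms(4))

lemma differentiable_fun_upd_cong:
  fixes f g :: "(nat \<Rightarrow> real) \<Rightarrow> real"
  assumes "openin (Euclidean_space n) S" "y \<in> S" "i < n" "\<And>z. z \<in> S \<Longrightarrow> f z = g z"
    and "(\<lambda>t. f (y(i := t))) differentiable at (y i)"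
  shows "(\<lambda>t. g (y(i := t))) differentiable at (y i)"
proof -
  have "eventually (\<lambda>t. f (y(i := t)) = g (y(i := t))) (nhds (y i))"
    using eventually_fun_upd_mem[OF assms(1-3)] by (rule eventually_mono) (auto simp: assms(4))
  moreover have "((\<lambda>t. f (y(i := t))) has_real_derivative partial i f y) (at (y i))"
    using assms(5) unfolding partial_def by (simp add: DERIV_deriv_iff_real_differentiable)
  ultimately have "((\<lambda>t. g (y(i := t))) has_real_derivative partial i f y) (at (y i))"
    by (rule iffD1[OF DERIV_cong_ev[OF refl _ refl]])
  then show ?thesis unfolding real_differentiable_def by blast
qed

lemma Ck_on_cong:
  assumes "openin (Euclidean_space n) S" "\<And>z. z \<in> S \<Longrightarrow> f z = g z" "Ck_on n S k f"
  shows "Ck_on n S k g"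
  using assms(2,3)
proof (induction k arbitrary: f g)
  case 0
  then show ?case by (metis Ck_on.simps(1) continuous_on_cong)
next
  case (Suc k)
  have "continuous_on S g" using Suc.prems by (metis Ck_on.simps(2) continuous_on_cong)
  moreover have "(\<lambda>t. g (y(i := t))) differentiable at (y i)" if "i < n" "y \<in> S" for i y
    using differentiable_fun_upd_cong[of n S y i f g] assms(1) Suc.prems(1) Suc.prems(2) that by auto
  moreover have "Ck_on n S k (partial i g)" if "i < n" for i
    using Suc.IH[of "partial i f" "partial i g"] partial_cong[OF assms(1) _ that Suc.prems(1)] Suc.prems(2) that
    by auto
  ultimately show ?case by simp
qed

section \<open>Smooth functions under linear combinations and partial derivatives\<close>

lemma partial_has_derivative:
  assumes "(\<lambda>t. f (y(i := t))) differentiable at (y i)"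
  shows "((\<lambda>t. f (y(i := t))) has_real_derivative partial i f y) (at (y i))"
  using assms unfolding partial_def by (simp add: DERIV_deriv_iff_real_differentiable)

lemma partial_eqI:
  "((\<lambda>t. f (y(i := t))) has_real_derivative D) (at (y i)) \<Longrightarrow> partial i f y = D"
  unfolding partial_def by (rule DERIV_imp_deriv)

lemma Ck_on_add_scale:
  assumes "openin (Euclidean_space n) S" "Ck_on n S k f" "Ck_on n S k g"
  shows "Ck_on n S k (\<lambda>y. f y + r * g y)"
  using assms(2,3)
proof (induction k arbitrary: f g)
  case 0
  then show ?case by (auto intro!: continuous_intros)
next
  case (Suc k)
  have D: "((\<lambda>t. f (y(i := t)) + r * g (y(i := t))) has_real_derivative (partial i f y + r * partial i g y)) (at (y i))"
    if "i < n" "y \<in> S" for i y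
  proof -
    have "(\<lambda>t. f (y(i := t))) differentiable at (y i)" "(\<lambda>t. g (y(i := t))) differentiable at (y i)"
      using Suc.prems that by simp_all
    then show ?thesis by (intro DERIV_add DERIV_cmult partial_has_derivative)
  qed
  \<comment> \<open>The sum rule for \<open>partial\<close> is available only on S, because
    \<open>deriv\<close> is unspecified where differentiability fails; hence the passage through
    \<open>Ck_on_cong\<close>.\<close>
  have "Ck_on n S k (partial i (\<lambda>y. f y + r * g y))" if "i < n" for i
  proof (rule Ck_on_cong[OF assms(1)])
    show "partial i f z + r * partial i g z = partial i (\<lambda>y. f y + r * g y) z" if "z \<in> S" for z
      using partial_eqI[OF D[OF \<open>i < n\<close> that]] by simp
    show "Ck_on n S k (\<lambda>y. partial i f y + r * partial i g y)"
      using Suc.prems \<open>i < n\<close> by (intro Suc.IH) simp_all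
  qed
  moreover have "continuous_on S (\<lambda>y. f y + r * g y)"
    using Suc.prems by (auto intro!: continuous_intros)
  moreover have "(\<lambda>t. f (y(i := t)) + r * g (y(i := t))) differentiable at (y i)"
    if "i < n" "y \<in> S" for i y using D[OF that] unfolding real_differentiable_def by blast
  ultimately show ?case by simp
qed

lemma Ck_on_const: "Ck_on n S k (\<lambda>_. a)"
proof (induction k arbitrary: a)
  case (Suc k)
  have "partial i (\<lambda>_. a) = (\<lambda>_. 0)" for i by (simp add: partial_def fun_eq_iff)
  then show ?case using Suc.IH[of 0] by simp
qed simp

lemma smooth_on_cong:
  "openin (Euclidean_space n) S \<Longrightarrow> (\<And>z. z \<in> S \<Longrightarrow> f z = g z) \<Longrightarrow> smooth_on n S f \<Longrightarrow> smooth_on n S g"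
  unfolding smooth_on_def using Ck_on_cong by blast

lemma smooth_on_add_scale:
  "openin (Euclidean_space n) S \<Longrightarrow> smooth_on n S f \<Longrightarrow> smooth_on n S g \<Longrightarrow> smooth_on n S (\<lambda>y. f y + r * g y)"
  unfolding smooth_on_def using Ck_on_add_scale by blast

lemma smooth_on_const: "smooth_on n S (\<lambda>_. a)"
  unfolding smooth_on_def using Ck_on_const by blast

lemma smooth_on_sum_scale:
  assumes "openin (Euclidean_space n) S" "\<And>k. k \<in> A \<Longrightarrow> smooth_on n S (f k)"
  shows "smooth_on n S (\<lambda>y. \<Sum>k\<in>A. a k * f k y)"
proof (cases "finite A")
  case True
  then show ?thesis using assms(2)
  proof induction
    case (insert x F)
    then show ?case
      using smooth_on_add_scale[OF assms(1), of "\<lambda>y. \<Sum>k\<in>F. a k * f k y" "f x" "a x"]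
      by (simp add: add.commute)
  qed (simp add: smooth_on_const)
qed (auto intro: smooth_on_const)

lemma smooth_on_partial: "smooth_on n S f \<Longrightarrow> i < n \<Longrightarrow> smooth_on n S (partial i f)"
  unfolding smooth_on_def by (metis Ck_on.simps(2))

lemma smooth_on_imp_continuous_on: "smooth_on n S f \<Longrightarrow> continuous_on S f"
  unfolding smooth_on_def by (metis Ck_on.simps(1))

lemma smooth_on_has_partial:
  "smooth_on n S f \<Longrightarrow> i < n \<Longrightarrow> y \<in> S \<Longrightarrow>
    ((\<lambda>t. f (y(i := t))) has_real_derivative partial i f y) (at (y i))"
  unfolding smooth_on_def by (intro partial_has_derivative) (metis Ck_on.simps(2))

lemma MVT_abs:
  fixes f :: "real \<Rightarrow> real"
  assumes "\<And>x. \<bar>x - a\<bar> \<le> \<bar>b - a\<bar> \<Longrightarrow> (f has_real_derivative f' x) (at x)"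
  shows "\<exists>z. \<bar>z - a\<bar> \<le> \<bar>b - a\<bar> \<and> f b - f a = f' z * (b - a)"
proof -
  \<comment> \<open>The increment of a curve in one coordinate may have either sign or
    vanish.\<close>
  consider "a < b" | "a = b" | "b < a" by linarith
  then show ?thesis
  proof cases
    case 1
    then have "\<exists>z. a < z \<and> z < b \<and> f b - f a = (b - a) * f' z"
      by (intro MVT2 assms) auto
    then obtain z where "a < z" "z < b" "f b - f a = (b - a) * f' z" by blast
    then show ?thesis using 1 by (intro exI[of _ z]) simp
  next
    case 3
    then have "\<exists>z. b < z \<and> z < a \<and> f a - f b = (a - b) * f' z"
      by (intro MVT2 assms) auto
    then obtain z where "b < z" "z < a" "f a - f b = (a - b) * f' z" by blast
    then show ?thesis using 3 by (intro exI[of _ z]) (simp add: algebra_simps)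
  qed auto
qed

text \<open>The intermediate functions move the first \<open>m\<close> coordinates along the curve and keep the others fixed,
  so that each step varies a single coordinate.\<close>

lemma chain_rule_curve:
  fixes f :: "(nat \<Rightarrow> real) \<Rightarrow> real" and \<gamma> :: "real \<Rightarrow> nat \<Rightarrow> real"
  assumes U: "openin (Euclidean_space n) U" and f: "Ck_on n U 1 f"
    and \<gamma>0: "\<gamma> t0 \<in> U" and \<gamma>: "eventually (\<lambda>t. \<gamma> t \<in> U) (nhds t0)"
    and \<gamma>': "\<And>l. l < n \<Longrightarrow> ((\<lambda>t. \<gamma> t l) has_real_derivative \<gamma>' l) (at t0)"
  shows "((\<lambda>t. f (\<gamma> t)) has_real_derivative (\<Sum>l<n. partial l f (\<gamma> t0) * \<gamma>' l)) (at t0)"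
proof -
  define z where "z m t = (\<lambda>l. if l < m then \<gamma> t l else \<gamma> t0 l)" for m t
  have supp: "\<gamma> t0 l = 0" if "l \<ge> n" for l using openin_Euclidean_space_support[OF U \<gamma>0 that] .
  have near: "eventually (\<lambda>t. \<forall>l<n. \<bar>\<gamma> t l - \<gamma> t0 l\<bar> < d) (at t0)" if "d > 0" for d
  proof -
    have "eventually (\<lambda>t. \<bar>\<gamma> t l - \<gamma> t0 l\<bar> < d) (at t0)" if "l < n" for l
      using tendstoD[OF DERIV_isCont[OF \<gamma>'[OF that], unfolded isCont_def] \<open>d > 0\<close>]
      by (simp add: dist_real_def)
    then have "eventually (\<lambda>t. \<forall>l\<in>{..<n}. \<bar>\<gamma> t l - \<gamma> t0 l\<bar> < d) (at t0)"
      by (intro eventually_ball_finite) auto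
    then show ?thesis by (rule eventually_mono) auto
  qed
  have main: "((\<lambda>t. f (z m t)) has_real_derivative (\<Sum>l<m. partial l f (\<gamma> t0) * \<gamma>' l)) (at t0)" if "m \<le> n" for m
    using that
  proof (induction m)
    case 0
    then show ?case by (simp add: z_def)
  next
    case (Suc m)
    then have m: "m < n" by simp
    have dif: "\<And>y. y \<in> U \<Longrightarrow> ((\<lambda>t. f (y(m := t))) has_real_derivative partial m f y) (at (y m))"
      using f m by (intro partial_has_derivative) simp
    have cont: "continuous_on U (partial m f)" using f m by auto
    define D where "D t = f (z (Suc m) t) - f (z m t)" for t
    have D0: "D t0 = 0" by (simp add: D_def z_def)
    \<comment> \<open>The difference quotient in coordinate m, completed by its expected limit where
      the increment vanishes. In this way D factors as k times the increment for every t, without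
      division.\<close>
    define k where "k t = (if \<gamma> t m = \<gamma> t0 m then partial m f (\<gamma> t0) else D t / (\<gamma> t m - \<gamma> t0 m))" for t
    have Dk: "D t = k t * (\<gamma> t m - \<gamma> t0 m)" for t
    proof (cases "\<gamma> t m = \<gamma> t0 m")
      case True
      have "z (Suc m) t l = z m t l" for l using True by (cases "l = m") (simp_all add: z_def less_Suc_eq)
      then have "z (Suc m) t = z m t" by blast
      then show ?thesis using True by (simp add: D_def)
    qed (auto simp: k_def)
    have "(k \<longlongrightarrow> partial m f (\<gamma> t0)) (at t0)"
    proof (rule tendstoI)
      fix e :: real assume "e > 0"
      obtain d where d: "d > 0" "cube n (\<gamma> t0) d \<subseteq> U"
          "\<And>y. y \<in> cube n (\<gamma> t0) d \<Longrightarrow> \<bar>partial m f y - partial m f (\<gamma> t0)\<bar> < e"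
        using continuous_on_cube[OF U cont \<gamma>0 \<open>e > 0\<close>] by auto
      have "dist (k t) (partial m f (\<gamma> t0)) < e" if t: "\<forall>l<n. \<bar>\<gamma> t l - \<gamma> t0 l\<bar> < d" for t
      proof (cases "\<gamma> t m = \<gamma> t0 m")
        case False
        \<comment> \<open>Coordinates before m lie on the curve, later ones at the base point, and
          coordinate m between the two; so the intermediate point of the mean value theorem stays in
          the cube.\<close>
        have inc: "(z m t)(m := x) \<in> cube n (\<gamma> t0) d" if "\<bar>x - \<gamma> t0 m\<bar> \<le> \<bar>\<gamma> t m - \<gamma> t0 m\<bar>" for x
        proof -
          have "\<bar>x - \<gamma> t0 m\<bar> < d" using that t m by fastforce
          then show ?thesis using t m supp d(1) by (simp add: cube_def z_def)
        qed
        have der: "((\<lambda>x. f ((z m t)(m := x))) has_real_derivative partial m f ((z m t)(m := x))) (at x)"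
          if "\<bar>x - \<gamma> t0 m\<bar> \<le> \<bar>\<gamma> t m - \<gamma> t0 m\<bar>" for x
          using dif[OF subsetD[OF d(2) inc[OF that]]] by simp
        obtain x where x: "\<bar>x - \<gamma> t0 m\<bar> \<le> \<bar>\<gamma> t m - \<gamma> t0 m\<bar>"
          "f ((z m t)(m := \<gamma> t m)) - f ((z m t)(m := \<gamma> t0 m)) = partial m f ((z m t)(m := x)) * (\<gamma> t m - \<gamma> t0 m)"
          using MVT_abs[of "\<gamma> t0 m" "\<gamma> t m", OF der] by blast
        have "(z m t)(m := \<gamma> t m) = z (Suc m) t" "(z m t)(m := \<gamma> t0 m) = z m t"
          by (simp_all add: z_def less_Suc_eq fun_eq_iff)
        then have "D t = partial m f ((z m t)(m := x)) * (\<gamma> t m - \<gamma> t0 m)"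
          using x(2) by (simp add: D_def)
        then have "k t = partial m f ((z m t)(m := x))" using False by (simp add: k_def)
        then show ?thesis using d(3)[OF inc[OF x(1)]] by (simp add: dist_real_def)
      qed (use \<open>e > 0\<close> in \<open>auto simp: k_def\<close>)
      then show "eventually (\<lambda>t. dist (k t) (partial m f (\<gamma> t0)) < e) (at t0)"
        using near[OF d(1)] by (rule eventually_mono[rotated])
    qed
    then have "((\<lambda>t. k t * ((\<gamma> t m - \<gamma> t0 m) / (t - t0))) \<longlongrightarrow> partial m f (\<gamma> t0) * \<gamma>' m) (at t0)"
      using \<gamma>'[OF m] unfolding has_field_derivative_iff by (intro tendsto_mult)
    then have "(D has_real_derivative partial m f (\<gamma> t0) * \<gamma>' m) (at t0)"
      unfolding has_field_derivative_iff by (simp add: Dk D0)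
    then have "((\<lambda>t. f (z m t) + D t) has_real_derivative
        (\<Sum>l<m. partial l f (\<gamma> t0) * \<gamma>' l) + partial m f (\<gamma> t0) * \<gamma>' m) (at t0)"
      using Suc by (intro DERIV_add) auto
    then show ?case by (simp add: D_def)
  qed
  \<comment> \<open>\<open>z n t\<close> has the zero tail of the base point, so it equals
    \<open>\<gamma> t\<close> only while the curve is in U.\<close>
  have "eventually (\<lambda>t. f (z n t) = f (\<gamma> t)) (nhds t0)"
    using \<gamma>
  proof (rule eventually_mono)
    fix t assume "\<gamma> t \<in> U"
    then have "z n t = \<gamma> t" using supp openin_Euclidean_space_support[OF U] by (auto simp: z_def fun_eq_iff)
    then show "f (z n t) = f (\<gamma> t)" by simp
  qed
  then show ?thesis using main[OF order_refl] by (rule iffD1[OF DERIV_cong_ev[OF refl _ refl]])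
qed

text \<open>The second difference over a square is the increment of \<phi> in direction i, where
  \<phi> is itself a difference in direction j. The mean value theorem for \<phi>, then for
  \<open>partial i f\<close> along j, produces the two factors h.\<close>

lemma second_difference:
  assumes U: "cube n y d \<subseteq> U" and f: "Ck_on n U 2 f" and ij: "i < n" "j < n" "i \<noteq> j"
    and y: "y \<in> topspace (Euclidean_space n)" and h: "0 < h" "h < d"
  shows "\<exists>z\<in>cube n y d.
    f (y(i := y i + h, j := y j + h)) - f (y(i := y i + h)) - f (y(j := y j + h)) + f y = h\<^sup>2 * partial j (partial i f) z"
proof -
  have inc: "y(i := s, j := t) \<in> cube n y d" if "\<bar>s - y i\<bar> \<le> h" "\<bar>t - y j\<bar> \<le> h" for s t
    using that h ij y by (auto simp: cube_def topspace_Euclidean_space)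
  have d1: "((\<lambda>t. f (w(i := t))) has_real_derivative partial i f w) (at (w i))" if "w \<in> U" for w
    using f ij that by (intro partial_has_derivative) (auto simp: numeral_2_eq_2)
  have d2: "((\<lambda>t. partial i f (w(j := t))) has_real_derivative partial j (partial i f) w) (at (w j))" if "w \<in> U" for w
    using f ij that by (intro partial_has_derivative) (auto simp: numeral_2_eq_2)
  define \<phi> where "\<phi> s = f (y(i := s, j := y j + h)) - f (y(i := s, j := y j))" for s
  have "(\<phi> has_real_derivative partial i f (y(i := s, j := y j + h)) - partial i f (y(i := s, j := y j))) (at s)"
    if s: "\<bar>s - y i\<bar> \<le> \<bar>(y i + h) - y i\<bar>" for s
  proof -
    have "((\<lambda>t. f (y(i := t, j := v))) has_real_derivative partial i f (y(i := s, j := v))) (at s)"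
      if v: "\<bar>v - y j\<bar> \<le> h" for v
    proof -
      have "y(i := s, j := v) \<in> U" using inc[of s v] s v U h by auto
      moreover have "(y(i := s, j := v))(i := t) = y(i := t, j := v)" for t using ij by (auto simp: fun_eq_iff)
      ultimately show ?thesis using d1[of "y(i := s, j := v)"] ij by simp
    qed
    then show ?thesis unfolding \<phi>_def using h by (intro DERIV_diff) auto
  qed
  from MVT_abs[of "y i" "y i + h", OF this] obtain \<xi> where \<xi>: "\<bar>\<xi> - y i\<bar> \<le> h"
     "\<phi> (y i + h) - \<phi> (y i) = (partial i f (y(i := \<xi>, j := y j + h)) - partial i f (y(i := \<xi>, j := y j))) * h"
    using h by auto
  have "((\<lambda>t. partial i f (y(i := \<xi>, j := t))) has_real_derivative partial j (partial i f) (y(i := \<xi>, j := t))) (at t)"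
    if t: "\<bar>t - y j\<bar> \<le> \<bar>(y j + h) - y j\<bar>" for t
    using d2[of "y(i := \<xi>, j := t)"] inc[of \<xi> t] \<xi>(1) t U h by auto
  from MVT_abs[of "y j" "y j + h", OF this] obtain \<eta> where \<eta>: "\<bar>\<eta> - y j\<bar> \<le> h"
     "partial i f (y(i := \<xi>, j := y j + h)) - partial i f (y(i := \<xi>, j := y j)) = partial j (partial i f) (y(i := \<xi>, j := \<eta>)) * h"
    using h by auto
  have "\<phi> (y i + h) - \<phi> (y i) = h\<^sup>2 * partial j (partial i f) (y(i := \<xi>, j := \<eta>))"
    using \<xi>(2) \<eta>(2) by (simp add: power2_eq_square)
  moreover have "y(i := s, j := y j) = y(i := s)" "y(i := y i, j := t) = y(j := t)" for s t using ij by auto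
  ultimately have "f (y(i := y i + h, j := y j + h)) - f (y(i := y i + h)) - f (y(j := y j + h)) + f y
      = h\<^sup>2 * partial j (partial i f) (y(i := \<xi>, j := \<eta>))" unfolding \<phi>_def by simp
  then show ?thesis using inc[OF \<xi>(1) \<eta>(1)] by blast
qed

text \<open>The second difference is symmetric in i and j, so in every small cube the two mixed
  derivatives take a common value, at possibly different points. Continuity brings both points to
  y.\<close>

lemma partial_commute:
  assumes U: "openin (Euclidean_space n) U" and f: "Ck_on n U 2 f" and y: "y \<in> U" and ij: "i < n" "j < n"
  shows "partial i (partial j f) y = partial j (partial i f) y"
proof (cases "i = j")
  case False
  show ?thesis
  proof (rule ccontr)
    assume ne: "\<not> ?thesis"
    \<comment> \<open>Half the supposed gap: if both mixed derivatives vary by less than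
      \<open>e\<close>, they cannot meet.\<close>
    define e where "e = \<bar>partial i (partial j f) y - partial j (partial i f) y\<bar> / 2"
    have "e > 0" using ne by (auto simp: e_def)
    have c: "continuous_on U (partial j (partial i f))" "continuous_on U (partial i (partial j f))"
      using f ij by (auto simp: numeral_2_eq_2)
    obtain d1 where d1: "d1 > 0" "cube n y d1 \<subseteq> U"
        "\<And>z. z \<in> cube n y d1 \<Longrightarrow> \<bar>partial j (partial i f) z - partial j (partial i f) y\<bar> < e"
      using continuous_on_cube[OF U c(1) y \<open>e > 0\<close>] by auto
    obtain d2 where d2: "d2 > 0" "cube n y d2 \<subseteq> U"
        "\<And>z. z \<in> cube n y d2 \<Longrightarrow> \<bar>partial i (partial j f) z - partial i (partial j f) y\<bar> < e"
      using continuous_on_cube[OF U c(2) y \<open>e > 0\<close>] by auto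
    define d where "d = min d1 d2"
    have d: "d > 0" "cube n y d \<subseteq> U" "cube n y d \<subseteq> cube n y d1" "cube n y d \<subseteq> cube n y d2"
      using d1(1,2) d2(1) cube_mono[of d d1] cube_mono[of d d2] by (auto simp: d_def)
    have yt: "y \<in> topspace (Euclidean_space n)" using U y openin_subset by blast
    have h: "0 < d / 2" "d / 2 < d" using d(1) by auto
    obtain z where z: "z \<in> cube n y d" "f (y(i := y i + d/2, j := y j + d/2)) - f (y(i := y i + d/2)) - f (y(j := y j + d/2)) + f y
        = (d/2)\<^sup>2 * partial j (partial i f) z" using second_difference[OF d(2) f ij False yt h] by blast
    obtain w where w: "w \<in> cube n y d" "f (y(j := y j + d/2, i := y i + d/2)) - f (y(j := y j + d/2)) - f (y(i := y i + d/2)) + f y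
        = (d/2)\<^sup>2 * partial i (partial j f) w" using second_difference[OF d(2) f ij(2,1) False[symmetric] yt h] by blast
    have "(d/2)\<^sup>2 * partial j (partial i f) z = (d/2)\<^sup>2 * partial i (partial j f) w"
      using z(2) w(2) unfolding fun_upd_twist[OF False, of y "y i + d/2" "y j + d/2"] by linarith
    then have eq: "partial j (partial i f) z = partial i (partial j f) w" using h(1) by simp
    have "\<bar>partial j (partial i f) z - partial j (partial i f) y\<bar> < e" "\<bar>partial i (partial j f) w - partial i (partial j f) y\<bar> < e"
      using d1(3) d2(3) z(1) w(1) d(3,4) by auto
    then show False using eq unfolding e_def by argo
  qed
qed simp

section \<open>Positive definite matrices\<close>

definition positive_definite :: "nat \<Rightarrow> (nat \<Rightarrow> nat \<Rightarrow> real) \<Rightarrow> bool" where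
  "positive_definite n g \<longleftrightarrow> (\<forall>i<n. \<forall>j<n. g i j = g j i) \<and>
     (\<forall>v. (\<exists>i<n. v i \<noteq> 0) \<longrightarrow> (\<Sum>i<n. \<Sum>j<n. g i j * v i * v j) > 0)"

definition inverse_entries :: "nat \<Rightarrow> (nat \<Rightarrow> nat \<Rightarrow> real) \<Rightarrow> nat \<Rightarrow> nat \<Rightarrow> real" where
  "inverse_entries n g i j = the (mat_inverse (square_mat n g)) $$ (i, j)"

text \<open>Completing the square in the last variable leaves a positive definite form in one
  variable less.\<close>

lemma positive_definite_Cholesky:
  assumes "positive_definite n g"
  shows "\<exists>C. \<forall>i<n. \<forall>j<n. g i j = (\<Sum>k<n. C k i * C k j)"
  using assms
proof (induction n arbitrary: g)
  case (Suc n)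
  define a where "a = g n n"
  have sym: "g i j = g j i" if "i < Suc n" "j < Suc n" for i j
    using Suc.prems that by (auto simp: positive_definite_def)
  have pos: "(\<Sum>i<Suc n. \<Sum>j<Suc n. g i j * v i * v j) > 0" if "\<exists>i<Suc n. v i \<noteq> 0" for v
    using Suc.prems that unfolding positive_definite_def by blast
  have "(\<Sum>i<Suc n. \<Sum>j<Suc n. g i j * (if i = n then 1 else 0) * (if j = n then 1 else 0)) = a"
    by (simp add: a_def)
  then have a: "a > 0" using pos[of "\<lambda>i. if i = n then 1 else 0"] by auto
  \<comment> \<open>The Schur complement of the last diagonal entry.\<close>
  define h where "h i j = g i j - g i n * g j n / a" for i j
  have "positive_definite n h"
    unfolding positive_definite_def
  proof (intro conjI allI impI)
    fix i j assume "i < n" "j < n"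
    then show "h i j = h j i" using sym[of i j] by (simp add: h_def)
  next
    fix v :: "nat \<Rightarrow> real" assume v: "\<exists>i<n. v i \<noteq> 0"
    \<comment> \<open>The last entry \<open>- s / a\<close> of \<open>w\<close> minimizes the form
      of g over all extensions of v, and the minimum is the form of h at v.\<close>
    define s where "s = (\<Sum>i<n. g i n * v i)"
    define w where "w i = (if i = n then - s / a else v i)" for i
    have wn: "w n = - s / a" and wi: "\<And>i. i < n \<Longrightarrow> w i = v i" by (auto simp: w_def)
    have "\<exists>i<Suc n. w i \<noteq> 0" using v wi by (metis less_Suc_eq)
    from pos[OF this] have "0 < (\<Sum>i<Suc n. \<Sum>j<Suc n. g i j * w i * w j)" .
    also have "\<dots> = (\<Sum>i<n. \<Sum>j<n. g i j * v i * v j) + (\<Sum>i<n. g i n * v i * w n)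
        + ((\<Sum>j<n. g n j * w n * v j) + a * w n * w n)"
      using wi by (simp add: sum.distrib a_def)
    also have "(\<Sum>i<n. g i n * v i * w n) = s * w n" by (simp add: s_def sum_distrib_right)
    also have "(\<Sum>j<n. g n j * w n * v j) = w n * s"
      unfolding s_def sum_distrib_left using sym by (intro sum.cong) auto
    also have "(\<Sum>i<n. \<Sum>j<n. g i j * v i * v j) + s * w n + (w n * s + a * w n * w n)
        = (\<Sum>i<n. \<Sum>j<n. g i j * v i * v j) - s * s / a"
      using a by (simp add: wn field_simps)
    also have "s * s / a = (\<Sum>i<n. \<Sum>j<n. g i n * g j n / a * v i * v j)"
      unfolding s_def sum_product by (simp add: sum_divide_distrib mult_ac)
    also have "(\<Sum>i<n. \<Sum>j<n. g i j * v i * v j) - (\<Sum>i<n. \<Sum>j<n. g i n * g j n / a * v i * v j)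
        = (\<Sum>i<n. \<Sum>j<n. h i j * v i * v j)"
      by (simp add: h_def sum_subtractf[symmetric] left_diff_distrib)
    finally show "0 < (\<Sum>i<n. \<Sum>j<n. h i j * v i * v j)" .
  qed
  then obtain C where C: "\<And>i j. i < n \<Longrightarrow> j < n \<Longrightarrow> h i j = (\<Sum>k<n. C k i * C k j)"
    using Suc.IH by blast
  \<comment> \<open>The factor of h is extended by a zero column; the new row restores the rank-one
    part that was subtracted from g.\<close>
  define B where "B k i = (if k < n then (if i < n then C k i else 0) else g i n / sqrt a)" for k i
  have "g i j = (\<Sum>k<Suc n. B k i * B k j)" if ij: "i < Suc n" "j < Suc n" for i j
  proof -
    have "(\<Sum>k<Suc n. B k i * B k j) = (\<Sum>k<n. B k i * B k j) + g i n * g j n / a"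
      using a by (simp add: B_def)
    also have "(\<Sum>k<n. B k i * B k j) = (if i < n \<and> j < n then h i j else 0)"
    proof (cases "i < n \<and> j < n")
      case True
      then show ?thesis using C[of i j] by (simp add: B_def)
    next
      case False
      then have "B k i * B k j = 0" if "k < n" for k using that by (auto simp: B_def)
      then have "(\<Sum>k<n. B k i * B k j) = 0" by (intro sum.neutral) blast
      then show ?thesis unfolding if_not_P[OF False] .
    qed
    finally have *: "(\<Sum>k<Suc n. B k i * B k j) = (if i < n \<and> j < n then h i j else 0) + g i n * g j n / a" .
    have "(if i < n \<and> j < n then h i j else 0) + g i n * g j n / a = g i j"
    proof (cases "i < n \<and> j < n")
      case True
      then show ?thesis unfolding h_def by simp
    next
      case False
      then have "j = n \<or> i = n" using ij by auto
      then have "g i n * g j n = g i j * a"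
      proof
        assume i: "i = n"
        show ?thesis unfolding a_def i using sym[of n j] ij by simp
      qed (simp add: a_def)
      then show ?thesis unfolding if_not_P[OF False] using a by simp
    qed
    then show ?thesis unfolding * ..
  qed
  then show ?case by blast
qed simp

section \<open>Determinant and inverse of a positive definite matrix, and their continuity\<close>

lemma square_mat_mult:
  "square_mat n a * square_mat n b = square_mat n (\<lambda>i j. \<Sum>k<n. a i k * b k j)"
  by (rule eq_matI) (auto simp: square_mat_def scalar_prod_def atLeast0LessThan)

lemma square_mat_carrier [simp]: "square_mat n a \<in> carrier_mat n n"
  by (simp add: square_mat_def)

lemma square_mat_index [simp]: "i < n \<Longrightarrow> j < n \<Longrightarrow> square_mat n a $$ (i, j) = a i j"
  by (simp add: square_mat_def)

text \<open>A nonzero kernel vector would have quadratic form zero.\<close>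

lemma positive_definite_det_nonzero:
  assumes "positive_definite n g"
  shows "Determinant.det (square_mat n g) \<noteq> 0"
proof
  assume "Determinant.det (square_mat n g) = 0"
  then obtain v where v: "v \<in> carrier_vec n" "v \<noteq> 0\<^sub>v n" "square_mat n g *\<^sub>v v = 0\<^sub>v n"
    using det_0_iff_vec_prod_zero_field[OF square_mat_carrier] by blast
  have dv: "dim_vec v = n" using v(1) by auto
  have gv: "(\<Sum>j<n. g i j * vec_index v j) = 0" if "i < n" for i
  proof -
    have "vec_index (square_mat n g *\<^sub>v v) i = (\<Sum>j<n. g i j * vec_index v j)"
      using that dv by (simp add: square_mat_def scalar_prod_def atLeast0LessThan)
    then show ?thesis using v(3) that by simp
  qed
  have "\<exists>i<n. vec_index v i \<noteq> 0" using v(2) dv by (metis eq_vecI index_zero_vec)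
  then have "0 < (\<Sum>i<n. \<Sum>j<n. g i j * vec_index v i * vec_index v j)"
    using assms by (auto simp: positive_definite_def)
  also have "\<dots> = (\<Sum>i<n. vec_index v i * (\<Sum>j<n. g i j * vec_index v j))"
    by (simp add: sum_distrib_left mult_ac)
  also have "\<dots> = 0" using gv by simp
  finally show False by simp
qed

text \<open>The Cholesky factorization makes the determinant a square, and it is not zero.\<close>

lemma positive_definite_det_pos:
  assumes "positive_definite n g"
  shows "Determinant.det (square_mat n g) > 0"
proof -
  obtain C where C: "\<forall>i<n. \<forall>j<n. g i j = (\<Sum>k<n. C k i * C k j)"
    using positive_definite_Cholesky[OF assms] by blast
  let ?C = "square_mat n C"
  have "square_mat n g = transpose_mat ?C * ?C"
  proof -
    have "transpose_mat ?C = square_mat n (\<lambda>i j. C j i)" by (rule eq_matI) (auto simp: square_mat_def)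
    then show ?thesis using C by (simp add: square_mat_mult) (auto simp: square_mat_def intro!: eq_matI)
  qed
  then have "Determinant.det (square_mat n g) = Determinant.det ?C * Determinant.det ?C"
    using det_mult[of "transpose_mat ?C" n ?C] det_transpose[of ?C n] by simp
  then show ?thesis using positive_definite_det_nonzero[OF assms]
    by (metis not_real_square_gt_zero mult_zero_left)
qed

text \<open>The third fact compares the inverse B with the adjugate through the product of B, the
  matrix and its adjugate. It presents the entries as quotients of polynomials, from which their
  continuity in the point follows.\<close>

lemma inverse_entries:
  assumes "Determinant.det (square_mat n g) \<noteq> 0" "i < n" "j < n"
  shows "(\<Sum>k<n. g i k * inverse_entries n g k j) = (if i = j then 1 else 0)"
    and "(\<Sum>k<n. inverse_entries n g i k * g k j) = (if i = j then 1 else 0)"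
    and "inverse_entries n g i j = cofactor (square_mat n g) j i / Determinant.det (square_mat n g)"
proof -
  let ?G = "square_mat n g"
  have "?G \<in> Units (ring_mat TYPE(real) n ())"
    by (rule det_non_zero_imp_unit[OF square_mat_carrier assms(1)])
  then have "mat_inverse ?G \<noteq> None"
    using mat_inverse(1)[OF square_mat_carrier[of n g], where b = "()"] by auto
  then obtain B where B0: "mat_inverse ?G = Some B" by blast
  then have B: "?G * B = 1\<^sub>m n" "B * ?G = 1\<^sub>m n" "B \<in> carrier_mat n n"
    using mat_inverse(2)[OF square_mat_carrier] by blast+
  have Be: "B = square_mat n (inverse_entries n g)"
    using B(3) B0 by (intro eq_matI) (auto simp: square_mat_def inverse_entries_def)
  have "square_mat n (\<lambda>i j. \<Sum>k<n. g i k * inverse_entries n g k j) $$ (i, j) = 1\<^sub>m n $$ (i, j)"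
    using B(1) unfolding Be square_mat_mult by simp
  then show "(\<Sum>k<n. g i k * inverse_entries n g k j) = (if i = j then 1 else 0)" using assms by simp
  have "square_mat n (\<lambda>i j. \<Sum>k<n. inverse_entries n g i k * g k j) $$ (i, j) = 1\<^sub>m n $$ (i, j)"
    using B(2) unfolding Be square_mat_mult by simp
  then show "(\<Sum>k<n. inverse_entries n g i k * g k j) = (if i = j then 1 else 0)" using assms by simp
  have "adj_mat ?G = B * ?G * adj_mat ?G" using B(2) adj_mat(1)[OF square_mat_carrier, of n g] by simp
  also have "\<dots> = B * (?G * adj_mat ?G)"
    using B(3) adj_mat(1)[OF square_mat_carrier, of n g] by (intro assoc_mult_mat[of _ n n _ n _ n]) auto
  also have "\<dots> = Determinant.det ?G \<cdot>\<^sub>m B"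
    unfolding adj_mat(2)[OF square_mat_carrier]
    using mult_smult_distrib[OF B(3), of "1\<^sub>m n" n "Determinant.det ?G"] B(3) by simp
  finally have "adj_mat ?G $$ (i, j) = Determinant.det ?G * B $$ (i, j)" using B(3) assms by simp
  moreover have "adj_mat ?G $$ (i, j) = cofactor ?G j i"
    using assms by (simp add: adj_mat_def square_mat_def)
  ultimately show "inverse_entries n g i j = cofactor ?G j i / Determinant.det ?G"
    using assms B0 by (simp add: inverse_entries_def)
qed

lemma continuous_on_det:
  fixes A :: "'a::topological_space \<Rightarrow> real mat"
  assumes "\<And>x. x \<in> S \<Longrightarrow> A x \<in> carrier_mat n n"
    and "\<And>i j. i < n \<Longrightarrow> j < n \<Longrightarrow> continuous_on S (\<lambda>x. A x $$ (i, j))"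
  shows "continuous_on S (\<lambda>x. Determinant.det (A x))"
proof -
  have "continuous_on S (\<lambda>x. \<Sum>p | p permutes {0..<n}. signof p * (\<Prod>i = 0..<n. A x $$ (i, p i)))"
  proof (intro continuous_on_sum continuous_on_mult continuous_on_const continuous_on_prod)
    fix p i assume "p \<in> {p. p permutes {0..<n}}" "i \<in> {0..<n}"
    then show "continuous_on S (\<lambda>x. A x $$ (i, p i))"
      using permutes_in_image[of p "{0..<n}" i] by (intro assms(2)) auto
  qed
  then show ?thesis
    by (rule continuous_on_eq) (simp add: det_def'[OF assms(1)])
qed

lemma continuous_on_cofactor:
  fixes A :: "'a::topological_space \<Rightarrow> real mat"
  assumes A: "\<And>x. x \<in> S \<Longrightarrow> A x \<in> carrier_mat n n"
    and c: "\<And>i j. i < n \<Longrightarrow> j < n \<Longrightarrow> continuous_on S (\<lambda>x. A x $$ (i, j))"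
  shows "continuous_on S (\<lambda>x. cofactor (A x) k l)"
  unfolding cofactor_def
proof (intro continuous_on_mult continuous_on_const continuous_on_det[where n = "n - 1"])
  show "mat_delete (A x) k l \<in> carrier_mat (n - 1) (n - 1)" if "x \<in> S" for x
    using A[OF that] by (rule mat_delete_carrier)
  fix i j assume ij: "i < n - 1" "j < n - 1"
  \<comment> \<open>Deleting row k and column l shifts the later indices by one.\<close>
  have "continuous_on S (\<lambda>x. A x $$ (if i < k then i else Suc i, if j < l then j else Suc j))"
    using ij by (intro c) auto
  then show "continuous_on S (\<lambda>x. mat_delete (A x) k l $$ (i, j))"
    using ij A by (elim continuous_on_eq) (auto simp: mat_delete_def dest!: A)
qed

lemma continuous_on_det_square_mat:
  assumes "\<And>i j. i < n \<Longrightarrow> j < n \<Longrightarrow> continuous_on S (\<lambda>x. g x i j)"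
  shows "continuous_on S (\<lambda>x. Determinant.det (square_mat n (g x)))"
  using assms by (intro continuous_on_det[where n = n]) auto

lemma continuous_on_inverse_entries:
  assumes c: "\<And>i j. i < n \<Longrightarrow> j < n \<Longrightarrow> continuous_on S (\<lambda>x. g x i j)"
    and d: "\<And>x. x \<in> S \<Longrightarrow> Determinant.det (square_mat n (g x)) \<noteq> 0" and ij: "i < n" "j < n"
  shows "continuous_on S (\<lambda>x. inverse_entries n (g x) i j)"
proof -
  have "continuous_on S (\<lambda>x. cofactor (square_mat n (g x)) j i / Determinant.det (square_mat n (g x)))"
    using c d by (intro continuous_on_divide continuous_on_cofactor[where n = n] continuous_on_det_square_mat) auto
  then show ?thesis by (rule continuous_on_eq) (simp add: inverse_entries(3)[OF d ij])
qed

text \<open>If \<open>g = C\<^sup>T C\<close>, then \<open>N = C g\<^sup>-\<^sup>1\<close> satisfies \<open>g\<^sup>-\<^sup>1 = N\<^sup>T N\<close> and \<open>C\<^sup>T N = 1\<close>; hence the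
  quadratic form of \<open>g\<^sup>-\<^sup>1 \<otimes> \<dots> \<otimes> g\<^sup>-\<^sup>1\<close> is a sum of squares of an injective transform.\<close>

lemma inverse_entries_factor:
  assumes "positive_definite n g"
  shows "\<exists>C N. (\<forall>i<n. \<forall>j<n. inverse_entries n g i j = (\<Sum>k<n. N k i * N k j)) \<and>
    (\<forall>i<n. \<forall>j<n. (\<Sum>k<n. C k i * N k j) = (if i = j then 1 else 0))"
proof -
  obtain C where C: "\<And>i j. i < n \<Longrightarrow> j < n \<Longrightarrow> g i j = (\<Sum>k<n. C k i * C k j)"
    using positive_definite_Cholesky[OF assms] by blast
  note inv = inverse_entries[OF positive_definite_det_nonzero[OF assms]]
  define h where "h = inverse_entries n g"
  define N where "N k j = (\<Sum>l<n. C k l * h l j)" for k j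
  have CN: "(\<Sum>k<n. C k i * N k j) = (if i = j then 1 else 0)" if "i < n" "j < n" for i j
  proof -
    have "(\<Sum>k<n. C k i * N k j) = (\<Sum>k<n. \<Sum>l<n. C k i * C k l * h l j)"
      by (simp add: N_def sum_distrib_left mult.assoc)
    also have "\<dots> = (\<Sum>l<n. \<Sum>k<n. C k i * C k l * h l j)" by (rule sum.swap)
    also have "\<dots> = (\<Sum>l<n. g i l * h l j)"
      using C that by (intro sum.cong) (simp_all add: sum_distrib_right)
    finally show ?thesis using inv(1)[OF that] by (simp add: h_def)
  qed
  have "h i j = (\<Sum>k<n. N k i * N k j)" if ij: "i < n" "j < n" for i j
  proof -
    have "(\<Sum>k<n. N k i * N k j) = (\<Sum>k<n. \<Sum>l<n. h l i * (C k l * N k j))"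
      by (simp add: N_def[of _ i] sum_distrib_left sum_distrib_right mult_ac)
    also have "\<dots> = (\<Sum>l<n. \<Sum>k<n. h l i * (C k l * N k j))" by (rule sum.swap)
    also have "\<dots> = (\<Sum>l<n. h l i * (\<Sum>k<n. C k l * N k j))" by (simp add: sum_distrib_left)
    also have "\<dots> = (\<Sum>l<n. h l i * (if l = j then 1 else 0))" using CN ij by (intro sum.cong) auto
    also have "\<dots> = h j i" using ij by (simp add: if_distrib[of "\<lambda>x. _ * x"] cong: if_cong)
    finally have sym: "(\<Sum>k<n. N k i * N k j) = h j i" .
    \<comment> \<open>Unfolding N in its second occurrence lets C meet the first one; their
      contraction is a Kronecker delta and leaves \<open>h i j\<close>.\<close>
    have "(\<Sum>k<n. N k i * N k j) = (\<Sum>k<n. \<Sum>l<n. h l j * (C k l * N k i))"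
      by (simp add: N_def[of _ j] sum_distrib_left mult_ac)
    also have "\<dots> = (\<Sum>l<n. \<Sum>k<n. h l j * (C k l * N k i))" by (rule sum.swap)
    also have "\<dots> = (\<Sum>l<n. h l j * (\<Sum>k<n. C k l * N k i))" by (simp add: sum_distrib_left)
    also have "\<dots> = (\<Sum>l<n. h l j * (if l = i then 1 else 0))" using CN ij by (intro sum.cong) auto
    also have "\<dots> = h i j" using ij by (simp add: if_distrib[of "\<lambda>x. _ * x"] cong: if_cong)
    finally show ?thesis by simp
  qed
  then show ?thesis using CN unfolding h_def by blast
qed

lemma tensor_power_inverse_positive:
  fixes A :: "nat list \<Rightarrow> real"
  assumes "positive_definite n g"
    and Q_def: "Q = (\<Sum>ks\<in>index_lists n p. A ks *
    (\<Sum>ls\<in>index_lists n p. (\<Prod>a<p. inverse_entries n g (ks ! a) (ls ! a)) * A ls))"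
  shows "Q \<ge> 0" and "Q = 0 \<Longrightarrow> ks \<in> index_lists n p \<Longrightarrow> A ks = 0"
proof -
  obtain C N where N: "\<forall>i<n. \<forall>j<n. inverse_entries n g i j = (\<Sum>k<n. N k i * N k j)"
    and CN: "\<forall>i<n. \<forall>j<n. (\<Sum>k<n. C k i * N k j) = (if i = j then 1 else 0)"
    using inverse_entries_factor[OF assms(1)] by blast
  let ?I = "index_lists n p"
  have nth: "ks ! a < n" if "ks \<in> ?I" "a < p" for ks a
    using that nth_mem[of a ks] by (auto simp: index_lists_def subset_iff)
  \<comment> \<open>The p-fold tensor power of N applied to A; the quadratic form Q will be the sum
    of squares of its components.\<close>
  define R where "R ms = (\<Sum>ks\<in>?I. (\<Prod>a<p. N (ms ! a) (ks ! a)) * A ks)" for ms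
  have pr: "(\<Prod>a<p. inverse_entries n g (ks ! a) (ls ! a))
      = (\<Sum>ms\<in>?I. (\<Prod>a<p. N (ms ! a) (ks ! a)) * (\<Prod>a<p. N (ms ! a) (ls ! a)))"
    if "ks \<in> ?I" "ls \<in> ?I" for ks ls
  proof -
    have "(\<Prod>a<p. inverse_entries n g (ks ! a) (ls ! a)) = (\<Prod>a<p. \<Sum>k<n. N k (ks ! a) * N k (ls ! a))"
      using N nth that by (intro prod.cong) auto
    then show ?thesis
      by (simp add: sum_index_lists_prod[symmetric] prod.distrib[symmetric])
  qed
  have "Q = (\<Sum>ks\<in>?I. \<Sum>ls\<in>?I. \<Sum>ms\<in>?I. ((\<Prod>a<p. N (ms ! a) (ks ! a)) * A ks) * ((\<Prod>a<p. N (ms ! a) (ls ! a)) * A ls))"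
    unfolding Q_def sum_distrib_left
    by (intro sum.cong refl) (simp add: pr sum_distrib_left sum_distrib_right mult_ac)
  also have "\<dots> = (\<Sum>ks\<in>?I. \<Sum>ms\<in>?I. \<Sum>ls\<in>?I. ((\<Prod>a<p. N (ms ! a) (ks ! a)) * A ks) * ((\<Prod>a<p. N (ms ! a) (ls ! a)) * A ls))"
    by (intro sum.cong refl sum.swap)
  also have "\<dots> = (\<Sum>ms\<in>?I. \<Sum>ks\<in>?I. \<Sum>ls\<in>?I. ((\<Prod>a<p. N (ms ! a) (ks ! a)) * A ks) * ((\<Prod>a<p. N (ms ! a) (ls ! a)) * A ls))"
    by (rule sum.swap)
  also have "\<dots> = (\<Sum>ms\<in>?I. (R ms)\<^sup>2)"
    unfolding R_def power2_eq_square sum_product ..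
  finally have Q: "Q = (\<Sum>ms\<in>?I. (R ms)\<^sup>2)" .
  show "Q \<ge> 0" unfolding Q by (simp add: sum_nonneg)
  show "A ks = 0" if "Q = 0" and ks: "ks \<in> ?I"
  proof -
    have R0: "R ms = 0" if "ms \<in> ?I" for ms
      using \<open>Q = 0\<close> that unfolding Q by (simp add: sum_nonneg_eq_0_iff)
    \<comment> \<open>The tensor power of the transpose of C inverts that of N, so it recovers
      \<open>A ks\<close> from R, which is zero.\<close>
    have "0 = (\<Sum>ms\<in>?I. (\<Prod>a<p. C (ms ! a) (ks ! a)) * R ms)" using R0 by simp
    also have "\<dots> = (\<Sum>ms\<in>?I. \<Sum>ls\<in>?I. (\<Prod>a<p. C (ms ! a) (ks ! a) * N (ms ! a) (ls ! a)) * A ls)"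
      by (simp add: R_def sum_distrib_left prod.distrib mult.assoc)
    also have "\<dots> = (\<Sum>ls\<in>?I. \<Sum>ms\<in>?I. (\<Prod>a<p. C (ms ! a) (ks ! a) * N (ms ! a) (ls ! a)) * A ls)"
      by (rule sum.swap)
    also have "\<dots> = (\<Sum>ls\<in>?I. (\<Prod>a<p. \<Sum>m<n. C m (ks ! a) * N m (ls ! a)) * A ls)"
      by (intro sum.cong refl)
        (simp only: sum_distrib_right[symmetric] sum_index_lists_prod[of "\<lambda>a m. C m (ks ! a) * N m (ls ! a)" p n for ls])
    also have "\<dots> = (\<Sum>ls\<in>?I. (if ls = ks then 1 else 0) * A ls)"
    proof (intro sum.cong refl arg_cong2[of _ _ _ _ "(*)"])
      fix ls assume ls: "ls \<in> ?I"
      have "(\<Prod>a<p. \<Sum>m<n. C m (ks ! a) * N m (ls ! a)) = (\<Prod>a<p. if ks ! a = ls ! a then 1 else 0)"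
        using CN nth ls ks by (intro prod.cong) auto
      also have "\<dots> = (if ls = ks then 1 else 0)"
      proof (cases "ls = ks")
        case False
        then obtain a where "a < p" "ks ! a \<noteq> ls ! a"
          using ls ks by (metis (mono_tags, lifting) index_lists_def mem_Collect_eq nth_equalityI)
        then show ?thesis using False by (auto intro!: prod_zero)
      qed auto
      finally show "(\<Prod>a<p. \<Sum>m<n. C m (ks ! a) * N m (ls ! a)) = (if ls = ks then 1 else 0)" .
    qed
    also have "\<dots> = A ks" using ks by (simp add: if_distrib[of "\<lambda>x. x * _"] sum.delta cong: if_cong)
    finally show ?thesis by simp
  qed
qed

section \<open>The exterior derivative\<close>

locale oriented_manifold =
  fixes M :: "'a riem"
  assumes oriented_smooth: "oriented_smooth_manifold M"
begin

abbreviation (input) "n \<equiv> mdim M"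

lemma atlas_is_chart: "c \<in> atlas M \<Longrightarrow> is_chart (points M) n c"
  using oriented_smooth by (simp add: oriented_smooth_manifold_def)

lemma openin_fst: "c \<in> atlas M \<Longrightarrow> openin (points M) (fst c)"
  using atlas_is_chart by (auto simp: is_chart_def)

lemma openin_image: "c \<in> atlas M \<Longrightarrow> openin (Euclidean_space n) (snd c ` fst c)"
  using atlas_is_chart by (auto simp: is_chart_def)

lemma homeomorphic_chart:
  "c \<in> atlas M \<Longrightarrow>
    homeomorphic_map (subtopology (points M) (fst c)) (subtopology (Euclidean_space n) (snd c ` fst c)) (snd c)"
  using atlas_is_chart by (auto simp: is_chart_def)

lemma fst_subset: "c \<in> atlas M \<Longrightarrow> fst c \<subseteq> topspace (points M)"
  by (rule openin_subset[OF openin_fst])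

lemma topspace_chart: "c \<in> atlas M \<Longrightarrow> topspace (subtopology (points M) (fst c)) = fst c"
  using fst_subset by (simp add: Int_absorb1)

lemma topspace_image:
  "c \<in> atlas M \<Longrightarrow> topspace (subtopology (Euclidean_space n) (snd c ` fst c)) = snd c ` fst c"
  by (simp add: Int_absorb1 openin_subset[OF openin_image])

lemma inj_on_chart: "c \<in> atlas M \<Longrightarrow> inj_on (snd c) (fst c)"
  using homeomorphic_imp_injective_map[OF homeomorphic_chart, of c] by (simp only: topspace_chart)

lemma chart_inv_chart [simp]: "c \<in> atlas M \<Longrightarrow> x \<in> fst c \<Longrightarrow> chart_inv c (snd c x) = x"
  by (simp add: chart_inv_def inv_into_f_f inj_on_chart)

lemma continuous_chart_inv:
  assumes "c \<in> atlas M"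
  shows "continuous_map (subtopology (Euclidean_space n) (snd c ` fst c)) (subtopology (points M) (fst c)) (chart_inv c)"
proof -
  obtain g where g: "homeomorphic_maps (subtopology (points M) (fst c))
      (subtopology (Euclidean_space n) (snd c ` fst c)) (snd c) g"
    using homeomorphic_chart[OF assms] homeomorphic_map_maps by blast
  have "g y = chart_inv c y" if "y \<in> snd c ` fst c" for y
    using g that assms unfolding homeomorphic_maps_def topspace_chart[OF assms] by auto
  then show ?thesis
    using g by (auto simp: homeomorphic_maps_def topspace_image[OF assms] intro: continuous_map_eq)
qed

lemma openin_chart_image:
  assumes "c \<in> atlas M" "openin (points M) W" "W \<subseteq> fst c"
  shows "openin (Euclidean_space n) (snd c ` W)"
proof -
  have "openin (subtopology (points M) (fst c)) W"
    using assms openin_fst by (simp add: openin_open_subtopology)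
  then have "openin (subtopology (Euclidean_space n) (snd c ` fst c)) (snd c ` W)"
    using homeomorphic_imp_open_map[OF homeomorphic_chart[OF assms(1)]] unfolding open_map_def by blast
  then show ?thesis using openin_open_subtopology[OF openin_image[OF assms(1)]] by blast
qed

lemma openin_overlap:
  assumes "c \<in> atlas M" "c' \<in> atlas M"
  shows "openin (Euclidean_space n) (snd c ` (fst c \<inter> fst c'))"
  by (intro openin_chart_image openin_Int openin_fst assms) simp

lemma smooth_transition:
  "c \<in> atlas M \<Longrightarrow> c' \<in> atlas M \<Longrightarrow> k < n \<Longrightarrow>
    smooth_on n (snd c ` (fst c \<inter> fst c')) (\<lambda>y. snd c' (chart_inv c y) k)"
  using oriented_smooth by (simp add: oriented_smooth_manifold_def)

lemma chart_partial_cong: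
  assumes "c \<in> atlas M" "openin (points M) W" "W \<subseteq> fst c" "x \<in> W" "i < n" "\<And>z. z \<in> W \<Longrightarrow> f z = g z"
  shows "chart_partial c i f x = chart_partial c i g x"
  unfolding chart_partial_def
proof (rule partial_cong[OF openin_chart_image[OF assms(1-3)] _ assms(5)])
  show "snd c x \<in> snd c ` W" using assms by blast
  fix y assume "y \<in> snd c ` W"
  then have "chart_inv c y \<in> W" using assms by auto
  then show "f (chart_inv c y) = g (chart_inv c y)" by (rule assms(6))
qed

lemma chart_partial_add_scale:
  assumes "c \<in> atlas M" "x \<in> fst c" "i < n" "smooth_in_chart n c f" "smooth_in_chart n c g"
  shows "chart_partial c i (\<lambda>z. f z + r * g z) x = chart_partial c i f x + r * chart_partial c i g x"
  unfolding chart_partial_def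
  using assms unfolding smooth_in_chart_def
  by (intro partial_eqI DERIV_add DERIV_cmult smooth_on_has_partial[where S = "snd c ` fst c"]) auto

lemma chart_partial_const [simp]: "chart_partial c i (\<lambda>_. a) x = 0"
  by (simp add: chart_partial_def partial_def)

section \<open>Components of forms and their linear combinations\<close>

lemma form_zero:
  "\<omega> \<in> forms M p \<Longrightarrow> \<not> (c \<in> atlas M \<and> x \<in> fst c \<and> ns \<in> index_lists n p) \<Longrightarrow> \<omega> c x ns = 0"
  unfolding forms_def by blast

lemma form_alternating:
  "\<omega> \<in> forms M p \<Longrightarrow> c \<in> atlas M \<Longrightarrow> x \<in> fst c \<Longrightarrow> alternating n p (\<omega> c x)"
  unfolding forms_def alternating_def by blast

lemma form_transform:
  "\<omega> \<in> forms M p \<Longrightarrow> c \<in> atlas M \<Longrightarrow> c' \<in> atlas M \<Longrightarrow> x \<in> fst c \<Longrightarrow> x \<in> fst c' \<Longrightarrow> ns \<in> index_lists n p \<Longrightarrow>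
    \<omega> c x ns = (\<Sum>js\<in>index_lists n p. (\<Prod>a<p. jacobian c c' x (js ! a) (ns ! a)) * \<omega> c' x js)"
  unfolding forms_def by blast

text \<open>Meaningless index lists give the zero function, so smoothness is available for every
  list, in particular for those obtained by deleting an entry.\<close>

lemma form_smooth:
  assumes "\<omega> \<in> forms M p" "c \<in> atlas M"
  shows "smooth_in_chart n c (\<lambda>x. \<omega> c x ns)"
proof (cases "ns \<in> index_lists n p")
  case True
  then show ?thesis using assms unfolding forms_def by blast
next
  case False
  then have "\<omega> c x ns = 0" for x using form_zero[OF assms(1)] by blast
  then show ?thesis by (simp add: smooth_in_chart_def smooth_on_const)
qed

lemma formsI:
  assumes "\<And>c x ns. \<not> (c \<in> atlas M \<and> x \<in> fst c \<and> ns \<in> index_lists n p) \<Longrightarrow> \<omega> c x ns = 0"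
    and "\<And>c x. c \<in> atlas M \<Longrightarrow> x \<in> fst c \<Longrightarrow> alternating n p (\<omega> c x)"
    and "\<And>c ns. c \<in> atlas M \<Longrightarrow> ns \<in> index_lists n p \<Longrightarrow> smooth_in_chart n c (\<lambda>x. \<omega> c x ns)"
    and "\<And>c c' x ns. c \<in> atlas M \<Longrightarrow> c' \<in> atlas M \<Longrightarrow> x \<in> fst c \<Longrightarrow> x \<in> fst c' \<Longrightarrow> ns \<in> index_lists n p \<Longrightarrow>
      \<omega> c x ns = (\<Sum>js\<in>index_lists n p. (\<Prod>a<p. jacobian c c' x (js ! a) (ns ! a)) * \<omega> c' x js)"
  shows "\<omega> \<in> forms M p"
  unfolding forms_def using assms[unfolded alternating_def] by (intro CollectI conjI allI ballI impI) blast+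

text \<open>Sums, differences and multiples are all of this one shape (r = 1, r = -1, first summand
  0), so linearity is stated in it throughout.\<close>

lemma forms_add_scale:
  assumes "\<alpha> \<in> forms M p" "\<beta> \<in> forms M p"
  shows "\<alpha> + form_scale r \<beta> \<in> forms M p"
proof (rule formsI)
  show "(\<alpha> + form_scale r \<beta>) c x ns = 0" if "\<not> (c \<in> atlas M \<and> x \<in> fst c \<and> ns \<in> index_lists n p)" for c x ns
    using form_zero[OF assms(1) that] form_zero[OF assms(2) that] by (simp add: form_scale_def)
  show "alternating n p ((\<alpha> + form_scale r \<beta>) c x)" if "c \<in> atlas M" "x \<in> fst c" for c x
    using form_alternating[OF assms(1) that] form_alternating[OF assms(2) that]
    by (simp add: alternating_def form_scale_def distrib_left mult.left_commute)
  show "smooth_in_chart n c (\<lambda>x. (\<alpha> + form_scale r \<beta>) c x ns)" if "c \<in> atlas M" for c ns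
    using form_smooth[OF assms(1) that] form_smooth[OF assms(2) that] openin_image[OF that]
    unfolding smooth_in_chart_def by (auto simp: form_scale_def intro: smooth_on_add_scale)
  show "(\<alpha> + form_scale r \<beta>) c x ns
      = (\<Sum>js\<in>index_lists n p. (\<Prod>a<p. jacobian c c' x (js ! a) (ns ! a)) * (\<alpha> + form_scale r \<beta>) c' x js)"
    if "c \<in> atlas M" "c' \<in> atlas M" "x \<in> fst c" "x \<in> fst c'" "ns \<in> index_lists n p" for c c' x ns
    using form_transform[OF assms(1) that] form_transform[OF assms(2) that]
    by (simp add: form_scale_def distrib_left sum.distrib sum_distrib_left mult.left_commute)
qed

lemma zero_form: "0 \<in> forms M p"
  by (rule formsI) (simp_all add: alternating_def smooth_in_chart_def smooth_on_const)

lemma ext_deriv_add_scale: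
  assumes "\<alpha> \<in> forms M p" "\<beta> \<in> forms M p"
  shows "ext_deriv M (\<alpha> + form_scale r \<beta>) = ext_deriv M \<alpha> + form_scale r (ext_deriv M \<beta>)"
proof (intro ext)
  fix c x ns
  have "chart_partial c (ns ! k) (\<lambda>z. (\<alpha> + form_scale r \<beta>) c z js) x
      = chart_partial c (ns ! k) (\<lambda>z. \<alpha> c z js) x + r * chart_partial c (ns ! k) (\<lambda>z. \<beta> c z js) x"
    if "c \<in> atlas M" "x \<in> fst c" "set ns \<subseteq> {..<n}" "k < length ns" for js k
  proof -
    have "ns ! k < n" using that nth_mem by blast
    then show ?thesis
      using chart_partial_add_scale[OF that(1,2) _ form_smooth[OF assms(1) that(1)] form_smooth[OF assms(2) that(1)]]
      by (simp add: form_scale_def)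
  qed
  then show "ext_deriv M (\<alpha> + form_scale r \<beta>) c x ns = (ext_deriv M \<alpha> + form_scale r (ext_deriv M \<beta>)) c x ns"
    by (simp add: ext_deriv_def form_scale_def distrib_left sum.distrib sum_distrib_left mult.left_commute)
qed

text \<open>All first partial derivatives of the components, with the direction of differentiation
  as first index. Despite the name it does not transform as a tensor in general; its
  antisymmetrization does.\<close>

definition derivative_tensor :: "'a form \<Rightarrow> 'a form" where
  "derivative_tensor \<omega> c x ns = chart_partial c (hd ns) (\<lambda>z. \<omega> c z (tl ns)) x"

lemma alternating_chart_partial:
  assumes "\<omega> \<in> forms M p" "c \<in> atlas M" "x \<in> fst c" "i < n"
  shows "alternating n p (\<lambda>js. chart_partial c i (\<lambda>z. \<omega> c z js) x)"
  unfolding alternating_def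
proof (intro ballI allI impI)
  fix js \<sigma> assume js: "js \<in> index_lists n p" and \<sigma>: "\<sigma> permutes {..<p}"
  have "chart_partial c i (\<lambda>z. \<omega> c z (permute_list \<sigma> js)) x
      = chart_partial c i (\<lambda>z. 0 + of_int (sign \<sigma>) * \<omega> c z js) x"
    using alternatingD[OF form_alternating[OF assms(1,2)] js \<sigma>]
    by (intro chart_partial_cong[OF assms(2) openin_fst[OF assms(2)] order_refl assms(3,4)]) simp
  also have "\<dots> = of_int (sign \<sigma>) * chart_partial c i (\<lambda>z. \<omega> c z js) x"
    using chart_partial_add_scale[OF assms(2-4) _ form_smooth[OF assms(1,2)], of "\<lambda>_. 0"]
    by (simp add: smooth_in_chart_def smooth_on_const)
  finally show "chart_partial c i (\<lambda>z. \<omega> c z (permute_list \<sigma> js)) x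
      = of_int (sign \<sigma>) * chart_partial c i (\<lambda>z. \<omega> c z js) x" .
qed

text \<open>Among the (p + 1)! permutations those with the same leading index contribute equally, p!
  each. In this form the alternation and the chart change of \<open>ext_deriv\<close> become
  statements about permutation sums.\<close>

lemma ext_deriv_antisymmetrization:
  assumes "\<omega> \<in> forms M p" "c \<in> atlas M" "x \<in> fst c" "ns \<in> index_lists n (Suc p)"
  shows "ext_deriv M \<omega> c x ns =
    (\<Sum>\<sigma> | \<sigma> permutes {..<Suc p}. of_int (sign \<sigma>) * derivative_tensor \<omega> c x (permute_list \<sigma> ns)) / fact p"
proof -
  have "alternating n p (\<lambda>js. derivative_tensor \<omega> c x (i # js))" if "i < n" for i
    using alternating_chart_partial[OF assms(1-3) that] by (simp add: derivative_tensor_def)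
  from sum_permutations_Cons[OF this assms(4)]
  show ?thesis using assms by (simp add: ext_deriv_def derivative_tensor_def index_lists_def)
qed

lemma transition_point:
  assumes "c \<in> atlas M" "c' \<in> atlas M" "y \<in> snd c ` (fst c \<inter> fst c')"
  shows "chart_inv c y \<in> fst c \<inter> fst c'" "snd c' (chart_inv c y) \<in> snd c' ` fst c'" "snd c (chart_inv c y) = y"
    "chart_inv c' (snd c' (chart_inv c y)) = chart_inv c y"
  using assms by auto

text \<open>The product rule applied to the transformation law of \<omega>: the derivative falls
  either on a Jacobian entry, which gives the second derivatives H, or on a component, where the
  chain rule supplies one more Jacobian factor.\<close>

lemma derivative_tensor_transform:
  assumes \<omega>: "\<omega> \<in> forms M p" and c: "c \<in> atlas M" "c' \<in> atlas M" and x: "x \<in> fst c" "x \<in> fst c'"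
    and ns: "ns \<in> index_lists n (Suc p)"
  defines "H \<equiv> \<lambda>k j i. partial i (partial j (\<lambda>y. snd c' (chart_inv c y) k)) (snd c x)"
  shows "derivative_tensor \<omega> c x ns =
     (\<Sum>ls\<in>index_lists n p. (\<Sum>b<p. H (ls ! b) (ns ! Suc b) (ns ! 0) *
        (\<Prod>a\<in>{..<p} - {b}. jacobian c c' x (ls ! a) (ns ! Suc a))) * \<omega> c' x ls)
     + (\<Sum>ls\<in>index_lists n (Suc p). (\<Prod>a<Suc p. jacobian c c' x (ls ! a) (ns ! a)) * derivative_tensor \<omega> c' x ls)"
proof -
  obtain i js where nsi: "ns = i # js" using ns by (cases ns) (auto simp: index_lists_def)
  have i: "i < n" and js: "js \<in> index_lists n p" using ns nsi by (auto simp: index_lists_def)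
  have jsn: "js ! a < n" if "a < p" for a using index_lists_nth[OF js that] .
  let ?V = "snd c ` (fst c \<inter> fst c')" and ?I = "index_lists n p"
  define y0 where "y0 = snd c x"
  define F where "F k = (\<lambda>y. snd c' (chart_inv c y) k)" for k
  note V = openin_overlap[OF c]
  have y0: "y0 \<in> ?V" "chart_inv c y0 = x" using x c by (auto simp: y0_def)
  have F: "smooth_on n ?V (F k)" if "k < n" for k using smooth_transition[OF c that] by (simp add: F_def)
  have J: "jacobian c c' (chart_inv c y) k j = partial j (F k) y" if "y \<in> ?V" for y k j
    using transition_point(3)[OF c that] by (simp add: jacobian_def chart_partial_def F_def)
  have Jx: "jacobian c c' x k j = partial j (F k) y0" for k j using J[OF y0(1)] y0(2) by simp
  have H: "H k j i = partial i (partial j (F k)) y0" for k j i by (simp add: H_def F_def y0_def)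
  \<comment> \<open>The transformation law written in the coordinates of \<open>c\<close>; it
    represents \<omega> only on the overlap, which is open and therefore enough for a
    derivative.\<close>
  define G where "G y = (\<Sum>ls\<in>?I. (\<Prod>a<p. partial (js ! a) (F (ls ! a)) y) * \<omega> c' (chart_inv c y) ls)" for y
  have "derivative_tensor \<omega> c x ns = partial i (\<lambda>y. \<omega> c (chart_inv c y) js) y0"
    by (simp add: derivative_tensor_def nsi chart_partial_def y0_def)
  also have "\<dots> = partial i G y0"
  proof (rule partial_cong[OF V y0(1) i])
    fix y assume y: "y \<in> ?V"
    show "\<omega> c (chart_inv c y) js = G y"
      using form_transform[OF \<omega> c _ _ js, of "chart_inv c y"] transition_point(1)[OF c y] J[OF y]
      by (simp add: G_def)
  qed
  also have "\<dots> = (\<Sum>ls\<in>?I. (\<Sum>b<p. H (ls ! b) (js ! b) i *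
        (\<Prod>a\<in>{..<p} - {b}. jacobian c c' x (ls ! a) (js ! a))) * \<omega> c' x ls
      + (\<Sum>l<n. chart_partial c' l (\<lambda>z. \<omega> c' z ls) x * jacobian c c' x l i) * (\<Prod>a<p. jacobian c c' x (ls ! a) (js ! a)))"
  proof (rule partial_eqI)
    have D1: "((\<lambda>t. partial (js ! a) (F (ls ! a)) (y0(i := t))) has_real_derivative H (ls ! a) (js ! a) i) (at (y0 i))"
      if "ls \<in> ?I" "a < p" for ls a
    proof -
      have "ls ! a < n" using index_lists_nth[OF that] .
      then show ?thesis unfolding H
        by (intro smooth_on_has_partial[OF smooth_on_partial[OF F jsn[OF that(2)]] i y0(1)])
    qed
    have D2: "((\<lambda>t. \<omega> c' (chart_inv c (y0(i := t))) ls) has_real_derivative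
        (\<Sum>l<n. chart_partial c' l (\<lambda>z. \<omega> c' z ls) x * jacobian c c' x l i)) (at (y0 i))" for ls
    proof -
      \<comment> \<open>The coordinate line of \<open>c\<close> through \<open>y0\<close>, seen in
        the chart \<open>c'\<close>, is the curve \<gamma>; along it the component is the coordinate
        expression \<open>f\<close> of that chart.\<close>
      define f where "f = (\<lambda>y. \<omega> c' (chart_inv c' y) ls)"
      define \<gamma> where "\<gamma> t = snd c' (chart_inv c (y0(i := t)))" for t
      have ev: "eventually (\<lambda>t. y0(i := t) \<in> ?V) (nhds (y0 i))" by (rule eventually_fun_upd_mem[OF V y0(1) i])
      have "((\<lambda>t. f (\<gamma> t)) has_real_derivative (\<Sum>l<n. partial l f (\<gamma> (y0 i)) * partial i (F l) y0)) (at (y0 i))"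
      proof (rule chain_rule_curve[OF openin_image[OF c(2)]])
        show "Ck_on n (snd c' ` fst c') 1 f"
          using form_smooth[OF \<omega> c(2)] unfolding smooth_in_chart_def smooth_on_def f_def by blast
        show "\<gamma> (y0 i) \<in> snd c' ` fst c'" using x y0 by (simp add: \<gamma>_def)
        show "eventually (\<lambda>t. \<gamma> t \<in> snd c' ` fst c') (nhds (y0 i))"
          using ev by (rule eventually_mono) (auto simp: \<gamma>_def c)
        show "((\<lambda>t. \<gamma> t l) has_real_derivative partial i (F l) y0) (at (y0 i))" if "l < n" for l
          using smooth_on_has_partial[OF F[OF that] i y0(1)] by (simp add: F_def \<gamma>_def)
      qed
      moreover have "\<gamma> (y0 i) = snd c' x" using y0 by (simp add: \<gamma>_def)
      ultimately have D: "((\<lambda>t. f (\<gamma> t)) has_real_derivative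
          (\<Sum>l<n. chart_partial c' l (\<lambda>z. \<omega> c' z ls) x * jacobian c c' x l i)) (at (y0 i))"
        by (simp add: chart_partial_def f_def Jx)
      have "eventually (\<lambda>t. f (\<gamma> t) = \<omega> c' (chart_inv c (y0(i := t))) ls) (nhds (y0 i))"
        using ev by (rule eventually_mono) (simp add: f_def \<gamma>_def transition_point(4)[OF c])
      then show ?thesis using D by (rule iffD1[OF DERIV_cong_ev[OF refl _ refl]])
    qed
    show "((\<lambda>t. G (y0(i := t))) has_real_derivative (\<Sum>ls\<in>?I. (\<Sum>b<p. H (ls ! b) (js ! b) i *
        (\<Prod>a\<in>{..<p} - {b}. jacobian c c' x (ls ! a) (js ! a))) * \<omega> c' x ls
      + (\<Sum>l<n. chart_partial c' l (\<lambda>z. \<omega> c' z ls) x * jacobian c c' x l i) * (\<Prod>a<p. jacobian c c' x (ls ! a) (js ! a))))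
      (at (y0 i))"
      unfolding G_def
    proof (rule DERIV_sum)
      fix ls assume ls: "ls \<in> ?I"
      have "((\<lambda>t. \<Prod>a<p. partial (js ! a) (F (ls ! a)) (y0(i := t))) has_real_derivative
          (\<Sum>b<p. H (ls ! b) (js ! b) i * (\<Prod>a\<in>{..<p} - {b}. partial (js ! a) (F (ls ! a)) (y0(i := y0 i))))) (at (y0 i))"
        using D1[OF ls] by (intro has_field_derivative_prod) auto
      then have P: "((\<lambda>t. \<Prod>a<p. partial (js ! a) (F (ls ! a)) (y0(i := t))) has_real_derivative
          (\<Sum>b<p. H (ls ! b) (js ! b) i * (\<Prod>a\<in>{..<p} - {b}. jacobian c c' x (ls ! a) (js ! a)))) (at (y0 i))"
        by (simp add: Jx)
      show "((\<lambda>t. (\<Prod>a<p. partial (js ! a) (F (ls ! a)) (y0(i := t))) * \<omega> c' (chart_inv c (y0(i := t))) ls)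
         has_real_derivative (\<Sum>b<p. H (ls ! b) (js ! b) i *
        (\<Prod>a\<in>{..<p} - {b}. jacobian c c' x (ls ! a) (js ! a))) * \<omega> c' x ls
      + (\<Sum>l<n. chart_partial c' l (\<lambda>z. \<omega> c' z ls) x * jacobian c c' x l i) * (\<Prod>a<p. jacobian c c' x (ls ! a) (js ! a)))
         (at (y0 i))"
        using DERIV_mult[OF P D2] by (simp add: y0(2) Jx)
    qed
  qed
  also have "\<dots> = (\<Sum>ls\<in>?I. (\<Sum>b<p. H (ls ! b) (js ! b) i *
        (\<Prod>a\<in>{..<p} - {b}. jacobian c c' x (ls ! a) (js ! a))) * \<omega> c' x ls)
      + (\<Sum>ls\<in>?I. \<Sum>l<n. jacobian c c' x l i * (\<Prod>a<p. jacobian c c' x (ls ! a) (js ! a)) * chart_partial c' l (\<lambda>z. \<omega> c' z ls) x)"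
    by (simp add: sum.distrib sum_distrib_left sum_distrib_right mult_ac)
  \<comment> \<open>The chain rule index l becomes the head of a list of length p + 1, and its
    Jacobian entry the factor for position 0.\<close>
  also have "(\<Sum>ls\<in>?I. \<Sum>l<n. jacobian c c' x l i * (\<Prod>a<p. jacobian c c' x (ls ! a) (js ! a)) * chart_partial c' l (\<lambda>z. \<omega> c' z ls) x)
      = (\<Sum>ls\<in>index_lists n (Suc p). (\<Prod>a<Suc p. jacobian c c' x (ls ! a) (ns ! a)) * derivative_tensor \<omega> c' x ls)"
    unfolding sum_index_lists_Suc nsi derivative_tensor_def prod.lessThan_Suc_shift
    by (subst sum.swap) (simp add: o_def)
  finally show ?thesis unfolding nsi by simp
qed

lemma ext_deriv_form:
  assumes \<omega>: "\<omega> \<in> forms M p"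
  shows "ext_deriv M \<omega> \<in> forms M (Suc p)"
proof (rule formsI)
  fix c x ns assume "\<not> (c \<in> atlas M \<and> x \<in> fst c \<and> ns \<in> index_lists n (Suc p))"
  \<comment> \<open>Deleting one entry of a list whose length is not p + 1 leaves a list whose
    length is not p, where \<omega> is zero.\<close>
  moreover have "ext_deriv M \<omega> c x ns = 0" if "length ns \<noteq> Suc p"
  proof -
    have "\<omega> c z (take k ns @ drop (Suc k) ns) = 0" if "k < length ns" for z k
    proof -
      have "take k ns @ drop (Suc k) ns \<notin> index_lists n p"
        using \<open>length ns \<noteq> Suc p\<close> that by (auto simp: index_lists_def)
      then show ?thesis using form_zero[OF \<omega>] by blast
    qed
    then show ?thesis by (simp add: ext_deriv_def)
  qed
  ultimately show "ext_deriv M \<omega> c x ns = 0" by (auto simp: ext_deriv_def index_lists_def)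
next
  fix c x assume c: "c \<in> atlas M" "x \<in> fst c"
  show "alternating n (Suc p) (ext_deriv M \<omega> c x)"
    unfolding alternating_def
  proof (intro ballI allI impI)
    fix ns \<sigma> assume ns: "ns \<in> index_lists n (Suc p)" and \<sigma>: "\<sigma> permutes {..<Suc p}"
    have len: "length ns = Suc p" using ns by (simp add: index_lists_def)
    show "ext_deriv M \<omega> c x (permute_list \<sigma> ns) = of_int (sign \<sigma>) * ext_deriv M \<omega> c x ns"
      using sum_permutations_compose_list[of \<sigma> ns "derivative_tensor \<omega> c x"] \<sigma>
      by (simp add: ext_deriv_antisymmetrization[OF \<omega> c] ns permute_list_index_lists[OF \<sigma> ns] len)
  qed
next
  fix c ns assume c: "c \<in> atlas M" and ns: "ns \<in> index_lists n (Suc p)"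
  let ?f = "\<lambda>k y. \<omega> c (chart_inv c y) (take k ns @ drop (Suc k) ns)"
  have "smooth_on n (snd c ` fst c) (\<lambda>y. \<Sum>k<length ns. (- 1) ^ k * partial (ns ! k) (?f k) y)"
  proof (rule smooth_on_sum_scale[OF openin_image[OF c]])
    fix k assume "k \<in> {..<length ns}"
    then have "ns ! k < n" using ns index_lists_nth[OF ns] by (simp add: index_lists_def)
    then show "smooth_on n (snd c ` fst c) (partial (ns ! k) (?f k))"
      using form_smooth[OF \<omega> c] unfolding smooth_in_chart_def by (intro smooth_on_partial)
  qed
  then show "smooth_in_chart n c (\<lambda>x. ext_deriv M \<omega> c x ns)"
    unfolding smooth_in_chart_def
    by (rule smooth_on_cong[OF openin_image[OF c], rotated])
      (use c ns in \<open>auto simp: ext_deriv_def chart_partial_def index_lists_def\<close>)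
next
  fix c c' x ns assume c: "c \<in> atlas M" "c' \<in> atlas M" and x: "x \<in> fst c" "x \<in> fst c'"
    and ns: "ns \<in> index_lists n (Suc p)"
  let ?P = "{\<sigma>. \<sigma> permutes {..<Suc p}}" and ?I = "index_lists n (Suc p)"
  let ?J = "jacobian c c' x" and ?T = "derivative_tensor \<omega> c' x"
  define H where "H k j i = partial i (partial j (\<lambda>y. snd c' (chart_inv c y) k)) (snd c x)" for k j i
  have sym: "H k i j = H k j i" if "k < n" "i < n" "j < n" for k i j
  proof -
    have "Ck_on n (snd c ` (fst c \<inter> fst c')) 2 (\<lambda>y. snd c' (chart_inv c y) k)"
      using smooth_transition[OF c that(1)] unfolding smooth_on_def by blast
    then show ?thesis unfolding H_def
      using that x by (intro partial_commute[OF openin_overlap[OF c]]) auto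
  qed
  \<comment> \<open>The cancellation lemma asks for symmetry at every k, but the transition map is
    known to be smooth only in its components below n; the others are replaced by zero.\<close>
  define K where "K k = (if k < n then H k else (\<lambda>_ _. 0))" for k
  have symK: "K k i j = K k j i" if "i < n" "j < n" for k i j
    using sym that by (simp add: K_def)
  have len: "length ns = Suc p" using ns by (simp add: index_lists_def)
  have tr: "derivative_tensor \<omega> c x ms =
     (\<Sum>ls\<in>index_lists n p. (\<Sum>b<p. K (ls ! b) (ms ! Suc b) (ms ! 0) *
        (\<Prod>a\<in>{..<p} - {b}. ?J (ls ! a) (ms ! Suc a))) * \<omega> c' x ls)
     + (\<Sum>ls\<in>?I. (\<Prod>a<Suc p. ?J (ls ! a) (ms ! a)) * ?T ls)" if "ms \<in> ?I" for ms
  proof -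
    have "K (ls ! b) = H (ls ! b)" if "ls \<in> index_lists n p" "b < p" for ls b
      using index_lists_nth[OF that] by (simp add: K_def)
    then show ?thesis
      using derivative_tensor_transform[OF \<omega> c x that] by (simp add: H_def[abs_def])
  qed
  have "(\<Sum>\<sigma>\<in>?P. of_int (sign \<sigma>) * derivative_tensor \<omega> c x (permute_list \<sigma> ns))
     = (\<Sum>\<sigma>\<in>?P. of_int (sign \<sigma>) * (\<Sum>ls\<in>index_lists n p. (\<Sum>b<p. K (ls ! b) (permute_list \<sigma> ns ! Suc b) (permute_list \<sigma> ns ! 0) *
        (\<Prod>a\<in>{..<p} - {b}. ?J (ls ! a) (permute_list \<sigma> ns ! Suc a))) * \<omega> c' x ls))
     + (\<Sum>\<sigma>\<in>?P. of_int (sign \<sigma>) * (\<Sum>ls\<in>?I. (\<Prod>a<Suc p. ?J (ls ! a) (permute_list \<sigma> ns ! a)) * ?T ls))"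
    unfolding sum.distrib[symmetric] distrib_left[symmetric]
    using tr permute_list_index_lists[OF _ ns] by (intro sum.cong refl) (simp del: prod.lessThan_Suc)
  \<comment> \<open>Antisymmetrization removes the second derivatives, and with them the obstruction
    to a tensor law.\<close>
  also have "\<dots> = (\<Sum>\<sigma>\<in>?P. of_int (sign \<sigma>) * (\<Sum>ls\<in>?I. (\<Prod>a<Suc p. ?J (ls ! a) (permute_list \<sigma> ns ! a)) * ?T ls))"
    using sum_permutations_symmetric_cancel[OF ns symK, where J = ?J and W = "\<omega> c' x"] by simp
  also have "\<dots> = (\<Sum>ls\<in>?I. (\<Prod>a<Suc p. ?J (ls ! a) (ns ! a)) * (\<Sum>\<sigma>\<in>?P. of_int (sign \<sigma>) * ?T (permute_list \<sigma> ls)))"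
    by (rule sum_index_lists_transform[OF len])
  finally have "ext_deriv M \<omega> c x ns
     = (\<Sum>ls\<in>?I. (\<Prod>a<Suc p. ?J (ls ! a) (ns ! a)) * (\<Sum>\<sigma>\<in>?P. of_int (sign \<sigma>) * ?T (permute_list \<sigma> ls))) / fact p"
    by (simp only: ext_deriv_antisymmetrization[OF \<omega> c(1) x(1) ns])
  also have "\<dots> = (\<Sum>ls\<in>?I. (\<Prod>a<Suc p. ?J (ls ! a) (ns ! a)) * ext_deriv M \<omega> c' x ls)"
    unfolding sum_divide_distrib[of _ ?I]
    by (intro sum.cong refl) (simp only: ext_deriv_antisymmetrization[OF \<omega> c(2) x(2)] times_divide_eq_right)
  finally show "ext_deriv M \<omega> c x ns = (\<Sum>ls\<in>?I. (\<Prod>a<Suc p. ?J (ls ! a) (ns ! a)) * ext_deriv M \<omega> c' x ls)" .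
qed

end

section \<open>Integration and partitions of unity\<close>

lemma sets_lborel_Rn [simp, measurable_cong]: "sets (lborel_Rn n) = sets borel"
  and space_lborel_Rn [simp]: "space (lborel_Rn n) = UNIV"
  by (simp_all add: lborel_Rn_def)

lemma measurable_extend_zero:
  "(\<lambda>y i. if i < n then y i else 0) \<in> measurable (Pi\<^sub>M {..<n} (\<lambda>_. lborel)) (borel :: (nat \<Rightarrow> real) measure)"
proof -
  have "(\<lambda>y i. if i < n then y i else 0) \<in> measurable (Pi\<^sub>M {..<n} (\<lambda>_. lborel :: real measure)) (Pi\<^sub>M UNIV (\<lambda>_. borel))"
  proof (rule measurable_PiM_single')
    fix i :: nat
    show "(\<lambda>y. if i < n then y i else 0) \<in> measurable (Pi\<^sub>M {..<n} (\<lambda>_. lborel :: real measure)) borel"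
    proof (cases "i < n")
      case True
      then have "(\<lambda>y. y i) \<in> measurable (Pi\<^sub>M {..<n} (\<lambda>_. lborel :: real measure)) lborel"
        by (intro measurable_component_singleton) simp
      then show ?thesis using True by simp
    qed simp
  qed simp
  then show ?thesis
    using measurable_cong_sets[OF refl sets_PiM_equal_borel] by blast
qed

lemma emeasure_lborel_Rn:
  "A \<in> sets borel \<Longrightarrow> emeasure (lborel_Rn n) A =
    emeasure (Pi\<^sub>M {..<n} (\<lambda>_. lborel)) ((\<lambda>y i. if i < n then y i else 0) -` A \<inter> space (Pi\<^sub>M {..<n} (\<lambda>_. lborel)))"
  unfolding lborel_Rn_def by (rule emeasure_distr[OF measurable_extend_zero])

lemma emeasure_PiM_lborel_PiE:
  fixes n :: nat
  assumes "\<And>i. i < n \<Longrightarrow> A i \<in> sets borel"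
  shows "emeasure (Pi\<^sub>M {..<n} (\<lambda>_. lborel :: real measure)) (Pi\<^sub>E {..<n} A) = (\<Prod>i<n. emeasure lborel (A i))"
proof -
  interpret product_sigma_finite "\<lambda>_ :: nat. lborel :: real measure" ..
  show ?thesis by (rule emeasure_PiM) (use assms in simp_all)
qed

text \<open>Coordinates are continuous, so a compact set has bounded projections and sits in a box
  of finite volume.\<close>

lemma emeasure_lborel_Rn_compact:
  fixes K :: "(nat \<Rightarrow> real) set"
  assumes "compact K"
  shows "emeasure (lborel_Rn n) K < \<infinity>"
proof -
  have Kb: "K \<in> sets borel" by (rule borel_closed[OF compact_imp_closed[OF assms]])
  have "\<exists>b. \<forall>y\<in>K. \<bar>y i\<bar> \<le> b" for i
  proof -
    have "compact ((\<lambda>y. y i) ` K)"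
      by (intro compact_continuous_image assms continuous_on_product_coordinates continuous_on_subset[OF _ subset_UNIV])
    then have "bounded ((\<lambda>y. y i) ` K)" by (rule compact_imp_bounded)
    then show ?thesis unfolding bounded_real by simp
  qed
  then obtain b where b: "\<And>i y. y \<in> K \<Longrightarrow> \<bar>y i\<bar> \<le> b i" by metis
  let ?B = "Pi\<^sub>E {..<n} (\<lambda>i. {- b i..b i})"
  have "emeasure (lborel_Rn n) K \<le> emeasure (Pi\<^sub>M {..<n} (\<lambda>_. lborel :: real measure)) ?B"
    unfolding emeasure_lborel_Rn[OF Kb]
  proof (rule emeasure_mono)
    show "?B \<in> sets (Pi\<^sub>M {..<n} (\<lambda>_. lborel :: real measure))" by (intro sets_PiM_I_finite) auto
    show "(\<lambda>y i. if i < n then y i else 0) -` K \<inter> space (Pi\<^sub>M {..<n} (\<lambda>_. lborel)) \<subseteq> ?B"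
    proof
      fix y :: "nat \<Rightarrow> real"
      assume y: "y \<in> (\<lambda>y i. if i < n then y i else 0) -` K \<inter> space (Pi\<^sub>M {..<n} (\<lambda>_. lborel))"
      have "\<bar>y i\<bar> \<le> b i" if "i < n" for i
        using b[of "\<lambda>i. if i < n then y i else 0" i] y that by simp
      then have "y i \<in> {- b i..b i}" if "i < n" for i
        using that unfolding atLeastAtMost_iff by (metis abs_le_iff minus_le_iff)
      then show "y \<in> ?B" using y by (simp add: space_PiM PiE_iff)
    qed
  qed
  also have "\<dots> = (\<Prod>i<n. emeasure lborel {- b i..b i})"
    by (rule emeasure_PiM_lborel_PiE) simp
  also have "\<dots> < \<infinity>"
    by (simp add: emeasure_lborel_Icc_eq prod_ennreal)
  finally show ?thesis .
qed

text \<open>The box has volume \<open>(2 * d) ^ n\<close>, which is positive also for n = 0, where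
  the measure is a point mass. The Borel superset is, in the application, a null set that would have
  to contain a cube.\<close>

lemma emeasure_lborel_Rn_cube:
  assumes "A \<in> sets borel" "cube n y d \<subseteq> A" "d > 0"
  shows "emeasure (lborel_Rn n) A > 0"
proof -
  let ?B = "Pi\<^sub>E {..<n} (\<lambda>i. {y i - d<..<y i + d})"
  have "(\<Prod>i<n. emeasure lborel {y i - d<..<y i + d}) = ennreal (2 * d) ^ n"
    using assms(3) by (simp add: emeasure_lborel_Ioo)
  then have "0 < (\<Prod>i<n. emeasure lborel {y i - d<..<y i + d})"
    using assms(3) by (simp add: ennreal_power)
  also have "\<dots> = emeasure (Pi\<^sub>M {..<n} (\<lambda>_. lborel :: real measure)) ?B"
    by (rule emeasure_PiM_lborel_PiE[symmetric]) simp
  also have "\<dots> \<le> emeasure (lborel_Rn n) A"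
    unfolding emeasure_lborel_Rn[OF assms(1)]
  proof (rule emeasure_mono)
    show "(\<lambda>y i. if i < n then y i else 0) -` A \<inter> space (Pi\<^sub>M {..<n} (\<lambda>_. lborel)) \<in> sets (Pi\<^sub>M {..<n} (\<lambda>_. lborel :: real measure))"
      using measurable_sets[OF measurable_extend_zero assms(1)] .
    show "?B \<subseteq> (\<lambda>y i. if i < n then y i else 0) -` A \<inter> space (Pi\<^sub>M {..<n} (\<lambda>_. lborel))"
    proof
      fix z assume z: "z \<in> ?B"
      have "\<bar>z i - y i\<bar> < d" if "i < n" for i
        using PiE_mem[OF z, of i] that by (simp add: abs_less_iff)
      then have "(\<lambda>i. if i < n then z i else 0) \<in> cube n y d" by (simp add: cube_def)
      then show "z \<in> (\<lambda>y i. if i < n then y i else 0) -` A \<inter> space (Pi\<^sub>M {..<n} (\<lambda>_. lborel))"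
        using subsetD[OF assms(2)] z by (simp add: space_PiM PiE_iff)
    qed
  qed
  finally show ?thesis .
qed

text \<open>Restricting to K instead of U does not change the integrand, and on K it is bounded on a
  set of finite measure.\<close>

lemma set_integrable_compact_support:
  fixes g :: "(nat \<Rightarrow> real) \<Rightarrow> real"
  assumes "compact K" "K \<subseteq> U" "continuous_on K g" "\<And>y. y \<in> U - K \<Longrightarrow> g y = 0"
  shows "set_integrable (lborel_Rn n) U g"
proof -
  have K: "K \<in> sets borel" by (rule borel_closed[OF compact_imp_closed[OF assms(1)]])
  obtain B where B: "\<And>y. y \<in> K \<Longrightarrow> norm (g y) \<le> B"
    using compact_imp_bounded[OF compact_continuous_image[OF assms(3,1)]] unfolding bounded_iff by blast
  have "(\<lambda>y. indicator K y *\<^sub>R g y) \<in> borel_measurable (lborel_Rn n)"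
    using borel_measurable_continuous_on_indicator[OF K assms(3)]
    by (simp add: measurable_cong_sets[OF sets_lborel_Rn refl])
  then have "integrable (lborel_Rn n) (\<lambda>y. indicator K y *\<^sub>R g y)"
    using K emeasure_lborel_Rn_compact[OF assms(1)] B
    by (intro integrableI_bounded_set[where A = K and B = B]) (auto simp: indicator_def)
  moreover have "(\<lambda>y. indicator K y *\<^sub>R g y) = (\<lambda>y. indicator U y *\<^sub>R g y)"
    using assms(2,4) by (force simp: indicator_def)
  ultimately show ?thesis unfolding set_integrable_def by metis
qed

text \<open>A positive value would persist on a cube by continuity, and a cube is too large for a
  null set.\<close>

lemma set_integral_eq_0_imp:
  fixes g :: "(nat \<Rightarrow> real) \<Rightarrow> real"
  assumes U: "openin (Euclidean_space n) U" and g: "continuous_on U g" "\<And>y. y \<in> U \<Longrightarrow> g y \<ge> 0"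
    and int: "set_integrable (lborel_Rn n) U g" and 0: "set_lebesgue_integral (lborel_Rn n) U g = 0" and y: "y \<in> U"
  shows "g y = 0"
proof (rule ccontr)
  assume "g y \<noteq> 0"
  then have gy: "g y > 0" using g(2)[OF y] by simp
  obtain d where d: "d > 0" "cube n y d \<subseteq> U" "\<And>z. z \<in> cube n y d \<Longrightarrow> \<bar>g z - g y\<bar> < g y"
    using continuous_on_cube[OF U g(1) y gy] by auto
  have "AE z in lborel_Rn n. 0 \<le> indicator U z *\<^sub>R g z" using g(2) by (simp add: indicator_def)
  then have "AE z in lborel_Rn n. indicator U z *\<^sub>R g z = 0"
    using 0 int integral_nonneg_eq_0_iff_AE unfolding set_lebesgue_integral_def set_integrable_def by blast
  then obtain N where N: "{z \<in> space (lborel_Rn n). \<not> indicator U z *\<^sub>R g z = 0} \<subseteq> N"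
      "emeasure (lborel_Rn n) N = 0" "N \<in> sets (lborel_Rn n)"
    by (rule AE_E)
  have "cube n y d \<subseteq> N"
  proof
    fix z assume z: "z \<in> cube n y d"
    then have "g z > 0" "z \<in> U" using d(2) d(3)[OF z] by auto
    then show "z \<in> N" using N(1) by auto
  qed
  then show False using emeasure_lborel_Rn_cube[of N n y d] N(2,3) d(1) by simp
qed

text \<open>Regularity separates x from the complement of W by P and Q, and complete regularity
  gives an f with value 0 at x and 1 off P. The support of 1 - f avoids the open Q, hence so does
  its closure.\<close>

lemma compact_Hausdorff_bump:
  assumes "compact_space X" "Hausdorff_space X" "openin X W" "x \<in> W"
  shows "\<exists>f. continuous_map X euclideanreal f \<and> (\<forall>z\<in>topspace X. f z \<ge> 0) \<and> f x > 0 \<and>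
    X closure_of {z \<in> topspace X. f z \<noteq> 0} \<subseteq> W"
proof -
  have reg: "regular_space X" using assms compact_Hausdorff_imp_regular_space by blast
  have cr: "completely_regular_space X"
    using assms compact_Hausdorff_or_regular_imp_normal_space normal_imp_completely_regular_space
    by blast
  have x: "x \<in> topspace X" using assms openin_subset by blast
  obtain P Q where PQ: "openin X P" "openin X Q" "x \<in> P" "topspace X - W \<subseteq> Q" "disjnt P Q"
    using reg assms x unfolding regular_space_def
    by (metis DiffE DiffI closedin_diff closedin_topspace)
  obtain f :: "'a \<Rightarrow> real" where f: "continuous_map X (top_of_set {0..1}) f" "f x = 0" "f ` (topspace X - P) \<subseteq> {1}"
    using cr PQ x unfolding completely_regular_space_def
    by (metis DiffD2 DiffI closedin_diff closedin_topspace)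
  have fc: "continuous_map X euclideanreal f" "\<And>z. z \<in> topspace X \<Longrightarrow> f z \<in> {0..1}"
    using f(1) by (auto simp: continuous_map_in_subtopology)
  have "{z \<in> topspace X. 1 - f z \<noteq> 0} \<subseteq> topspace X - Q" using f(3) PQ(5) by (auto simp: disjnt_iff)
  then have "X closure_of {z \<in> topspace X. 1 - f z \<noteq> 0} \<subseteq> topspace X - Q"
    using PQ(2) by (intro closure_of_minimal closedin_diff) auto
  then have "X closure_of {z \<in> topspace X. 1 - f z \<noteq> 0} \<subseteq> W" using PQ(4) by blast
  moreover have "continuous_map X euclideanreal (\<lambda>z. 1 - f z)" using fc(1) by (intro continuous_intros)
  moreover have "\<forall>z\<in>topspace X. 1 - f z \<ge> 0" using fc(2) by auto
  ultimately show ?thesis using f(2) by (intro exI[of _ "\<lambda>z. 1 - f z"]) simp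
qed

text \<open>Compactness leaves finitely many bumps whose positivity sets cover the space; they are
  divided by their sum.\<close>

lemma (in oriented_manifold) partition_of_unity_exists:
  assumes "compact_space (points M)"
  shows "\<exists>F \<rho>. partition_of_unity M F \<rho>"
proof -
  let ?X = "points M"
  have haus: "Hausdorff_space ?X" and cover: "topspace ?X = (\<Union>c\<in>atlas M. fst c)"
    using oriented_smooth by (auto simp: oriented_smooth_manifold_def)
  have "\<forall>x\<in>topspace ?X. \<exists>c f. c \<in> atlas M \<and> x \<in> fst c \<and> continuous_map ?X euclideanreal f \<and> (\<forall>z\<in>topspace ?X. f z \<ge> 0) \<and> f x > 0 \<and>
    ?X closure_of {z \<in> topspace ?X. f z \<noteq> 0} \<subseteq> fst c"
  proof
    fix x assume "x \<in> topspace ?X"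
    then obtain c where c: "c \<in> atlas M" "x \<in> fst c" using cover by blast
    then show "\<exists>c f. c \<in> atlas M \<and> x \<in> fst c \<and> continuous_map ?X euclideanreal f \<and> (\<forall>z\<in>topspace ?X. f z \<ge> 0) \<and> f x > 0 \<and>
      ?X closure_of {z \<in> topspace ?X. f z \<noteq> 0} \<subseteq> fst c"
      using compact_Hausdorff_bump[OF assms haus openin_fst[OF c(1)] c(2)] by blast
  qed
  then have "\<exists>ch. \<forall>x\<in>topspace ?X. \<exists>f. ch x \<in> atlas M \<and> x \<in> fst (ch x) \<and> continuous_map ?X euclideanreal f \<and>
    (\<forall>z\<in>topspace ?X. f z \<ge> 0) \<and> f x > 0 \<and> ?X closure_of {z \<in> topspace ?X. f z \<noteq> 0} \<subseteq> fst (ch x)"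
    by (rule bchoice)
  then obtain ch where "\<forall>x\<in>topspace ?X. \<exists>f. ch x \<in> atlas M \<and> x \<in> fst (ch x) \<and> continuous_map ?X euclideanreal f \<and>
    (\<forall>z\<in>topspace ?X. f z \<ge> 0) \<and> f x > 0 \<and> ?X closure_of {z \<in> topspace ?X. f z \<noteq> 0} \<subseteq> fst (ch x)" ..
  then have "\<exists>f. \<forall>x\<in>topspace ?X. ch x \<in> atlas M \<and> x \<in> fst (ch x) \<and> continuous_map ?X euclideanreal (f x) \<and>
    (\<forall>z\<in>topspace ?X. f x z \<ge> 0) \<and> f x x > 0 \<and> ?X closure_of {z \<in> topspace ?X. f x z \<noteq> 0} \<subseteq> fst (ch x)"
    by (rule bchoice)
  then obtain f where chf: "\<forall>x\<in>topspace ?X. ch x \<in> atlas M \<and> x \<in> fst (ch x) \<and> continuous_map ?X euclideanreal (f x) \<and>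
    (\<forall>z\<in>topspace ?X. f x z \<ge> 0) \<and> f x x > 0 \<and> ?X closure_of {z \<in> topspace ?X. f x z \<noteq> 0} \<subseteq> fst (ch x)" ..
  have ch: "ch x \<in> atlas M" if "x \<in> topspace ?X" for x using chf that by simp
  have f: "continuous_map ?X euclideanreal (f x)" "f x x > 0"
      "\<And>z. z \<in> topspace ?X \<Longrightarrow> f x z \<ge> 0" "?X closure_of {z \<in> topspace ?X. f x z \<noteq> 0} \<subseteq> fst (ch x)"
    if "x \<in> topspace ?X" for x using chf that by simp_all
  let ?P = "\<lambda>x. {z \<in> topspace ?X. f x z \<in> {0<..}}"
  have 1: "\<forall>U\<in>?P ` topspace ?X. openin ?X U"
  proof
    fix U assume "U \<in> ?P ` topspace ?X"
    then obtain x where "x \<in> topspace ?X" "U = ?P x" by blast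
    then show "openin ?X U" using openin_continuous_map_preimage[OF f(1), of x "{0<..}"] by simp
  qed
  have 2: "topspace ?X \<subseteq> \<Union>(?P ` topspace ?X)" using f(2) by fastforce
  obtain \<F> where \<F>: "finite \<F>" "\<F> \<subseteq> ?P ` topspace ?X" "topspace ?X \<subseteq> \<Union>\<F>"
    using assms[unfolded compact_space_alt, THEN spec, THEN mp, OF conjI[OF 1 2]] by blast
  obtain T where T: "T \<subseteq> topspace ?X" "finite T" "\<F> = ?P ` T"
    using finite_subset_image[OF \<F>(1,2)] by blast
  have fT: "0 \<le> f x z" if "x \<in> T" "z \<in> topspace ?X" for x z using f(3) that T(1) by blast
  define s where "s z = (\<Sum>x\<in>T. f x z)" for z
  have s: "s z > 0" if z: "z \<in> topspace ?X" for z
  proof -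
    obtain x where x: "x \<in> T" "f x z > 0" using \<F>(3) T(3) z by auto
    have "f x z \<le> s z" unfolding s_def using fT T(2) z x(1) by (intro member_le_sum) auto
    then show ?thesis using x by simp
  qed
  have sc: "continuous_map ?X euclideanreal s" unfolding s_def
    using f(1) T by (intro continuous_map_sum) auto
  \<comment> \<open>Several selected points may share a chart. Since the partition is indexed by
    charts, their bumps are added.\<close>
  define \<rho> where "\<rho> c z = (\<Sum>x | x \<in> T \<and> ch x = c. f x z) / s z" for c z
  have "partition_of_unity M (ch ` T) \<rho>"
    unfolding partition_of_unity_def
  proof (intro conjI ballI)
    show "finite (ch ` T)" "ch ` T \<subseteq> atlas M" using T ch by auto
    fix c assume c: "c \<in> ch ` T"
    show "continuous_map ?X euclideanreal (\<rho> c)"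
      unfolding \<rho>_def using s f(1) T
      by (intro continuous_map_real_divide continuous_map_sum sc) (auto simp: less_le)
    show "0 \<le> \<rho> c x" if "x \<in> topspace ?X" for x
      unfolding \<rho>_def using s[OF that] fT that by (intro divide_nonneg_pos sum_nonneg) auto
    let ?C = "\<Union>x\<in>{x \<in> T. ch x = c}. ?X closure_of {z \<in> topspace ?X. f x z \<noteq> 0}"
    have "?X closure_of {x \<in> topspace ?X. \<rho> c x \<noteq> 0} \<subseteq> ?C"
    proof (rule closure_of_minimal)
      show "{x \<in> topspace ?X. \<rho> c x \<noteq> 0} \<subseteq> ?C"
      proof
        fix z assume z: "z \<in> {x \<in> topspace ?X. \<rho> c x \<noteq> 0}"
        then have "(\<Sum>x | x \<in> T \<and> ch x = c. f x z) \<noteq> 0" by (auto simp: \<rho>_def)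
        then obtain x where "x \<in> T" "ch x = c" "f x z \<noteq> 0" by (auto elim: sum.not_neutral_contains_not_neutral)
        moreover have "{z \<in> topspace ?X. f x z \<noteq> 0} \<subseteq> ?X closure_of {z \<in> topspace ?X. f x z \<noteq> 0}"
          by (rule closure_of_subset) auto
        ultimately show "z \<in> ?C" using z by blast
      qed
      show "closedin ?X ?C" using T(2) by (intro closedin_Union) auto
    qed
    also have "?C \<subseteq> fst c" using f(4) T(1) by blast
    finally show "?X closure_of {x \<in> topspace ?X. \<rho> c x \<noteq> 0} \<subseteq> fst c" .
  next
    fix z assume z: "z \<in> topspace ?X"
    have "(\<Sum>c\<in>ch ` T. \<Sum>x | x \<in> T \<and> ch x = c. f x z) = s z"
      unfolding s_def using T(2) by (intro sum.group) auto
    then show "(\<Sum>c\<in>ch ` T. \<rho> c z) = 1"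
      using s[OF z] by (simp add: \<rho>_def sum_divide_distrib[symmetric])
  qed
  then show ?thesis by blast
qed

context oriented_manifold begin

text \<open>The support is closed in a compact space and lies in the chart domain, so the chart
  carries it to a compact set. This is what makes the chart integrals finite.\<close>

lemma partition_support:
  assumes P: "partition_of_unity M F \<rho>" and c: "c \<in> F" and K: "compact_space (points M)"
  defines "S \<equiv> snd c ` (points M closure_of {x \<in> topspace (points M). \<rho> c x \<noteq> 0})"
  shows "compact S" "S \<subseteq> snd c ` fst c" "\<And>y. y \<in> snd c ` fst c - S \<Longrightarrow> \<rho> c (chart_inv c y) = 0"
    "continuous_on (snd c ` fst c) (\<lambda>y. \<rho> c (chart_inv c y))"
proof -
  let ?C = "points M closure_of {x \<in> topspace (points M). \<rho> c x \<noteq> 0}"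
  have at: "c \<in> atlas M" and C: "?C \<subseteq> fst c" and cont: "continuous_map (points M) euclideanreal (\<rho> c)"
    using P c by (auto simp: partition_of_unity_def)
  have E: "Euclidean_space n = top_of_set {x. \<forall>i\<ge>n. x i = 0}"
    by (simp add: Euclidean_space_def euclidean_product_topology)
  have "compactin (points M) ?C" by (rule closedin_compact_space[OF K closedin_closure_of])
  then have "compactin (subtopology (points M) (fst c)) ?C" using C by (simp add: compactin_subtopology)
  then have "compactin (subtopology (Euclidean_space n) (snd c ` fst c)) S"
    unfolding S_def
    by (rule image_compactin[OF _ homeomorphic_imp_continuous_map[OF homeomorphic_chart[OF at]]])
  then show "compact S" unfolding E by (simp add: compactin_subtopology)
  show "S \<subseteq> snd c ` fst c" using C by (auto simp: S_def)
  show "\<rho> c (chart_inv c y) = 0" if y: "y \<in> snd c ` fst c - S" for y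
  proof (rule ccontr)
    assume ne: "\<rho> c (chart_inv c y) \<noteq> 0"
    obtain x where x: "x \<in> fst c" "y = snd c x" using y by blast
    have "x \<in> {x \<in> topspace (points M). \<rho> c x \<noteq> 0}"
      using ne x at fst_subset[OF at] by auto
    then have "x \<in> ?C" using closure_of_subset[of "{x \<in> topspace (points M). \<rho> c x \<noteq> 0}" "points M"] by blast
    then show False using y x by (auto simp: S_def)
  qed
  have "continuous_map (subtopology (Euclidean_space n) (snd c ` fst c)) euclideanreal (\<rho> c \<circ> chart_inv c)"
    by (rule continuous_map_compose[OF continuous_chart_inv[OF at] continuous_map_from_subtopology[OF cont]])
  then have "continuous_map (top_of_set (snd c ` fst c)) euclideanreal (\<rho> c \<circ> chart_inv c)"
    using openin_subset[OF openin_image[OF at]] unfolding E by (simp add: subtopology_subtopology Int_absorb1)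
  then show "continuous_on (snd c ` fst c) (\<lambda>y. \<rho> c (chart_inv c y))" by (simp add: o_def)
qed

end

section \<open>The inner product of forms\<close>

locale compact_riemannian = oriented_manifold M for M :: "'a riem" +
  assumes riemannian: "riemannian_metric M" and compact: "compact_space (points M)"
begin

lemma positive_definite_metric: "c \<in> atlas M \<Longrightarrow> x \<in> fst c \<Longrightarrow> positive_definite n (metric M c x)"
  using riemannian unfolding riemannian_metric_def positive_definite_def by blast

lemma inverse_metric_eq: "inverse_metric M c x = inverse_entries n (metric M c x)"
  by (simp add: inverse_metric_def inverse_entries_def fun_eq_iff)

lemma continuous_form:
  "\<omega> \<in> forms M p \<Longrightarrow> c \<in> atlas M \<Longrightarrow> continuous_on (snd c ` fst c) (\<lambda>y. \<omega> c (chart_inv c y) ns)"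
  using form_smooth smooth_on_imp_continuous_on unfolding smooth_in_chart_def by blast

lemma continuous_metric:
  assumes "c \<in> atlas M" "i < n" "j < n"
  shows "continuous_on (snd c ` fst c) (\<lambda>y. metric M c (chart_inv c y) i j)"
proof -
  have "smooth_in_chart n c (\<lambda>x. metric M c x i j)"
    using riemannian assms unfolding riemannian_metric_def by blast
  then show ?thesis unfolding smooth_in_chart_def by (rule smooth_on_imp_continuous_on)
qed

lemma det_metric_pos:
  "c \<in> atlas M \<Longrightarrow> x \<in> fst c \<Longrightarrow> Determinant.det (square_mat n (metric M c x)) > 0"
  by (rule positive_definite_det_pos[OF positive_definite_metric])

lemma continuous_hodge_star:
  assumes "\<beta> \<in> forms M p" "c \<in> atlas M"
  shows "continuous_on (snd c ` fst c) (\<lambda>y. hodge_star M p \<beta> c (chart_inv c y) js)"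
  unfolding hodge_star_def raise_indices_def inverse_metric_eq
proof (intro continuous_on_mult continuous_on_divide continuous_on_const continuous_on_real_sqrt
    continuous_on_sum continuous_on_prod continuous_form[OF assms] continuous_on_det_square_mat)
  show "continuous_on (snd c ` fst c) (\<lambda>y. metric M c (chart_inv c y) i j)" if "i < n" "j < n" for i j
    using continuous_metric[OF assms(2) that] .
  fix ns ks a assume *: "ns \<in> index_lists n p" "ks \<in> index_lists n p" "a \<in> {..<p}"
  show "continuous_on (snd c ` fst c) (\<lambda>y. inverse_entries n (metric M c (chart_inv c y)) (ns ! a) (ks ! a))"
  proof (rule continuous_on_inverse_entries[OF continuous_metric[OF assms(2)]])
    show "Determinant.det (square_mat n (metric M c (chart_inv c y))) \<noteq> 0" if "y \<in> snd c ` fst c" for y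
    proof -
      obtain x where "x \<in> fst c" "y = snd c x" using \<open>y \<in> snd c ` fst c\<close> by blast
      then show ?thesis using det_metric_pos[OF assms(2), of x] assms(2) by simp
    qed
    show "ns ! a < n" "ks ! a < n" using * index_lists_nth by auto
  qed
qed simp

text \<open>The coefficient of \<open>\<alpha> \<and> *\<beta>\<close> with respect to the
  coordinates of the chart: the integrand of \<open>form_inner\<close> without the partition
  function.\<close>

definition inner_density :: "nat \<Rightarrow> 'a form \<Rightarrow> 'a form \<Rightarrow> 'a chart \<Rightarrow> 'a \<Rightarrow> real" where
  "inner_density p \<alpha> \<beta> c x = wedge p (n - p) \<alpha> (hodge_star M p \<beta>) c x [0..<n]"

lemma continuous_inner_density:
  assumes "\<alpha> \<in> forms M p" "\<beta> \<in> forms M p" "c \<in> atlas M"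
  shows "continuous_on (snd c ` fst c) (\<lambda>y. inner_density p \<alpha> \<beta> c (chart_inv c y))"
\<comment> \<open>For p > n truncated subtraction makes \<open>p + (n - p)\<close> differ from n,
  and the wedge takes its default value 0. Degree n + 1 does occur, as the derivative of
  n-forms.\<close>
proof (cases "length [0..<n] = p + (n - p)")
  case True
  then show ?thesis
    unfolding inner_density_def wedge_def if_P[OF True]
    by (intro continuous_on_divide continuous_on_sum continuous_on_mult continuous_on_const
        continuous_form[OF assms(1,3)] continuous_hodge_star[OF assms(2,3)]) simp
next
  case False
  then show ?thesis unfolding inner_density_def wedge_def if_not_P[OF False] by simp
qed

lemma raise_indices_add_scale:
  "raise_indices M p (\<beta> + form_scale r \<gamma>) = raise_indices M p \<beta> + form_scale r (raise_indices M p \<gamma>)"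
  by (simp add: raise_indices_def form_scale_def fun_eq_iff distrib_left sum.distrib sum_distrib_left mult.left_commute)

lemma hodge_star_add_scale:
  "hodge_star M p (\<beta> + form_scale r \<gamma>) = hodge_star M p \<beta> + form_scale r (hodge_star M p \<gamma>)"
  unfolding hodge_star_def raise_indices_add_scale
  by (simp add: form_scale_def fun_eq_iff distrib_left sum.distrib sum_distrib_left mult.left_commute)

lemma inner_density_add_scale_right:
  "inner_density p \<alpha> (\<beta> + form_scale r \<gamma>) c x = inner_density p \<alpha> \<beta> c x + r * inner_density p \<alpha> \<gamma> c x"
  unfolding inner_density_def hodge_star_add_scale
  by (simp add: wedge_def form_scale_def distrib_left sum.distrib sum_distrib_left mult.left_commute add_divide_distrib)

lemma inner_density_add_scale_left:
  "inner_density p (\<alpha> + form_scale r \<gamma>) \<beta> c x = inner_density p \<alpha> \<beta> c x + r * inner_density p \<gamma> \<beta> c x"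
  unfolding inner_density_def
  by (simp add: wedge_def form_scale_def distrib_left distrib_right sum.distrib sum_distrib_left mult_ac add_divide_distrib)

text \<open>A permutation of the free indices can be matched by the same permutation of the summed
  ones, which leaves the product of inverse metric entries alone and moves the sign to
  \<beta>.\<close>

lemma alternating_raise_indices:
  assumes \<beta>: "\<beta> \<in> forms M p" "c \<in> atlas M" "x \<in> fst c"
  shows "alternating n p (raise_indices M p \<beta> c x)"
  unfolding alternating_def
proof (intro ballI allI impI)
  fix ns \<sigma> assume ns: "ns \<in> index_lists n p" and \<sigma>: "\<sigma> permutes {..<p}"
  let ?h = "inverse_metric M c x" and ?I = "index_lists n p"
  have len: "length ks = p" if "ks \<in> ?I" for ks using that by (simp add: index_lists_def)
  have "raise_indices M p \<beta> c x (permute_list \<sigma> ns)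
      = (\<Sum>ks\<in>?I. (\<Prod>a<p. ?h (permute_list \<sigma> ns ! a) (permute_list \<sigma> ks ! a)) * \<beta> c x (permute_list \<sigma> ks))"
    unfolding raise_indices_def by (rule sum_index_lists_permute[OF \<sigma>, symmetric])
  also have "\<dots> = (\<Sum>ks\<in>?I. of_int (sign \<sigma>) * ((\<Prod>a<p. ?h (ns ! a) (ks ! a)) * \<beta> c x ks))"
  proof (intro sum.cong refl)
    fix ks assume ks: "ks \<in> ?I"
    have "(\<Prod>a<p. ?h (permute_list \<sigma> ns ! a) (permute_list \<sigma> ks ! a)) = (\<Prod>a<p. ?h (ns ! \<sigma> a) (ks ! \<sigma> a))"
      using \<sigma> len[OF ks] len[OF ns] by (intro prod.cong) (simp_all add: permute_list_nth)
    also have "\<dots> = (\<Prod>a<p. ?h (ns ! a) (ks ! a))"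
      using prod.permute[OF \<sigma>, of "\<lambda>a. ?h (ns ! a) (ks ! a)"] by (simp add: o_def)
    finally show "(\<Prod>a<p. ?h (permute_list \<sigma> ns ! a) (permute_list \<sigma> ks ! a)) * \<beta> c x (permute_list \<sigma> ks)
        = of_int (sign \<sigma>) * ((\<Prod>a<p. ?h (ns ! a) (ks ! a)) * \<beta> c x ks)"
      using alternatingD[OF form_alternating[OF \<beta>] ks \<sigma>] by simp
  qed
  also have "\<dots> = of_int (sign \<sigma>) * raise_indices M p \<beta> c x ns"
    by (simp only: raise_indices_def sum_distrib_left)
  finally show "raise_indices M p \<beta> c x (permute_list \<sigma> ns) = of_int (sign \<sigma>) * raise_indices M p \<beta> c x ns" .
qed

text \<open>The sign in the wedge cancels the one produced by the Levi-Civita symbol. What remains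
  depends only on the first p values of the permutation, and these run through all repetition-free
  lists equally often. The constant k is 1/p!, the same for all charts and points.\<close>

lemma inner_density_eq:
  assumes \<beta>: "\<beta> \<in> forms M p" and p: "p \<le> n"
  shows "\<exists>k>0. \<forall>c\<in>atlas M. \<forall>x\<in>fst c. \<forall>\<alpha>\<in>forms M p.
    inner_density p \<alpha> \<beta> c x = k * sqrt (Determinant.det (square_mat n (metric M c x))) *
      (\<Sum>ks\<in>index_lists n p. \<alpha> c x ks * raise_indices M p \<beta> c x ks)"
proof -
  obtain m :: nat where m: "m > 0" and sum_take: "\<And>f :: nat list \<Rightarrow> real.
      (\<Sum>\<sigma> | \<sigma> permutes {..<n}. f (take p (map \<sigma> [0..<n])))
      = of_nat m * (\<Sum>ks | ks \<in> index_lists n p \<and> distinct ks. f ks)"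
    using sum_permutations_take[OF p] by blast
  define k :: real where "k = of_nat m / (fact p * fact (n - p))"
  have "inner_density p \<alpha> \<beta> c x = k * sqrt (Determinant.det (square_mat n (metric M c x))) *
      (\<Sum>ks\<in>index_lists n p. \<alpha> c x ks * raise_indices M p \<beta> c x ks)"
    if c: "c \<in> atlas M" "x \<in> fst c" and \<alpha>: "\<alpha> \<in> forms M p" for c x \<alpha>
  proof -
    let ?s = "sqrt (Determinant.det (square_mat n (metric M c x)))" and ?R = "raise_indices M p \<beta> c x"
    let ?P = "{\<sigma>. \<sigma> permutes {..<n}}" and ?I = "index_lists n p"
    have "inner_density p \<alpha> \<beta> c x = (\<Sum>\<sigma>\<in>?P. of_int (sign \<sigma>) * \<alpha> c x (take p (permute_list \<sigma> [0..<n])) *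
        hodge_star M p \<beta> c x (drop p (permute_list \<sigma> [0..<n]))) / (fact p * fact (n - p))"
      using p by (simp add: inner_density_def wedge_def)
    also have "(\<Sum>\<sigma>\<in>?P. of_int (sign \<sigma>) * \<alpha> c x (take p (permute_list \<sigma> [0..<n])) *
        hodge_star M p \<beta> c x (drop p (permute_list \<sigma> [0..<n])))
        = (\<Sum>\<sigma>\<in>?P. ?s * (\<alpha> c x (take p (map \<sigma> [0..<n])) * ?R (take p (map \<sigma> [0..<n]))))"
    proof (intro sum.cong refl)
      fix \<sigma> assume "\<sigma> \<in> ?P"
      then have \<sigma>: "\<sigma> permutes {..<n}" by simp
      have "\<sigma> i < n" if "i < n" for i using permutes_in_image[OF \<sigma>, of i] that by auto
      then have pl: "permute_list \<sigma> [0..<n] = map \<sigma> [0..<n]" by (auto simp: permute_list_def)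
      have sq: "real_of_int (sign \<sigma>) * of_int (sign \<sigma>) = 1" by (metis of_int_1 of_int_mult sign_idempotent)
      \<comment> \<open>The p! of the Levi-Civita contraction cancels the denominator of the
        star.\<close>
      have "hodge_star M p \<beta> c x (drop p (map \<sigma> [0..<n])) = ?s * (of_int (sign \<sigma>) * ?R (take p (map \<sigma> [0..<n])))"
        using sum_levi_civita[OF alternating_raise_indices[OF \<beta> c] \<sigma> p] by (simp add: hodge_star_def)
      then show "of_int (sign \<sigma>) * \<alpha> c x (take p (permute_list \<sigma> [0..<n])) *
          hodge_star M p \<beta> c x (drop p (permute_list \<sigma> [0..<n]))
        = ?s * (\<alpha> c x (take p (map \<sigma> [0..<n])) * ?R (take p (map \<sigma> [0..<n])))"
        unfolding pl using sq by (simp add: algebra_simps)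
    qed
    also have "\<dots> = ?s * (\<Sum>\<sigma>\<in>?P. \<alpha> c x (take p (map \<sigma> [0..<n])) * ?R (take p (map \<sigma> [0..<n])))"
      by (simp only: sum_distrib_left)
    also have "(\<Sum>\<sigma>\<in>?P. \<alpha> c x (take p (map \<sigma> [0..<n])) * ?R (take p (map \<sigma> [0..<n])))
        = of_nat m * (\<Sum>ks | ks \<in> ?I \<and> distinct ks. \<alpha> c x ks * ?R ks)"
      by (rule sum_take)
    \<comment> \<open>Lists with a repeated index contribute zero by alternation.\<close>
    also have "(\<Sum>ks | ks \<in> ?I \<and> distinct ks. \<alpha> c x ks * ?R ks) = (\<Sum>ks\<in>?I. \<alpha> c x ks * ?R ks)"
    proof (rule sum.mono_neutral_left)
      show "\<forall>ks\<in>?I - {ks. ks \<in> ?I \<and> distinct ks}. \<alpha> c x ks * ?R ks = 0"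
        using alternating_not_distinct[OF form_alternating[OF \<alpha> c]] by simp
    qed auto
    finally show ?thesis by (simp add: k_def)
  qed
  moreover have "k > 0" using m by (simp add: k_def)
  ultimately show ?thesis by (intro exI[of _ k] conjI ballI)
qed

lemma inner_density_self:
  assumes \<alpha>: "\<alpha> \<in> forms M p" and p: "p \<le> n" and c: "c \<in> atlas M" "x \<in> fst c"
  shows "inner_density p \<alpha> \<alpha> c x \<ge> 0" and "inner_density p \<alpha> \<alpha> c x = 0 \<Longrightarrow> \<alpha> c x ks = 0"
proof -
  obtain k where k: "k > 0" "inner_density p \<alpha> \<alpha> c x = k * sqrt (Determinant.det (square_mat n (metric M c x))) *
      (\<Sum>ks\<in>index_lists n p. \<alpha> c x ks * raise_indices M p \<alpha> c x ks)"
    using inner_density_eq[OF \<alpha> p] c \<alpha> by blast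
  let ?Q = "\<Sum>ks\<in>index_lists n p. \<alpha> c x ks * raise_indices M p \<alpha> c x ks"
  have s: "k * sqrt (Determinant.det (square_mat n (metric M c x))) > 0"
    using k(1) det_metric_pos[OF c] by simp
  have Q: "?Q = (\<Sum>ks\<in>index_lists n p. \<alpha> c x ks *
    (\<Sum>ls\<in>index_lists n p. (\<Prod>a<p. inverse_entries n (metric M c x) (ks ! a) (ls ! a)) * \<alpha> c x ls))"
    by (simp add: raise_indices_def inverse_metric_eq)
  note pos = tensor_power_inverse_positive[OF positive_definite_metric[OF c] Q]
  show "inner_density p \<alpha> \<alpha> c x \<ge> 0" using s pos(1) unfolding k(2) by simp
  assume "inner_density p \<alpha> \<alpha> c x = 0"
  then have "?Q = 0" using s unfolding k(2) by (metis less_irrefl mult_eq_0_iff)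
  then show "\<alpha> c x ks = 0" using pos(2) form_zero[OF \<alpha>] by blast
qed

text \<open>The order of quantifiers is the content: a single partition serves all degrees and all
  pairs of forms, so integrals of different forms can be compared chart by chart.\<close>

lemma form_inner_expansion:
  "\<exists>F \<rho>. partition_of_unity M F \<rho> \<and> (\<forall>p \<alpha> \<beta>. form_inner M p \<alpha> \<beta> =
     (\<Sum>c\<in>F. set_lebesgue_integral (lborel_Rn n) (snd c ` fst c)
       (\<lambda>y. \<rho> c (chart_inv c y) * inner_density p \<alpha> \<beta> c (chart_inv c y))))"
proof -
  define Fr where "Fr = (SOME (F, \<rho>). partition_of_unity M F \<rho>)"
  have "\<exists>Fr. case Fr of (F, \<rho>) \<Rightarrow> partition_of_unity M F \<rho>"
    using partition_of_unity_exists[OF compact] by simp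
  then have "case Fr of (F, \<rho>) \<Rightarrow> partition_of_unity M F \<rho>" unfolding Fr_def by (rule someI_ex)
  then have "partition_of_unity M (fst Fr) (snd Fr)" by (simp add: case_prod_beta)
  moreover have "form_inner M p \<alpha> \<beta> = (\<Sum>c\<in>fst Fr. set_lebesgue_integral (lborel_Rn n) (snd c ` fst c)
       (\<lambda>y. snd Fr c (chart_inv c y) * inner_density p \<alpha> \<beta> c (chart_inv c y)))" for p \<alpha> \<beta>
    by (simp add: form_inner_def form_integral_def Fr_def[symmetric] case_prod_beta inner_density_def)
  ultimately show ?thesis by (intro exI[of _ "fst Fr"] exI[of _ "snd Fr"] conjI allI)
qed

lemma set_integrable_inner_density:
  assumes "partition_of_unity M F \<rho>" "c \<in> F" "\<alpha> \<in> forms M p" "\<beta> \<in> forms M p"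
  shows "set_integrable (lborel_Rn n) (snd c ` fst c) (\<lambda>y. \<rho> c (chart_inv c y) * inner_density p \<alpha> \<beta> c (chart_inv c y))"
    and "continuous_on (snd c ` fst c) (\<lambda>y. \<rho> c (chart_inv c y) * inner_density p \<alpha> \<beta> c (chart_inv c y))"
proof -
  have c: "c \<in> atlas M" using assms(1,2) by (auto simp: partition_of_unity_def)
  note supp = partition_support[OF assms(1,2) compact]
  show cont: "continuous_on (snd c ` fst c) (\<lambda>y. \<rho> c (chart_inv c y) * inner_density p \<alpha> \<beta> c (chart_inv c y))"
    by (intro continuous_on_mult supp(4) continuous_inner_density assms c)
  show "set_integrable (lborel_Rn n) (snd c ` fst c) (\<lambda>y. \<rho> c (chart_inv c y) * inner_density p \<alpha> \<beta> c (chart_inv c y))"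
    using supp(3) by (intro set_integrable_compact_support[OF supp(1,2) continuous_on_subset[OF cont supp(2)]]) simp
qed

lemma form_inner_add_scale_right:
  assumes "\<alpha> \<in> forms M p" "\<beta> \<in> forms M p" "\<gamma> \<in> forms M p"
  shows "form_inner M p \<alpha> (\<beta> + form_scale r \<gamma>) = form_inner M p \<alpha> \<beta> + r * form_inner M p \<alpha> \<gamma>"
proof -
  obtain F \<rho> where P: "partition_of_unity M F \<rho>" and
    I: "\<forall>p \<alpha> \<beta>. form_inner M p \<alpha> \<beta> = (\<Sum>c\<in>F. set_lebesgue_integral (lborel_Rn n) (snd c ` fst c)
       (\<lambda>y. \<rho> c (chart_inv c y) * inner_density p \<alpha> \<beta> c (chart_inv c y)))"
    using form_inner_expansion by blast
  show ?thesis
    unfolding I[rule_format] sum_distrib_left sum.distrib[symmetric]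
  proof (intro sum.cong refl)
    fix c assume c: "c \<in> F"
    note i1 = set_integrable_inner_density(1)[OF P c assms(1,2)]
    note i2 = set_integrable_inner_density(1)[OF P c assms(1,3)]
    show "set_lebesgue_integral (lborel_Rn n) (snd c ` fst c)
        (\<lambda>y. \<rho> c (chart_inv c y) * inner_density p \<alpha> (\<beta> + form_scale r \<gamma>) c (chart_inv c y))
      = set_lebesgue_integral (lborel_Rn n) (snd c ` fst c) (\<lambda>y. \<rho> c (chart_inv c y) * inner_density p \<alpha> \<beta> c (chart_inv c y))
      + r * set_lebesgue_integral (lborel_Rn n) (snd c ` fst c) (\<lambda>y. \<rho> c (chart_inv c y) * inner_density p \<alpha> \<gamma> c (chart_inv c y))"
      using set_integral_add(2)[OF i1 set_integrable_mult_right[of r, OF i2]]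
      by (simp add: inner_density_add_scale_right distrib_left mult.left_commute)
  qed
qed

lemma form_inner_add_scale_left:
  assumes "\<alpha> \<in> forms M p" "\<beta> \<in> forms M p" "\<gamma> \<in> forms M p"
  shows "form_inner M p (\<alpha> + form_scale r \<gamma>) \<beta> = form_inner M p \<alpha> \<beta> + r * form_inner M p \<gamma> \<beta>"
proof -
  obtain F \<rho> where P: "partition_of_unity M F \<rho>" and
    I: "\<forall>p \<alpha> \<beta>. form_inner M p \<alpha> \<beta> = (\<Sum>c\<in>F. set_lebesgue_integral (lborel_Rn n) (snd c ` fst c)
       (\<lambda>y. \<rho> c (chart_inv c y) * inner_density p \<alpha> \<beta> c (chart_inv c y)))"
    using form_inner_expansion by blast
  show ?thesis
    unfolding I[rule_format] sum_distrib_left sum.distrib[symmetric]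
  proof (intro sum.cong refl)
    fix c assume c: "c \<in> F"
    note i1 = set_integrable_inner_density(1)[OF P c assms(1,2)]
    note i2 = set_integrable_inner_density(1)[OF P c assms(3,2)]
    show "set_lebesgue_integral (lborel_Rn n) (snd c ` fst c)
        (\<lambda>y. \<rho> c (chart_inv c y) * inner_density p (\<alpha> + form_scale r \<gamma>) \<beta> c (chart_inv c y))
      = set_lebesgue_integral (lborel_Rn n) (snd c ` fst c) (\<lambda>y. \<rho> c (chart_inv c y) * inner_density p \<alpha> \<beta> c (chart_inv c y))
      + r * set_lebesgue_integral (lborel_Rn n) (snd c ` fst c) (\<lambda>y. \<rho> c (chart_inv c y) * inner_density p \<gamma> \<beta> c (chart_inv c y))"
      using set_integral_add(2)[OF i1 set_integrable_mult_right[of r, OF i2]]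
      by (simp add: inner_density_add_scale_left distrib_left mult.left_commute)
  qed
qed

lemma form_inner_definite:
  assumes \<alpha>: "\<alpha> \<in> forms M p" and p: "p \<le> n" and 0: "form_inner M p \<alpha> \<alpha> = 0"
  shows "\<alpha> = 0"
proof -
  obtain F \<rho> where P: "partition_of_unity M F \<rho>" and
    I: "\<forall>p \<alpha> \<beta>. form_inner M p \<alpha> \<beta> = (\<Sum>c\<in>F. set_lebesgue_integral (lborel_Rn n) (snd c ` fst c)
       (\<lambda>y. \<rho> c (chart_inv c y) * inner_density p \<alpha> \<beta> c (chart_inv c y)))"
    using form_inner_expansion by blast
  have F: "finite F" "\<And>c. c \<in> F \<Longrightarrow> c \<in> atlas M"
    and \<rho>0: "\<And>c x. c \<in> F \<Longrightarrow> x \<in> topspace (points M) \<Longrightarrow> \<rho> c x \<ge> 0"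
    and \<rho>1: "\<And>x. x \<in> topspace (points M) \<Longrightarrow> (\<Sum>c\<in>F. \<rho> c x) = 1"
    and supp: "\<And>c. c \<in> F \<Longrightarrow> points M closure_of {x \<in> topspace (points M). \<rho> c x \<noteq> 0} \<subseteq> fst c"
    using P unfolding partition_of_unity_def by blast+
  let ?g = "\<lambda>c y. \<rho> c (chart_inv c y) * inner_density p \<alpha> \<alpha> c (chart_inv c y)"
  have nonneg: "?g c y \<ge> 0" if c: "c \<in> F" and y: "y \<in> snd c ` fst c" for c y
  proof -
    obtain x where x: "x \<in> fst c" "y = snd c x" using y by blast
    have "x \<in> topspace (points M)" using x(1) fst_subset[OF F(2)[OF c]] by blast
    then show ?thesis
      using inner_density_self(1)[OF \<alpha> p F(2)[OF c] x(1)] \<rho>0[OF c] x F(2)[OF c] by simp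
  qed
  have int0: "set_lebesgue_integral (lborel_Rn n) (snd c ` fst c) (?g c) \<ge> 0" if "c \<in> F" for c
    unfolding set_lebesgue_integral_def
    using nonneg[OF that] by (intro integral_nonneg_AE AE_I2) (simp add: indicator_def)
  have "(\<Sum>c\<in>F. set_lebesgue_integral (lborel_Rn n) (snd c ` fst c) (?g c)) = 0" using 0 I by simp
  then have "set_lebesgue_integral (lborel_Rn n) (snd c ` fst c) (?g c) = 0" if "c \<in> F" for c
    using sum_nonneg_eq_0_iff[OF F(1), of "\<lambda>c. set_lebesgue_integral (lborel_Rn n) (snd c ` fst c) (?g c)"] int0 that
    by simp
  then have g0: "?g c y = 0" if "c \<in> F" "y \<in> snd c ` fst c" for c y
    using set_integral_eq_0_imp[OF openin_image[OF F(2)[OF that(1)]] set_integrable_inner_density(2)[OF P that(1) \<alpha> \<alpha>]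
      nonneg[OF that(1)] set_integrable_inner_density(1)[OF P that(1) \<alpha> \<alpha>] _ that(2)] that(1) by blast
  show ?thesis
  proof (intro ext)
    fix c' x ks
    show "\<alpha> c' x ks = 0 c' x ks"
    proof (cases "c' \<in> atlas M \<and> x \<in> fst c' \<and> ks \<in> index_lists n p")
      case True
      then have x: "x \<in> topspace (points M)" using fst_subset by blast
      \<comment> \<open>The partition functions sum to 1, so one of them is not zero at x; there the
        vanishing product forces the density itself to vanish.\<close>
      obtain c where c: "c \<in> F" "\<rho> c x \<noteq> 0"
        using \<rho>1[OF x] by (metis sum.neutral zero_neq_one)
      have "x \<in> points M closure_of {x \<in> topspace (points M). \<rho> c x \<noteq> 0}"
        using closure_of_subset[of "{x \<in> topspace (points M). \<rho> c x \<noteq> 0}" "points M"] c(2) x by blast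
      then have xc: "x \<in> fst c" using supp[OF c(1)] by blast
      have "inner_density p \<alpha> \<alpha> c x = 0"
        using g0[OF c(1), of "snd c x"] xc c F(2)[OF c(1)] by simp
      then have "\<alpha> c x ls = 0" for ls by (rule inner_density_self(2)[OF \<alpha> p F(2)[OF c(1)] xc])
      \<comment> \<open>The components are known to vanish in the chart \<open>c\<close> of the
        partition; the transformation law carries this to the arbitrary chart
        \<open>c'\<close>.\<close>
      then show ?thesis
        using form_transform[OF \<alpha> _ F(2)[OF c(1)] _ xc, of c' ks] True by simp
    qed (use form_zero[OF \<alpha>] in auto)
  qed
qed

end

section \<open>The Laplace-Beltrami operator\<close>

lemma form_scale_right_zero [simp]: "form_scale r 0 = 0"
  by (simp add: form_scale_def fun_eq_iff)

lemma form_scale_left_zero [simp]: "form_scale 0 \<omega> = 0"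
  by (simp add: form_scale_def fun_eq_iff)

lemma form_scale_one [simp]: "form_scale 1 \<omega> = \<omega>"
  by (simp add: form_scale_def fun_eq_iff)

lemma form_scale_scale [simp]: "form_scale r (form_scale s \<omega>) = form_scale (r * s) \<omega>"
  by (simp add: form_scale_def fun_eq_iff)

lemma form_scale_minus [simp]: "form_scale (- r) \<omega> = - form_scale r \<omega>"
  by (simp add: form_scale_def fun_eq_iff)

locale riemannian_codifferential = compact_riemannian +
  fixes \<delta> :: "'a form \<Rightarrow> 'a form"
  assumes codifferential: "codifferential M \<delta>"
begin

lemma codifferential_form: "\<beta> \<in> forms M (Suc k) \<Longrightarrow> \<delta> \<beta> \<in> forms M k"
  using codifferential unfolding codifferential_def by blast

lemma codifferential_0: "f \<in> forms M 0 \<Longrightarrow> \<delta> f = 0"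
  using codifferential unfolding codifferential_def by blast

lemma codifferential_adjoint:
  "\<beta> \<in> forms M (Suc k) \<Longrightarrow> \<alpha> \<in> forms M k \<Longrightarrow>
    form_inner M (Suc k) (ext_deriv M \<alpha>) \<beta> = form_inner M k \<alpha> (\<delta> \<beta>)"
  using codifferential unfolding codifferential_def by blast

lemma codifferential_add_scale:
  assumes "\<alpha> \<in> forms M k" "\<beta> \<in> forms M k" "k \<le> Suc n"
  shows "\<delta> (\<alpha> + form_scale r \<beta>) = \<delta> \<alpha> + form_scale r (\<delta> \<beta>)"
proof (cases k)
  case 0
  then have "\<delta> (\<alpha> + form_scale r \<beta>) = 0" "\<delta> \<alpha> = 0" "\<delta> \<beta> = 0"
    using assms forms_add_scale[OF assms(1,2)] codifferential_0 by auto
  then show ?thesis by simp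
next
  case (Suc j)
  note \<alpha> = assms(1)[unfolded Suc] and \<beta> = assms(2)[unfolded Suc]
  have j: "j \<le> n" using assms(3) Suc by simp
  let ?s = "\<delta> (\<alpha> + form_scale r \<beta>)" and ?t = "\<delta> \<alpha> + form_scale r (\<delta> \<beta>)"
  have s: "?s \<in> forms M j" by (intro codifferential_form forms_add_scale \<alpha> \<beta>)
  have t: "?t \<in> forms M j" by (intro codifferential_form forms_add_scale \<alpha> \<beta>)
  define e where "e = ?s + form_scale (- 1) ?t"
  have e: "e \<in> forms M j" unfolding e_def by (intro forms_add_scale s t)
  have de: "ext_deriv M e \<in> forms M (Suc j)" by (rule ext_deriv_form[OF e])
  have "form_inner M j e ?s = form_inner M (Suc j) (ext_deriv M e) (\<alpha> + form_scale r \<beta>)"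
    by (rule codifferential_adjoint[OF forms_add_scale[OF \<alpha> \<beta>] e, symmetric])
  also have "\<dots> = form_inner M (Suc j) (ext_deriv M e) \<alpha> + r * form_inner M (Suc j) (ext_deriv M e) \<beta>"
    by (rule form_inner_add_scale_right[OF de \<alpha> \<beta>])
  also have "\<dots> = form_inner M j e (\<delta> \<alpha>) + r * form_inner M j e (\<delta> \<beta>)"
    by (simp only: codifferential_adjoint[OF \<alpha> e] codifferential_adjoint[OF \<beta> e])
  also have "\<dots> = form_inner M j e ?t"
    by (rule form_inner_add_scale_right[OF e codifferential_form[OF \<alpha>] codifferential_form[OF \<beta>], symmetric])
  finally have "form_inner M j e e = 0"
    using form_inner_add_scale_right[OF e s t, of "- 1"] by (simp add: e_def)
  then have "e = 0" by (rule form_inner_definite[OF e j])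
  moreover have "?s - ?t = e"
    unfolding e_def form_scale_minus form_scale_one by (rule diff_conv_add_uminus)
  ultimately have "?s - ?t = 0" by (rule trans[rotated])
  then show ?thesis by (rule eq_iff_diff_eq_0[THEN iffD2])
qed

lemma ext_deriv_zero [simp]: "ext_deriv M 0 = 0"
  \<comment> \<open>For r = -1 linearity expresses the derivative of 0 as a difference of equal
    terms.\<close>
  using ext_deriv_add_scale[OF zero_form zero_form, of "- 1"] by simp

lemma laplacian_add_scale:
  assumes "\<alpha> \<in> forms M p" "\<beta> \<in> forms M p" "p \<le> n"
  shows "laplacian M \<delta> (\<alpha> + form_scale r \<beta>) = laplacian M \<delta> \<alpha> + form_scale r (laplacian M \<delta> \<beta>)"
proof -
  have 1: "\<delta> (\<alpha> + form_scale r \<beta>) = \<delta> \<alpha> + form_scale r (\<delta> \<beta>)"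
    using assms by (intro codifferential_add_scale) auto
  have 2: "\<delta> (ext_deriv M (\<alpha> + form_scale r \<beta>)) = \<delta> (ext_deriv M \<alpha>) + form_scale r (\<delta> (ext_deriv M \<beta>))"
    unfolding ext_deriv_add_scale[OF assms(1,2)]
    by (rule codifferential_add_scale[OF ext_deriv_form[OF assms(1)] ext_deriv_form[OF assms(2)]])
      (use assms(3) in simp)
  have 3: "ext_deriv M (\<delta> \<alpha> + form_scale r (\<delta> \<beta>)) = ext_deriv M (\<delta> \<alpha>) + form_scale r (ext_deriv M (\<delta> \<beta>))"
  \<comment> \<open>On functions \<delta> is zero instead of a form of degree p - 1, so the
    linearity of d is applied only for positive p.\<close>
  proof (cases p)
    case 0
    then show ?thesis using codifferential_0 assms by simp
  next
    case (Suc j)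
    then show ?thesis using assms by (intro ext_deriv_add_scale[of _ j] codifferential_form) auto
  qed
  show ?thesis
    unfolding laplacian_def 1 2 3 by (simp add: form_scale_def fun_eq_iff distrib_left)
qed

lemma laplacian_zero: "p \<le> n \<Longrightarrow> laplacian M \<delta> 0 = 0"
  using laplacian_add_scale[OF zero_form zero_form, where r = "- 1"] by simp

lemma laplacian_scale:
  assumes "\<alpha> \<in> forms M p" "p \<le> n"
  shows "laplacian M \<delta> (form_scale r \<alpha>) = form_scale r (laplacian M \<delta> \<alpha>)"
  using laplacian_add_scale[OF zero_form assms, of r] laplacian_zero[OF assms(2)] by simp

lemma zero_harmonic: "p \<le> n \<Longrightarrow> 0 \<in> harmonic_forms M \<delta> p"
  by (simp add: harmonic_forms_def zero_form laplacian_zero)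

lemma harmonic_perp_add_scale:
  assumes "\<alpha> \<in> harmonic_perp M \<delta> p" "\<beta> \<in> harmonic_perp M \<delta> p"
  shows "\<alpha> + form_scale r \<beta> \<in> harmonic_perp M \<delta> p"
proof -
  have "form_inner M p (\<alpha> + form_scale r \<beta>) h = 0" if h: "h \<in> harmonic_forms M \<delta> p" for h
  proof -
    have "h \<in> forms M p" using h by (simp add: harmonic_forms_def)
    then show ?thesis
      using assms h form_inner_add_scale_left[of \<alpha> p h \<beta> r] by (simp add: harmonic_perp_def)
  qed
  then show ?thesis using assms by (simp add: harmonic_perp_def forms_add_scale)
qed

lemma harmonic_perp_harmonic:
  assumes "\<omega> \<in> harmonic_perp M \<delta> p" "laplacian M \<delta> \<omega> = 0" "p \<le> n"
  shows "\<omega> = 0"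
proof -
  have \<omega>: "\<omega> \<in> forms M p" using assms(1) by (simp add: harmonic_perp_def)
  then have "\<omega> \<in> harmonic_forms M \<delta> p" using assms(2) by (simp add: harmonic_forms_def)
  then have "form_inner M p \<omega> \<omega> = 0" using assms(1) by (simp add: harmonic_perp_def)
  then show ?thesis by (rule form_inner_definite[OF \<omega> assms(3)])
qed

lemma harmonic_proj_perp:
  assumes \<omega>: "\<omega> \<in> harmonic_perp M \<delta> p" and p: "p \<le> n"
  shows "harmonic_proj M \<delta> p \<omega> = 0"
  unfolding harmonic_proj_def
proof (rule the_equality)
  show "0 \<in> harmonic_forms M \<delta> p \<and> \<omega> - 0 \<in> harmonic_perp M \<delta> p"
    using zero_harmonic[OF p] \<omega> by simp
  fix h assume h: "h \<in> harmonic_forms M \<delta> p \<and> \<omega> - h \<in> harmonic_perp M \<delta> p"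
  \<comment> \<open>Any candidate h is the difference of \<omega> and \<omega> - h, hence again
    orthogonal to the harmonic forms, and being harmonic it is zero.\<close>
  have "\<omega> + form_scale (- 1) (\<omega> - h) \<in> harmonic_perp M \<delta> p"
    by (rule harmonic_perp_add_scale[OF \<omega> conjunct2[OF h]])
  moreover have "\<omega> + form_scale (- 1) (\<omega> - h) = h" by (simp add: form_scale_def fun_eq_iff)
  ultimately have "h \<in> harmonic_perp M \<delta> p" by (rule back_subst[of "\<lambda>x. x \<in> _"])
  then show "h = 0"
    by (rule harmonic_perp_harmonic[OF _ _ p]) (use h in \<open>simp add: harmonic_forms_def\<close>)
qed

text \<open>The correspondence holds for each eigenform separately: on the complement the Laplacian
  undoes G and is injective.\<close>

lemma green_eigenvalue_iff:
  assumes G: "green_operator M \<delta> p G" and p: "p \<le> n" and \<omega>: "\<omega> \<in> harmonic_perp M \<delta> p" "\<omega> \<noteq> 0"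
  shows "G \<omega> = form_scale r \<omega> \<longleftrightarrow> r \<noteq> 0 \<and> laplacian M \<delta> \<omega> = form_scale (1 / r) \<omega>"
proof -
  have f: "\<omega> \<in> forms M p" using \<omega> by (simp add: harmonic_perp_def)
  have Gw: "G \<omega> \<in> harmonic_perp M \<delta> p" "laplacian M \<delta> (G \<omega>) = \<omega>"
    using G f harmonic_proj_perp[OF \<omega>(1) p] by (simp_all add: green_operator_def)
  have Gf: "G \<omega> \<in> forms M p" using Gw(1) by (simp add: harmonic_perp_def)
  show ?thesis
  proof
    assume "G \<omega> = form_scale r \<omega>"
    then have *: "form_scale r (laplacian M \<delta> \<omega>) = \<omega>" using Gw(2) laplacian_scale[OF f p] by simp
    \<comment> \<open>With r = 0 the Laplacian of \<open>G \<omega>\<close>, which is \<omega>,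
      would be zero.\<close>
    have "r \<noteq> 0"
    proof
      assume "r = 0"
      then have "\<omega> = 0" using * by simp
      then show False using \<omega>(2) by simp
    qed
    moreover have "form_scale (1 / r) (form_scale r (laplacian M \<delta> \<omega>)) = laplacian M \<delta> \<omega>"
      using \<open>r \<noteq> 0\<close> by simp
    ultimately show "r \<noteq> 0 \<and> laplacian M \<delta> \<omega> = form_scale (1 / r) \<omega>" using * by simp
  next
    assume r: "r \<noteq> 0 \<and> laplacian M \<delta> \<omega> = form_scale (1 / r) \<omega>"
    \<comment> \<open>The Laplacian sends both parts of \<open>e\<close> to \<omega> up to sign, so
      \<open>e\<close> is harmonic as well as orthogonal to the harmonic forms.\<close>
    define e where "e = G \<omega> + form_scale (- r) \<omega>"
    have "e \<in> harmonic_perp M \<delta> p" unfolding e_def by (rule harmonic_perp_add_scale[OF Gw(1) \<omega>(1)])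
    moreover have "laplacian M \<delta> e = \<omega> + form_scale (- r) (form_scale (1 / r) \<omega>)"
      unfolding e_def laplacian_add_scale[OF Gf f p] using r Gw(2) by simp
    then have "laplacian M \<delta> e = 0" using r by simp
    ultimately have "e = 0" by (rule harmonic_perp_harmonic[OF _ _ p])
    then show "G \<omega> = form_scale r \<omega>" by (simp add: e_def)
  qed
qed

end

theorem theorem5:
  fixes M :: "'a riem" and n p :: nat
    and \<delta> G :: "'a form \<Rightarrow> 'a form"
  assumes "oriented_riemannian_manifold M" and "compact_space (points M)"
    and "mdim M = n" and "p \<le> n"
    and "codifferential M \<delta>"
    and "green_operator M \<delta> p G"
  shows "{r. eigenvalue_on (harmonic_perp M \<delta> p) G r} =
         {1 / \<mu> | \<mu>. eigenvalue_on (harmonic_perp M \<delta> p) (laplacian M \<delta>) \<mu> \<and> \<mu> \<noteq> 0}"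
proof -
  interpret riemannian_codifferential M \<delta>
    using assms by unfold_locales (simp_all add: oriented_riemannian_manifold_def)
  have p: "p \<le> mdim M" using assms by simp
  have "eigenvalue_on (harmonic_perp M \<delta> p) G r \<longleftrightarrow>
      r \<noteq> 0 \<and> eigenvalue_on (harmonic_perp M \<delta> p) (laplacian M \<delta>) (1 / r)" for r
    unfolding eigenvalue_on_def using green_eigenvalue_iff[OF assms(6) p, of _ r] by blast
  \<comment> \<open>The substitution \<open>\<mu> = 1 / r\<close> matches the two descriptions; P
    stands for being an eigenvalue of the Laplacian.\<close>
  moreover have "(r \<noteq> 0 \<and> P (1 / r)) \<longleftrightarrow> (\<exists>\<mu>. r = 1 / \<mu> \<and> P \<mu> \<and> \<mu> \<noteq> 0)" for r :: real and P
  proof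
    assume "r \<noteq> 0 \<and> P (1 / r)"
    then show "\<exists>\<mu>. r = 1 / \<mu> \<and> P \<mu> \<and> \<mu> \<noteq> 0" by (intro exI[of _ "1 / r"]) simp
  next
    assume "\<exists>\<mu>. r = 1 / \<mu> \<and> P \<mu> \<and> \<mu> \<noteq> 0"
    then obtain \<mu> where "r = 1 / \<mu>" "P \<mu>" "\<mu> \<noteq> 0" by blast
    then show "r \<noteq> 0 \<and> P (1 / r)" by simp
  qed
  ultimately show ?thesis by simp
qed

end
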